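(* Let $n\le 11$ be a positive integer. Every Latin array of order $n$ contains a near transversal, i.e. a partial transversal of length at least $n-1$. Equivalently, every Latin array of order $n\le 11$ has a diagonal of weight at least $n-1$.
   Context: A Latin array of order $n$ is an $n\times n$ matrix each of whose cells contains a symbol (from an arbitrary set of symbols, not necessarily of size $n$), such that no symbol occurs more than once in any row or in any column. A diagonal of an $n\times n$ array is a selection of $n$ cells, one from each row and one from each column; its weight is the number of distinct symbols on it. A partial transversal of length $\ell$ is a set of $\ell$ cells, no two in the same row or column, no two containing the same symbol. A near transversal in an $n\times n$ array is a partial transversal of length $n-1$. *)

theory Defs
  imports Main
begin

definition latin_array :: "nat \<Rightarrow> (nat \<Rightarrow> nat \<Rightarrow> 'a) \<Rightarrow> bool" where
  "latin_array n A \<longleftrightarrow>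
     (\<forall>i<n. inj_on (\<lambda>j. A i j) {..<n}) \<and> (\<forall>j<n. inj_on (\<lambda>i. A i j) {..<n})"

definition partial_transversal :: "nat \<Rightarrow> (nat \<Rightarrow> nat \<Rightarrow> 'a) \<Rightarrow> (nat \<times> nat) set \<Rightarrow> bool" where
  "partial_transversal n A S \<longleftrightarrow>
     S \<subseteq> {..<n} \<times> {..<n} \<and> inj_on fst S \<and> inj_on snd S \<and> inj_on (\<lambda>(i,j). A i j) S"

end

theory Submission
  imports Defs "HOL-Library.FuncSet"
begin

text \<open>
  Take a partial transversal of maximum length and suppose that it misses two rows and two columns.
  A cell in a missed row and a missed column must carry a symbol of the transversal; exchanging it for
  the transversal cell with that symbol gives another maximum partial transversal with the same symbols.
  Keep one missed column fixed and always move the missed row that did not move last: the exchanges then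
  run through a cycle. Let \<open>g\<close> be the number of rows that are missed at some time of the cycle.
  The remaining \<open>n - g\<close> rows form an independent block, and rearranging the transversal there
  gives \<open>n - g \<ge> 4\<close>, so \<open>g \<le> 7\<close>. An exhaustive search over cycles leaves, up to the starting
  point, a single cycle with \<open>g \<le> 7\<close>; it has 16 exchanges and \<open>g = 6\<close>. Since the same holds with
  rows and columns interchanged and for every transversal reached, all these cycles would have to entry_at
  alike around one transversal, and a case tree shows that this is impossible.
\<close>

section \<open>Exchanges and their cycles\<close>

text \<open>The obstacle is that the counting bound gives no contradiction by itself: in order 11 it
  leaves \<open>g \<le> 7\<close>, and a cycle with \<open>g = 6\<close> survives. The way out is
  that the survivor stays below the bound. After the search, \<open>g \<le> 6\<close> holds for
  every cycle of rows and, by symmetry, of columns, around every transversal with the same symbols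
  in the chosen rows and columns. So in the case tree a seventh line on one cycle already closes a
  case. The tree also starts with much information, since the exceptional cycle fixes the contents
  of all cells that it visits. The constants come from the order: two missed rows leave at most nine
  symbols, hence nine labels in the tree, and seven rows are the two missed ones and the home rows
  of five symbols, hence five labels in the search. In order 12 the counting bound would only be 8,
  and five labels would not be exhaustive.\<close>

text \<open>
  In a configuration \<open>(\<rho>, \<gamma>, x, y, w, q)\<close> the transversal uses the cell \<open>(\<rho> s, \<gamma> s)\<close> for the symbol \<open>s\<close>;
  it misses the rows \<open>x\<close>, \<open>y\<close> and the columns \<open>w\<close>, \<open>q\<close>. The next exchange brings in the cell \<open>(x, w)\<close>.
\<close>

type_synonym ('r, 'c, 's) config = "('s \<Rightarrow> 'r) \<times> ('s \<Rightarrow> 'c) \<times> 'r \<times> 'r \<times> 'c \<times> 'c"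

text \<open>\<open>X\<close> and \<open>Z\<close> have exactly two lines more than there are
  symbols, so a configuration can name all missed lines. Indexing a transversal by its symbols keeps
  the index set \<open>S\<close> constant under exchanges.\<close>

locale deficient =
  fixes X :: "'r set" and Z :: "'c set" and A :: "'r \<Rightarrow> 'c \<Rightarrow> 's" and S :: "'s set"
  assumes finite_X: "finite X" and finite_Z: "finite Z" and finite_S: "finite S"
    and card_X: "card X = card S + 2" and card_Z: "card Z = card S + 2"
    and row_inj: "r \<in> X \<Longrightarrow> inj_on (A r) Z"
    and col_inj: "c \<in> Z \<Longrightarrow> inj_on (\<lambda>r. A r c) X"
    and maximal: "finite T \<Longrightarrow> inj_on \<rho> T \<Longrightarrow> inj_on \<gamma> T \<Longrightarrow> \<rho> ` T \<subseteq> X \<Longrightarrow> \<gamma> ` T \<subseteq> Z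
      \<Longrightarrow> (\<And>s. s \<in> T \<Longrightarrow> A (\<rho> s) (\<gamma> s) = s) \<Longrightarrow> card T \<le> card S"
begin

definition rainbow :: "'s set \<Rightarrow> ('s \<Rightarrow> 'r) \<Rightarrow> ('s \<Rightarrow> 'c) \<Rightarrow> bool" where
  "rainbow T \<rho> \<gamma> \<longleftrightarrow> inj_on \<rho> T \<and> inj_on \<gamma> T \<and> \<rho> ` T \<subseteq> X \<and> \<gamma> ` T \<subseteq> Z \<and> (\<forall>s\<in>T. A (\<rho> s) (\<gamma> s) = s)"

lemma rainbow_card: "rainbow T \<rho> \<gamma> \<Longrightarrow> finite T \<Longrightarrow> card T \<le> card S"
  unfolding rainbow_def by (rule maximal) auto

text \<open>This serves two purposes. If \<open>A x w\<close> is a new symbol, the transversal gets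
  longer, against maximality; if it is already in \<open>T\<close>, the \<open>insert\<close> is
  void and this is the exchange.\<close>

lemma rainbow_upd:
  assumes "rainbow T \<rho> \<gamma>" "x \<in> X - \<rho> ` T" "w \<in> Z - \<gamma> ` T"
  shows "rainbow (insert (A x w) T) (\<rho>(A x w := x)) (\<gamma>(A x w := w))"
proof -
  let ?s = "A x w"
  have 1: "inj_on (\<rho>(?s := x)) (insert ?s T)" "inj_on (\<gamma>(?s := w)) (insert ?s T)"
    using assms unfolding rainbow_def inj_on_def by (auto split: if_splits)
  show ?thesis using 1 assms unfolding rainbow_def by (auto split: if_splits)
qed

lemma uncovered_in:
  assumes "rainbow T \<rho> \<gamma>" "finite T" "card T = card S" "x \<in> X - \<rho> ` T" "w \<in> Z - \<gamma> ` T"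
  shows "A x w \<in> T"
proof (rule ccontr)
  assume "A x w \<notin> T"
  then show False
    using rainbow_card[OF rainbow_upd[OF assms(1,4,5)]] assms(2,3) by simp
qed

text \<open>The extensional function spaces make a configuration determined by its values on
  \<open>S\<close>. Thus there are finitely many of them, and agreement on \<open>S\<close> becomes
  equality when a cycle closes.\<close>

fun valid :: "('r, 'c, 's) config \<Rightarrow> bool" where
  "valid (\<rho>, \<gamma>, x, y, w, q) \<longleftrightarrow> rainbow S \<rho> \<gamma> \<and> \<rho> \<in> S \<rightarrow>\<^sub>E X \<and> \<gamma> \<in> S \<rightarrow>\<^sub>E Z
     \<and> x \<noteq> y \<and> w \<noteq> q \<and> {x, y} \<subseteq> X - \<rho> ` S \<and> {w, q} \<subseteq> Z - \<gamma> ` S"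

fun exchange :: "('r, 'c, 's) config \<Rightarrow> ('r, 'c, 's) config" where
  "exchange (\<rho>, \<gamma>, x, y, w, q) = (\<rho>(A x w := x), \<gamma>(A x w := w), \<rho> (A x w), y, \<gamma> (A x w), q)"

fun flip_rows :: "('r, 'c, 's) config \<Rightarrow> ('r, 'c, 's) config" where
  "flip_rows (\<rho>, \<gamma>, x, y, w, q) = (\<rho>, \<gamma>, y, x, w, q)"

fun flip_cols :: "('r, 'c, 's) config \<Rightarrow> ('r, 'c, 's) config" where
  "flip_cols (\<rho>, \<gamma>, x, y, w, q) = (\<rho>, \<gamma>, x, y, q, w)"

fun row where "row (\<rho>, \<gamma>, x, y, w, q) = x"
fun col where "col (\<rho>, \<gamma>, x, y, w, q) = w"
definition cell_sym where "cell_sym C = A (row C) (col C)"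

lemma valid_flip_rows: "valid C \<Longrightarrow> valid (flip_rows C)"
  by (cases C rule: valid.cases) auto

lemma valid_flip_cols: "valid C \<Longrightarrow> valid (flip_cols C)"
  by (cases C rule: valid.cases) auto

lemma valid_cell_sym: "valid C \<Longrightarrow> cell_sym C \<in> S"
  by (cases C rule: valid.cases) (auto simp: cell_sym_def intro!: uncovered_in finite_S)

lemma valid_exchange:
  assumes "valid C" shows "valid (exchange C)"
proof (cases C rule: valid.cases)
  case (1 \<rho> \<gamma> x y w q)
  let ?s = "A x w"
  have v: "valid (\<rho>, \<gamma>, x, y, w, q)" using assms 1 by simp
  have s: "?s \<in> S" using valid_cell_sym[OF v] by (simp add: cell_sym_def)
  have rb: "rainbow S \<rho> \<gamma>" and x: "x \<in> X - \<rho> ` S" and w: "w \<in> Z - \<gamma> ` S" using v by auto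
  have "rainbow S (\<rho>(?s := x)) (\<gamma>(?s := w))"
    using rainbow_upd[OF rb x w] s by (simp add: insert_absorb)
  moreover have "\<rho>(?s := x) \<in> S \<rightarrow>\<^sub>E X" "\<gamma>(?s := w) \<in> S \<rightarrow>\<^sub>E Z"
    using v s by (auto simp: PiE_iff extensional_def)
  moreover have im: "\<rho> ?s \<in> \<rho> ` S" "\<gamma> ?s \<in> \<gamma> ` S" using s by auto
  then have ne: "\<rho> ?s \<noteq> y" "\<gamma> ?s \<noteq> q" "\<rho> ?s \<noteq> x" "\<gamma> ?s \<noteq> w" using v by auto
  moreover have "\<rho> ?s \<notin> \<rho> ` (S - {?s})" "\<gamma> ?s \<notin> \<gamma> ` (S - {?s})" "\<rho> ?s \<in> X" "\<gamma> ?s \<in> Z"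
    using rb s unfolding rainbow_def inj_on_def by auto
  then have "{\<rho> ?s, y} \<subseteq> X - \<rho>(?s := x) ` S" "{\<gamma> ?s, q} \<subseteq> Z - \<gamma>(?s := w) ` S"
    using v s ne by (auto split: if_splits)
  ultimately show ?thesis using 1 v ne by simp
qed

text \<open>A bare \<open>exchange\<close> undoes itself when repeated, because the freed cell
  carries the symbol just moved. Flipping the rows makes the motion go on, and the same observation
  makes \<open>step\<close> reversible.\<close>

definition step where "step C = flip_rows (exchange C)"

lemma step_simp [simp]:
  "step (\<rho>, \<gamma>, x, y, w, q) = (\<rho>(A x w := x), \<gamma>(A x w := w), y, \<rho> (A x w), \<gamma> (A x w), q)"
  by (simp add: step_def)

lemma valid_step: "valid C \<Longrightarrow> valid (step C)"
  by (simp add: step_def valid_flip_rows valid_exchange)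

lemma valid_steps: "valid C \<Longrightarrow> valid ((step ^^ i) C)"
  by (induction i) (auto simp: valid_step)

lemma step_back: "valid C \<Longrightarrow> flip_rows (step (flip_rows (step C))) = C"
proof (cases C rule: valid.cases)
  case (1 \<rho> \<gamma> x y w q)
  assume "valid C"
  then have "A x w \<in> S" "rainbow S \<rho> \<gamma>" using valid_cell_sym[of C] 1 by (auto simp: cell_sym_def)
  then have "A (\<rho> (A x w)) (\<gamma> (A x w)) = A x w" by (auto simp: rainbow_def)
  then show ?thesis using 1 by (simp add: step_def)
qed

lemma step_inj: "inj_on step {C. valid C}"
  by (rule inj_on_inverseI[where g = "\<lambda>C. flip_rows (step (flip_rows C))"]) (simp add: step_back)

lemma finite_valid: "finite {C. valid C}"
proof (rule finite_subset)
  show "{C. valid C} \<subseteq> (S \<rightarrow>\<^sub>E X) \<times> (S \<rightarrow>\<^sub>E Z) \<times> X \<times> X \<times> Z \<times> Z"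
    by (auto elim!: valid.elims)
  show "finite ((S \<rightarrow>\<^sub>E X) \<times> (S \<rightarrow>\<^sub>E Z) \<times> X \<times> X \<times> Z \<times> Z)"
    by (intro finite_cartesian_product finite_PiE finite_S finite_X finite_Z)
qed

lemma periodic:
  assumes "valid C" obtains p where "p > 0" "(step ^^ p) C = C"
proof -
  have "range (\<lambda>i. (step ^^ i) C) \<subseteq> {C. valid C}" using valid_steps[OF assms] by auto
  then have "finite (range (\<lambda>i. (step ^^ i) C))" using finite_valid finite_subset by blast
  then have "\<not> inj (\<lambda>i. (step ^^ i) C)" using finite_imageD infinite_UNIV_nat by blast
  then obtain i j where "i \<noteq> j" "(step ^^ i) C = (step ^^ j) C" unfolding inj_on_def by auto
  then obtain i p where ip: "p > 0" "(step ^^ (i + p)) C = (step ^^ i) C"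
    by (metis add_diff_inverse_nat less_imp_le linorder_neqE_nat not_le zero_less_diff)
  have "(step ^^ (i + p)) C = (step ^^ i) C \<Longrightarrow> (step ^^ p) C = C" for i
  proof (induction i)
    case (Suc i)
    have "step ((step ^^ (i + p)) C) = step ((step ^^ i) C)" using Suc.prems by simp
    then have "(step ^^ (i + p)) C = (step ^^ i) C"
      using step_inj valid_steps[OF assms] unfolding inj_on_def by blast
    then show ?case by (rule Suc.IH)
  qed simp
  then show ?thesis using that ip by blast
qed

text \<open>Recording the first missed row is enough: the second one becomes the first at the next
  step.\<close>

definition orbit_rows where "orbit_rows C = range (\<lambda>i. row ((step ^^ i) C))"

lemma orbit_rows_steps:
  assumes "valid C" shows "orbit_rows ((step ^^ j) C) = orbit_rows C"
proof
  show "orbit_rows ((step ^^ j) C) \<subseteq> orbit_rows C"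
  proof -
    have "row ((step ^^ i) ((step ^^ j) C)) = row ((step ^^ (i + j)) C)" for i by (simp add: funpow_add)
    then show ?thesis unfolding orbit_rows_def by auto
  qed
  obtain p where p: "p > 0" "(step ^^ p) C = C" using periodic[OF assms] .
  have per: "(step ^^ (k * p)) C = C" for k
    by (induction k) (simp_all add: funpow_add p)
  have "row ((step ^^ i) C) \<in> orbit_rows ((step ^^ j) C)" for i
  proof -
    have "j \<le> j * p" using p by simp
    then obtain k where k: "j * p = k + j" by (metis le_iff_add add.commute)
    have "(step ^^ i) C = (step ^^ (i + (k + j))) C"
      using per[of j] k by (simp add: funpow_add)
    also have "\<dots> = (step ^^ (i + k)) ((step ^^ j) C)"
      by (simp add: funpow_add add.assoc[symmetric])
    finally show ?thesis unfolding orbit_rows_def by auto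
  qed
  then show "orbit_rows C \<subseteq> orbit_rows ((step ^^ j) C)" unfolding orbit_rows_def by auto
qed

end

section \<open>The rows outside a cycle\<close>

text \<open>Two matchings of the outside rows that leave the same column free bound the cells of
  that column in \<open>R\<close> by \<open>T \<union> P\<close> and by \<open>T \<union> Q\<close>.
  Distinct cells of a column have distinct symbols, so \<open>R\<close> has two symbols too many for
  \<open>T\<close>, and these lie in both \<open>P\<close> and \<open>Q\<close>.\<close>

lemma card_inter_ge:
  fixes f :: "'r \<Rightarrow> 's"
  assumes "inj_on f R" "f ` R \<subseteq> T \<union> P" "f ` R \<subseteq> T \<union> Q" "finite T" "finite P" "card R = card T + 2"
  shows "2 \<le> card (P \<inter> Q)"
proof -
  have "card R = card (f ` R)" by (simp add: assms card_image)
  also have "\<dots> \<le> card (T \<union> (P \<inter> Q))"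
    using assms by (intro card_mono) auto
  also have "\<dots> \<le> card T + card (P \<inter> Q)" by (rule card_Un_le)
  finally show ?thesis using assms by simp
qed

text \<open>\<open>W\<close> collects rows that are not fresh. With two outside symbols none can
  exist, with three at most one.\<close>

lemma card_nonfresh:
  fixes f :: "'r \<Rightarrow> 's"
  assumes "inj_on f (R \<union> W)" "f ` (R \<union> W) \<subseteq> T \<union> P" "R \<inter> W = {}" "finite R" "finite W" "finite T" "finite P"
    and "card R = card T + 2"
  shows "card W + 2 \<le> card P"
proof -
  have "card R + card W = card (f ` (R \<union> W))"
    using assms by (simp add: card_image card_Un_disjoint)
  also have "\<dots> \<le> card (T \<union> P)"
    using assms by (intro card_mono) auto
  also have "\<dots> \<le> card T + card P" by (rule card_Un_le)
  finally show ?thesis using assms by simp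
qed

text \<open>
  Here \<open>R\<close> consists of the rows of a cycle and \<open>T\<close> of the symbols that it moves. If the three rows \<open>Y\<close>
  outside the cycle are matched with columns so that only \<open>d\<close> stays free, then each row of \<open>R\<close> is missed at
  some time together with \<open>d\<close>; by maximality column \<open>d\<close> shows in \<open>R\<close> only \<open>T\<close> and the three used symbols.
  A row of \<open>Y\<close> is fresh if its cell in column \<open>d\<close> carries none of these symbols, so that it can move to \<open>d\<close>.
\<close>

locale block3 =
  fixes A :: "'r \<Rightarrow> 'c \<Rightarrow> 's" and R Y :: "'r set" and D :: "'c set" and T :: "'s set"
  assumes row_inj: "y \<in> Y \<Longrightarrow> inj_on (A y) D"
    and col_inj: "d \<in> D \<Longrightarrow> inj_on (\<lambda>r. A r d) (R \<union> Y)"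
    and fin: "finite R" "finite T" and card_R: "card R = card T + 2" and disj: "R \<inter> Y = {}"
    and avoid: "\<lbrakk>distinct [a, b, c]; {a, b, c} \<subseteq> Y; distinct [i, j, k, d]; {i, j, k, d} \<subseteq> D;
        distinct [A a i, A b j, A c k]; {A a i, A b j, A c k} \<inter> T = {}\<rbrakk>
      \<Longrightarrow> (\<lambda>r. A r d) ` R \<subseteq> T \<union> {A a i, A b j, A c k}"
begin

definition good where "good a b c i j k d \<longleftrightarrow> distinct [a, b, c] \<and> {a, b, c} \<subseteq> Y \<and>
  distinct [i, j, k, d] \<and> {i, j, k, d} \<subseteq> D \<and> distinct [A a i, A b j, A c k] \<and> {A a i, A b j, A c k} \<inter> T = {}"

definition two_fresh_rows where "two_fresh_rows a b c i j k d \<longleftrightarrow> good a b c i j k d \<and>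
  A a d \<notin> T \<union> {A a i, A b j, A c k} \<and> A b d \<notin> T \<union> {A a i, A b j, A c k}"

lemma inter:
  assumes "good a b c i j k d" "good a' b' c' i' j' k' d"
  shows "2 \<le> card ({A a i, A b j, A c k} \<inter> {A a' i', A b' j', A c' k'})"
proof (rule card_inter_ge[where R = R and T = T and f = "\<lambda>r. A r d"])
  show "inj_on (\<lambda>r. A r d) R"
    by (rule inj_on_subset[OF col_inj]) (use assms in \<open>auto simp: good_def\<close>)
  show "(\<lambda>r. A r d) ` R \<subseteq> T \<union> {A a i, A b j, A c k}" "(\<lambda>r. A r d) ` R \<subseteq> T \<union> {A a' i', A b' j', A c' k'}"
    using avoid assms unfolding good_def by metis+
qed (auto simp: fin card_R)

text \<open>Two rows that are not fresh would need four symbols on the matching, which has three.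
  Hence at least two of any three outside rows are fresh.\<close>

lemma fresh_or_fresh:
  assumes "good a b c i j k d" "y \<in> Y" "y' \<in> Y" "y \<noteq> y'"
  shows "A y d \<notin> T \<union> {A a i, A b j, A c k} \<or> A y' d \<notin> T \<union> {A a i, A b j, A c k}"
proof (rule ccontr)
  assume *: "\<not> ?thesis"
  have "card {y, y'} + 2 \<le> card {A a i, A b j, A c k}"
  proof (rule card_nonfresh[where f = "\<lambda>r. A r d" and R = R and T = T])
    show "inj_on (\<lambda>r. A r d) (R \<union> {y, y'})"
      by (rule inj_on_subset[OF col_inj]) (use assms in \<open>auto simp: good_def\<close>)
    have "(\<lambda>r. A r d) ` R \<subseteq> T \<union> {A a i, A b j, A c k}"
      by (rule avoid) (use assms(1) in \<open>auto simp: good_def\<close>)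
    then show "(\<lambda>r. A r d) ` (R \<union> {y, y'}) \<subseteq> T \<union> {A a i, A b j, A c k}"
      using * by auto
  qed (use fin card_R disj assms in auto)
  also have "\<dots> \<le> 3" by (simp add: card_insert_if)
  finally show False using assms by simp
qed

lemma good_perm: "good a b c i j k d \<longleftrightarrow> good b a c j i k d"
  unfolding good_def by auto

lemma two_fresh_rows_swap: "two_fresh_rows a b c i j k d \<longleftrightarrow> two_fresh_rows b a c j i k d"
  unfolding two_fresh_rows_def by (subst good_perm) auto

lemma eq_row: "y \<in> Y \<Longrightarrow> i \<in> D \<Longrightarrow> j \<in> D \<Longrightarrow> A y i = A y j \<longleftrightarrow> i = j"
  using row_inj by (meson inj_on_eq_iff)

lemma eq_col: "y \<in> Y \<Longrightarrow> z \<in> Y \<Longrightarrow> i \<in> D \<Longrightarrow> A y i = A z i \<longleftrightarrow> y = z"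
  using col_inj by (metis (no_types, lifting) UnCI inj_on_eq_iff)

lemma card_inter_le1: "P \<inter> Q \<subseteq> {x} \<Longrightarrow> card (P \<inter> Q) \<le> 1"
  using card_mono[of "{x}" "P \<inter> Q"] by simp

text \<open>Moving the fresh row \<open>a\<close> to \<open>d\<close> frees \<open>i\<close>. Row
  \<open>b\<close> is not fresh there: otherwise moving it on to \<open>i\<close>, and moving
  \<open>b\<close> instead of \<open>a\<close> to \<open>d\<close>, would give two matchings that
  both leave \<open>j\<close> free and share only the symbol \<open>A c k\<close>. So
  \<open>c\<close> must be fresh, and \<open>a\<close> is fresh because it can return.\<close>

lemma two_fresh_rows_rotate:
  assumes "two_fresh_rows a b c i j k d" shows "two_fresh_rows a c b d k j i"
proof -
  have g: "good a b c i j k d" using assms by (simp add: two_fresh_rows_def)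
  note eqs = eq_row eq_col
  have g1: "good a b c d j k i" using assms unfolding two_fresh_rows_def good_def by auto
  have g2: "good a b c i d k j" using assms unfolding two_fresh_rows_def good_def by auto
  have "A b i \<in> T \<union> {A a d, A b j, A c k}"
  proof (rule ccontr)
    assume n: "A b i \<notin> T \<union> {A a d, A b j, A c k}"
    then have "good a b c d i k j" using g1 unfolding good_def by auto
    from inter[OF this g2] have "2 \<le> card ({A a d, A b i, A c k} \<inter> {A a i, A b d, A c k})" .
    moreover have "{A a d, A b i, A c k} \<inter> {A a i, A b d, A c k} \<subseteq> {A c k}"
      using g eqs unfolding good_def by auto
    ultimately show False using card_inter_le1 by fastforce
  qed
  then have "A c i \<notin> T \<union> {A a d, A b j, A c k}"
    using fresh_or_fresh[OF g1, of b c] g unfolding good_def by auto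
  moreover have "A a i \<notin> T \<union> {A a d, A b j, A c k}"
    using g eqs unfolding good_def by auto
  ultimately show ?thesis using g1 unfolding two_fresh_rows_def good_def by auto
qed

text \<open>
  Moving the fresh rows in the two possible orders gives two sequences of matchings. Whenever both leave the
  same column free, their symbol sets share two symbols, which forces more and more coincidences of symbols.
\<close>

lemma no_two_fresh_rows: "\<not> two_fresh_rows a b c i j k d"
proof
  assume f0: "two_fresh_rows a b c i j k d"
  \<comment> \<open>The digits in the names list the rows moved so far, with 1, 2, 3 for
    \<open>a\<close>, \<open>b\<close>, \<open>c\<close>. The sequences 1, 3, 2, 1 and 2, 3, 1, 2
    end with the same free column \<open>d\<close>; their intermediate matchings pair up at the free
    columns \<open>i\<close>, \<open>j\<close> and \<open>k\<close>.\<close>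
  have f1: "two_fresh_rows a c b d k j i" using two_fresh_rows_rotate[OF f0] .
  have f13: "two_fresh_rows c b a i j d k" using two_fresh_rows_rotate[OF f1[unfolded two_fresh_rows_swap[of a]]] .
  have f132: "two_fresh_rows b a c k d i j" using two_fresh_rows_rotate[OF f13[unfolded two_fresh_rows_swap[of c]]] .
  have f1321: "two_fresh_rows a c b j i k d" using two_fresh_rows_rotate[OF f132[unfolded two_fresh_rows_swap[of b]]] .
  have f2: "two_fresh_rows b c a d k i j" using two_fresh_rows_rotate[OF f0[unfolded two_fresh_rows_swap[of a]]] .
  have f23: "two_fresh_rows c a b j i d k" using two_fresh_rows_rotate[OF f2[unfolded two_fresh_rows_swap[of b]]] .
  have f231: "two_fresh_rows a b c k d j i" using two_fresh_rows_rotate[OF f23[unfolded two_fresh_rows_swap[of c]]] .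
  have f2312: "two_fresh_rows b c a i j k d" using two_fresh_rows_rotate[OF f231[unfolded two_fresh_rows_swap[of a]]] .
  note f0 f1 f13 f132 f1321 f2 f23 f231 f2312
  note g = this[unfolded two_fresh_rows_def, THEN conjunct1]
  have Y: "a \<in> Y" "b \<in> Y" "c \<in> Y" "a \<noteq> b" "a \<noteq> c" "b \<noteq> c"
    and D: "i \<in> D" "j \<in> D" "k \<in> D" "d \<in> D" "distinct [i, j, k, d]"
    using g(1) unfolding good_def by auto
  have two: "False" if "P \<inter> Q \<subseteq> {x}" "2 \<le> card (P \<inter> Q)" for P Q :: "'s set" and x
    using card_inter_le1[OF that(1)] that(2) by simp
  note ne = eq_row[OF Y(1)] eq_row[OF Y(2)] eq_row[OF Y(3)] eq_col[OF Y(1,2)] eq_col[OF Y(1,3)] eq_col[OF Y(2,3)]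
    eq_col[OF Y(2,1)] eq_col[OF Y(3,1)] eq_col[OF Y(3,2)] Y D
  have d0: "distinct [A a i, A b j, A c k]" "A a d \<noteq> A b j" "A a d \<noteq> A c k" "A b d \<noteq> A a i" "A b d \<noteq> A c k"
    using f0 unfolding two_fresh_rows_def good_def by auto
  have 1: "A c i = A b d"
  proof (rule ccontr)
    assume n: "A c i \<noteq> A b d"
    show False by (rule two[OF _ inter[OF g(3) g(7)], of "A c j"]) (use n ne d0 in auto)
  qed
  have 2: "A c j = A a d"
  proof (rule ccontr)
    assume n: "A c j \<noteq> A a d"
    show False by (rule two[OF _ inter[OF g(3) g(7)], of "A c i"]) (use n ne d0 in auto)
  qed
  have 3: "A b k = A a i"
  proof (rule ccontr)
    assume n: "A b k \<noteq> A a i"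
    show False by (rule two[OF _ inter[OF g(4) g(6)], of "A c i"]) (use n ne d0 1 in auto)
  qed
  have 4: "A a k = A b j"
  proof (rule ccontr)
    assume n: "A a k \<noteq> A b j"
    show False by (rule two[OF _ inter[OF g(8) g(2)], of "A c j"]) (use n ne d0 2 in auto)
  qed
  \<comment> \<open>By the four equalities the two final matchings use the symbols
    \<open>{A a j, A b d, A a i}\<close> and \<open>{A b i, A a d, A b j}\<close>. The only
    coincidence still possible is \<open>A a j = A b i\<close>, and two are required.\<close>
  show False
    by (rule two[OF _ inter[OF g(5) g(9)], of "A b i"]) (use ne d0 1 2 3 4 in auto)
qed

lemma not_good: "\<not> good a b c i j k d"
proof
  assume g: "good a b c i j k d"
  then have "A a d \<notin> T \<union> {A a i, A b j, A c k} \<or> A b d \<notin> T \<union> {A a i, A b j, A c k}"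
    and "A a d \<notin> T \<union> {A a i, A b j, A c k} \<or> A c d \<notin> T \<union> {A a i, A b j, A c k}"
    and "A b d \<notin> T \<union> {A a i, A b j, A c k} \<or> A c d \<notin> T \<union> {A a i, A b j, A c k}"
    using fresh_or_fresh[OF g] unfolding good_def by simp_all
  moreover have "good a c b i k j d" "good b c a j k i d" using g unfolding good_def by auto
  ultimately have "two_fresh_rows a b c i j k d \<or> two_fresh_rows a c b i k j d \<or> two_fresh_rows b c a j k i d"
    using g unfolding two_fresh_rows_def by auto
  then show False using no_two_fresh_rows by blast
qed

end

section \<open>At least four rows lie outside every cycle\<close>

context deficient
begin

text \<open>The row of a moved symbol is the first missed row two steps later, so it lies in
  \<open>Q\<close>. A symbol outside \<open>T\<close> would still be at its home row, which is not
  in \<open>Q\<close>; hence only symbols of \<open>T\<close> move. They permute among their own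
  lines and the missed lines other than \<open>q\<close>.\<close>

lemma orbit_core:
  assumes v: "valid (\<rho>, \<gamma>, x, y, w, q)"
  defines "Q \<equiv> orbit_rows (\<rho>, \<gamma>, x, y, w, q)"
  defines "T \<equiv> {s \<in> S. \<rho> s \<in> Q}"
  assumes "(step ^^ i) (\<rho>, \<gamma>, x, y, w, q) = (\<rho>', \<gamma>', x', y', w', q')"
  shows "q' = q \<and> \<rho>' ` T \<union> {x', y'} = \<rho> ` T \<union> {x, y} \<and> \<gamma>' ` T \<union> {w'} = \<gamma> ` T \<union> {w}
    \<and> (\<forall>s\<in>S - T. \<rho>' s = \<rho> s \<and> \<gamma>' s = \<gamma> s)"
  using assms(4)
proof (induction i arbitrary: \<rho>' \<gamma>' x' y' w' q')
  case (Suc i)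
  let ?C = "(\<rho>, \<gamma>, x, y, w, q)"
  obtain \<rho>1 \<gamma>1 x1 y1 w1 q1 where 1: "(step ^^ i) ?C = (\<rho>1, \<gamma>1, x1, y1, w1, q1)" by (metis prod_cases6)
  let ?s = "A x1 w1"
  have v1: "valid (\<rho>1, \<gamma>1, x1, y1, w1, q1)" using valid_steps[OF v, of i] 1 by simp
  have s: "?s \<in> S" using valid_cell_sym[OF v1] by (simp add: cell_sym_def)
  have e: "\<rho>' = \<rho>1(?s := x1)" "\<gamma>' = \<gamma>1(?s := w1)" "x' = y1" "y' = \<rho>1 ?s" "w' = \<gamma>1 ?s" "q' = q1"
    using Suc.prems 1 by auto
  have "row ((step ^^ Suc (Suc i)) ?C) = \<rho>1 ?s" using Suc.prems e by simp
  then have "\<rho>1 ?s \<in> Q" unfolding Q_def orbit_rows_def by (metis rangeI)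
  moreover have "?s \<notin> T \<Longrightarrow> \<rho>1 ?s = \<rho> ?s" using Suc.IH[OF 1] s by blast
  ultimately have "?s \<in> T" using s unfolding T_def by force
  then have im: "\<rho>1 ` T = insert (\<rho>1 ?s) (\<rho>1 ` (T - {?s}))" "\<gamma>1 ` T = insert (\<gamma>1 ?s) (\<gamma>1 ` (T - {?s}))"
    and im': "\<rho>' ` T = insert x1 (\<rho>1 ` (T - {?s}))" "\<gamma>' ` T = insert w1 (\<gamma>1 ` (T - {?s}))"
    unfolding e by auto
  have "\<rho>' ` T \<union> {x', y'} = \<rho>1 ` T \<union> {x1, y1}" unfolding im' unfolding im e(3,4) by blast
  moreover have "\<gamma>' ` T \<union> {w'} = \<gamma>1 ` T \<union> {w1}" unfolding im' unfolding im e(5) by blast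
  moreover have "\<forall>s\<in>S - T. \<rho>' s = \<rho>1 s \<and> \<gamma>' s = \<gamma>1 s" using \<open>?s \<in> T\<close> e by auto
  ultimately show ?case using Suc.IH[OF 1] e by simp
qed auto

text \<open>As \<open>card Q = card T + 2\<close>, the claim is \<open>4 \<le> card (S - T)\<close>.
  The outside rows \<open>Y\<close> have one more column available in \<open>D\<close>, so a
  matching of \<open>Y\<close> leaves one column free. Sizes 0 and 1 fall to counting column
  \<open>q\<close> alone, sizes 2 and 3 to comparing matchings with the same free column.\<close>

theorem card_orbit_rows_le:
  assumes "valid C" shows "card (orbit_rows C) + 2 \<le> card S"
proof -
  obtain \<rho> \<gamma> u v p q where C: "C = (\<rho>, \<gamma>, u, v, p, q)" by (metis prod_cases6)
  define Q where "Q = orbit_rows C"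
  define T where "T = {s \<in> S. \<rho> s \<in> Q}"
  define Y where "Y = \<rho> ` (S - T)"
  define D where "D = insert q (\<gamma> ` (S - T))"
  have val: "valid (\<rho>, \<gamma>, u, v, p, q)" using assms C by simp
  then have rb: "rainbow S \<rho> \<gamma>" by simp
  have TS: "T \<subseteq> S" by (auto simp: T_def)
  have finT: "finite T" using finite_S TS finite_subset by blast
  note core = orbit_core[OF val, folded C, folded Q_def, folded T_def]
  have stp: "\<exists>\<rho>' \<gamma>' x' y' w'. (step ^^ i) C = (\<rho>', \<gamma>', x', y', w', q) \<and> rainbow S \<rho>' \<gamma>'
     \<and> x' \<in> X \<and> x' \<notin> \<rho>' ` S \<and> \<rho>' ` T \<union> {x', y'} = \<rho> ` T \<union> {u, v} \<and> \<gamma>' ` T \<union> {w'} = \<gamma> ` T \<union> {p}" for i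
  proof -
    obtain \<rho>' \<gamma>' x' y' w' q' where 1: "(step ^^ i) C = (\<rho>', \<gamma>', x', y', w', q')" by (metis prod_cases6)
    have "valid (\<rho>', \<gamma>', x', y', w', q')" using valid_steps[OF assms, of i] 1 by simp
    then show ?thesis using core[OF 1] 1 by auto
  qed
  have uv: "u \<in> Q" "v \<in> Q"
  proof -
    have "row ((step ^^ 0) C) = u" "row ((step ^^ 1) C) = v" using C by simp_all
    then show "u \<in> Q" "v \<in> Q" unfolding Q_def orbit_rows_def by (metis rangeI)+
  qed
  have QT: "Q = \<rho> ` T \<union> {u, v}"
  proof
    show "Q \<subseteq> \<rho> ` T \<union> {u, v}"
    proof
      fix x assume "x \<in> Q"
      then obtain i where "x = row ((step ^^ i) C)" unfolding Q_def orbit_rows_def by auto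
      then show "x \<in> \<rho> ` T \<union> {u, v}" using stp[of i] by auto
    qed
  qed (use uv T_def in auto)
  have inj: "inj_on \<rho> S" "inj_on \<gamma> S" and sub: "\<rho> ` S \<subseteq> X" "\<gamma> ` S \<subseteq> Z" and ident: "\<And>s. s \<in> S \<Longrightarrow> A (\<rho> s) (\<gamma> s) = s"
    using rb unfolding rainbow_def by auto
  have "card (\<rho> ` T) = card T" using inj TS by (meson card_image inj_on_subset)
  moreover have "u \<notin> \<rho> ` T" "v \<notin> \<rho> ` T" "u \<noteq> v" using val TS by auto
  ultimately have card_Q: "card Q = card T + 2" using finT unfolding QT by simp
  have finQ: "finite Q" and QX: "Q \<subseteq> X" using QT finT sub TS val by auto
  have YQ: "Y \<inter> Q = {}" and YX: "Y \<subseteq> X" and DZ: "D \<subseteq> Z"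
    using sub val unfolding Y_def D_def T_def by auto
  have card_ST: "card T + card (S - T) = card S"
    using finite_S TS by (metis card_Diff_subset card_mono finT le_add_diff_inverse)
  \<comment> \<open>For \<open>x\<close> in \<open>Q\<close>, take the moving part of the
    transversal at a time when \<open>x\<close> is missed and combine it with the given matching
    \<open>N\<close> of the outside rows. The result has maximum length and misses \<open>x\<close>
    and \<open>d\<close>, so the symbol of that cell must be among its symbols.\<close>
  have avoid: "(\<lambda>r. A r d) ` Q \<subseteq> T \<union> N"
    if N: "card N = card (S - T)" "finite N" "N \<inter> T = {}" "inj_on \<nu> N" "inj_on \<eta> N" "\<nu> ` N \<subseteq> Y" "\<eta> ` N \<subseteq> D"
      "\<And>s. s \<in> N \<Longrightarrow> A (\<nu> s) (\<eta> s) = s" "d \<in> D" "d \<notin> \<eta> ` N" for N \<nu> \<eta> d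
  proof
    fix s assume "s \<in> (\<lambda>r. A r d) ` Q"
    then obtain x where x: "x \<in> Q" "s = A x d" by auto
    then obtain i where i: "x = row ((step ^^ i) C)" unfolding Q_def orbit_rows_def by auto
    obtain \<rho>' \<gamma>' x' y' w' where st: "(step ^^ i) C = (\<rho>', \<gamma>', x', y', w', q)" "rainbow S \<rho>' \<gamma>'" "x' \<in> X" "x' \<notin> \<rho>' ` S"
      "\<rho>' ` T \<union> {x', y'} = \<rho> ` T \<union> {u, v}" "\<gamma>' ` T \<union> {w'} = \<gamma> ` T \<union> {p}" using stp[of i] by auto
    have xx: "x = x'" using i st by simp
    define \<rho>'' where "\<rho>'' = (\<lambda>s. if s \<in> T then \<rho>' s else \<nu> s)"
    define \<gamma>'' where "\<gamma>'' = (\<lambda>s. if s \<in> T then \<gamma>' s else \<eta> s)"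
    have r: "\<rho>' ` T \<subseteq> Q" using st QT by auto
    have c: "\<gamma>' ` T \<inter> D = {}"
    proof -
      have "\<gamma>' ` T \<subseteq> \<gamma> ` T \<union> {p}" using st by auto
      moreover have "(\<gamma> ` T \<union> {p}) \<inter> D = {}"
        using inj(2) TS val unfolding D_def inj_on_def by auto
      ultimately show ?thesis by auto
    qed
    have eq: "\<rho>'' ` (T \<union> N) = \<rho>' ` T \<union> \<nu> ` N" "\<gamma>'' ` (T \<union> N) = \<gamma>' ` T \<union> \<eta> ` N"
      using N(3) unfolding \<rho>''_def \<gamma>''_def by auto
    have on: "\<And>s. s \<in> T \<Longrightarrow> \<rho>'' s = \<rho>' s \<and> \<gamma>'' s = \<gamma>' s" "\<And>s. s \<in> N \<Longrightarrow> \<rho>'' s = \<nu> s \<and> \<gamma>'' s = \<eta> s"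
      using N(3) unfolding \<rho>''_def \<gamma>''_def by auto
    have "inj_on \<rho>' T" "inj_on \<gamma>' T" using st(2) TS unfolding rainbow_def by (auto intro: inj_on_subset)
    then have "inj_on \<rho>'' T" "inj_on \<gamma>'' T" "inj_on \<rho>'' N" "inj_on \<gamma>'' N"
      using N(4,5) on by (simp_all cong: inj_on_cong)
    moreover have "\<rho>'' ` T \<inter> \<rho>'' ` N = {}" "\<gamma>'' ` T \<inter> \<gamma>'' ` N = {}"
      using r c YQ N(6,7) on by (auto; metis IntI imageI subsetD emptyE)+
    ultimately have "inj_on \<rho>'' (T \<union> N)" "inj_on \<gamma>'' (T \<union> N)" unfolding inj_on_Un by blast+
    moreover have "\<rho>' ` T \<subseteq> X" "\<gamma>' ` T \<subseteq> Z" using st(2) TS unfolding rainbow_def by auto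
    ultimately have "rainbow (T \<union> N) \<rho>'' \<gamma>''"
      using st(2) N YX DZ TS unfolding rainbow_def eq by (auto simp: \<rho>''_def \<gamma>''_def)
    moreover have "card (T \<union> N) = card S"
      using N finT card_ST by (subst card_Un_disjoint) auto
    moreover have "x \<in> X - \<rho>'' ` (T \<union> N)" using st(3,4) xx x(1) N YQ TS unfolding eq by auto
    moreover have "d \<in> Z - \<gamma>'' ` (T \<union> N)" using N c DZ unfolding eq by auto
    ultimately show "s \<in> T \<union> N" using uncovered_in[of "T \<union> N" \<rho>'' \<gamma>'' x d] x N(2) finT by simp
  qed
  have inj_col: "inj_on (\<lambda>r. A r d) (Q \<union> Y)" if "d \<in> D" for d
    by (rule inj_on_subset[OF col_inj]) (use that DZ QX YX in auto)
  have inj_row: "inj_on (A y) D" if "y \<in> Y" for y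
    by (rule inj_on_subset[OF row_inj]) (use that DZ YX in auto)
  have finY: "finite Y" using finite_S unfolding Y_def by simp
  have cardY: "card Y = card (S - T)" "card D = card (S - T) + 1"
  proof -
    show "card Y = card (S - T)" unfolding Y_def using inj(1) by (intro card_image) (auto intro: inj_on_subset)
    have "card (\<gamma> ` (S - T)) = card (S - T)" using inj(2) by (intro card_image) (auto intro: inj_on_subset)
    moreover have "q \<notin> \<gamma> ` (S - T)" using val by auto
    ultimately show "card D = card (S - T) + 1" using finite_S unfolding D_def by simp
  qed
  have eqS: "\<rho> s = \<rho> t \<longleftrightarrow> s = t" "\<gamma> s = \<gamma> t \<longleftrightarrow> s = t" "\<gamma> s \<noteq> q" "q \<noteq> \<gamma> s" if "s \<in> S" "t \<in> S" for s t
    using inj val that by (auto simp: inj_on_eq_iff)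
  have base: "(\<lambda>r. A r q) ` Q \<subseteq> T \<union> (S - T)"
  proof (rule avoid)
    show "inj_on \<rho> (S - T)" "inj_on \<gamma> (S - T)" using inj by (auto intro: inj_on_subset)
    show "\<gamma> ` (S - T) \<subseteq> D" "q \<in> D" "q \<notin> \<gamma> ` (S - T)" using val unfolding D_def by auto
  qed (auto simp: Y_def ident finite_S)
  have "inj_on (\<lambda>r. A r q) Q" by (rule inj_on_subset[OF inj_col]) (auto simp: D_def)
  then have "2 \<le> card (S - T)"
    using card_nonfresh[of "\<lambda>r. A r q" Q "{}" T "S - T"] base finQ finT finite_S card_Q
    by (simp add: numeral_2_eq_2)
  moreover have "card (S - T) \<noteq> 2"
  proof
    assume "card (S - T) = 2"
    then obtain s1 s2 where s12: "S - T = {s1, s2}" "s1 \<noteq> s2" by (meson card_2_iff)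
    have in_S: "s1 \<in> S" "s2 \<in> S" "s1 \<notin> T" "s2 \<notin> T" using s12 by blast+
    have avoid2: "(\<lambda>r. A r d) ` Q \<subseteq> T \<union> {A a i, A b j}" if "a \<noteq> b" "{a, b} \<subseteq> Y" "distinct [i, j, d]" "{i, j, d} \<subseteq> D"
      "A a i \<noteq> A b j" "A a i \<notin> T" "A b j \<notin> T" for a b i j d
      by (rule avoid[of _ "\<lambda>s. if s = A a i then a else b" "\<lambda>s. if s = A a i then i else j"])
        (use that s12 in \<open>auto simp: inj_on_def\<close>)
    have fresh: "A y d \<notin> T \<union> {A a i, A b j}" if "a \<noteq> b" "{a, b} \<subseteq> Y" "distinct [i, j, d]" "{i, j, d} \<subseteq> D"
      "A a i \<noteq> A b j" "A a i \<notin> T" "A b j \<notin> T" "y \<in> Y" for a b i j d y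
    proof
      assume *: "A y d \<in> T \<union> {A a i, A b j}"
      have "card {y} + 2 \<le> card {A a i, A b j}"
      proof (rule card_nonfresh[where f = "\<lambda>r. A r d" and R = Q and T = T])
        show "inj_on (\<lambda>r. A r d) (Q \<union> {y})"
          by (rule inj_on_subset[OF inj_col]) (use that in auto)
        show "(\<lambda>r. A r d) ` (Q \<union> {y}) \<subseteq> T \<union> {A a i, A b j}"
          using avoid2[OF that(1-7)] * by auto
      qed (use finQ finT card_Q YQ that in auto)
      also have "\<dots> \<le> 2" by (simp add: card_insert_if)
      finally show False by simp
    qed
    define a where "a = \<rho> s1"
    define b where "b = \<rho> s2"
    define i where "i = \<gamma> s1"
    define j where "j = \<gamma> s2"
    have ab: "a \<noteq> b" "{a, b} \<subseteq> Y" and ij: "i \<noteq> j" "i \<noteq> q" "j \<noteq> q" "i \<in> D" "j \<in> D" "q \<in> D"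
      and AA: "A a i = s1" "A b j = s2" "s1 \<notin> T" "s2 \<notin> T"
      using s12 in_S eqS ident unfolding a_def b_def i_def j_def Y_def D_def by auto
    have 1: "A a q \<notin> T \<union> {A a i, A b j}" "A b q \<notin> T \<union> {A a i, A b j}"
      using fresh[of a b i j q a] fresh[of a b i j q b] ab ij AA s12 by auto
    have 2: "A b i \<notin> T \<union> {A a q, A b j}"
      using fresh[of a b q j i b] ab ij AA s12 1 by auto
    \<comment> \<open>Every outside row is fresh here. Moving \<open>a\<close> to \<open>q\<close>
      and then \<open>b\<close> to \<open>i\<close>, or only \<open>b\<close> to \<open>q\<close>,
      leaves \<open>j\<close> free in both cases, but the two matchings have at most one symbol in
      common.\<close>
    have "2 \<le> card ({A a q, A b i} \<inter> {A a i, A b q})"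
    proof (rule card_inter_ge[where f = "\<lambda>r. A r j" and R = Q and T = T])
      show "inj_on (\<lambda>r. A r j) Q" by (rule inj_on_subset[OF inj_col]) (use ij in auto)
      show "(\<lambda>r. A r j) ` Q \<subseteq> T \<union> {A a q, A b i}" by (rule avoid2) (use ab ij 1 2 in auto)
      show "(\<lambda>r. A r j) ` Q \<subseteq> T \<union> {A a i, A b q}" by (rule avoid2) (use ab ij 1 AA in auto)
    qed (auto simp: finT card_Q)
    moreover have "A a q \<noteq> A b q" using inj_col[of q] ab ij by (auto simp: inj_on_def)
    then have "{A a q, A b i} \<inter> {A a i, A b q} \<subseteq> {A b i}" using 1 by auto
    then have "card ({A a q, A b i} \<inter> {A a i, A b q}) \<le> card {A b i}" by (intro card_mono) auto
    ultimately show False by simp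
  qed
  moreover have "card (S - T) \<noteq> 3"
  proof
    assume "card (S - T) = 3"
    then obtain s1 s2 s3 where s123: "S - T = {s1, s2, s3}" "distinct [s1, s2, s3]"
      by (auto simp: card_3_iff)
    have in_S: "s1 \<in> S" "s2 \<in> S" "s3 \<in> S" "s1 \<notin> T" "s2 \<notin> T" "s3 \<notin> T" using s123 by blast+
    interpret block3 A Q Y D T
    proof
      fix a b c i j k d
      assume "distinct [a, b, c]" "{a, b, c} \<subseteq> Y" "distinct [i, j, k, d]" "{i, j, k, d} \<subseteq> D"
        "distinct [A a i, A b j, A c k]" "{A a i, A b j, A c k} \<inter> T = {}"
      then show "(\<lambda>r. A r d) ` Q \<subseteq> T \<union> {A a i, A b j, A c k}"
        by (intro avoid[of _ "\<lambda>s. if s = A a i then a else if s = A b j then b else c"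
              "\<lambda>s. if s = A a i then i else if s = A b j then j else k"])
          (use s123 in \<open>auto simp: inj_on_def\<close>)
    qed (use inj_row inj_col finQ finT card_Q YQ in auto)
    have "good (\<rho> s1) (\<rho> s2) (\<rho> s3) (\<gamma> s1) (\<gamma> s2) (\<gamma> s3) q"
      using s123 in_S eqS ident unfolding good_def unfolding Y_def D_def by auto
    then show False using not_good by blast
  qed
  ultimately have "4 \<le> card (S - T)" by linarith
  then show ?thesis using card_ST card_Q unfolding Q_def by linarith
qed

end

section \<open>Cycles with at most seven rows\<close>

text \<open>
  A label other than \<open>U\<close> and \<open>V\<close> names a symbol, and also the row and the column of the cell with this symbol
  in the initial transversal; \<open>U\<close> and \<open>V\<close> name the two missed rows and the two missed columns.
  In a table, \<open>Ent r c s\<close> says that cell \<open>(r, c)\<close> contains \<open>s\<close>; in a list of positions, \<open>Ent s r c\<close> says that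
  the current transversal uses \<open>(r, c)\<close> for \<open>s\<close>, and symbols not listed are in their initial place.
\<close>

datatype lbl = L0 | L1 | L2 | L3 | L4 | L5 | L6 | L7 | L8 | U | V

datatype entry = Ent lbl lbl lbl

type_synonym lstate = "entry list \<times> lbl \<times> lbl \<times> lbl \<times> lbl"

primrec entry_at :: "lbl \<Rightarrow> lbl \<Rightarrow> entry list \<Rightarrow> lbl option" where
  "entry_at x w [] = None"
| "entry_at x w (e # t) = (case e of Ent r c s \<Rightarrow> if r = x then if c = w then Some s else entry_at x w t else entry_at x w t)"

primrec blocked :: "lbl \<Rightarrow> lbl \<Rightarrow> entry list \<Rightarrow> lbl list" where
  "blocked x w [] = []"
| "blocked x w (e # t) = (case e of Ent r c s \<Rightarrow> if r = x then s # blocked x w t else if c = w then s # blocked x w t else blocked x w t)"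

primrec place :: "lbl \<Rightarrow> entry list \<Rightarrow> lbl \<times> lbl" where
  "place s [] = (s, s)"
| "place s (e # t) = (case e of Ent l r c \<Rightarrow> if l = s then (r, c) else place s t)"

primrec place_upd :: "lbl \<Rightarrow> lbl \<Rightarrow> lbl \<Rightarrow> entry list \<Rightarrow> entry list" where
  "place_upd s x w [] = [Ent s x w]"
| "place_upd s x w (e # t) = (case e of Ent l r c \<Rightarrow> if l = s then Ent s x w # t else e # place_upd s x w t)"

definition label_swap :: "lbl \<Rightarrow> lstate \<Rightarrow> lstate" where
  "label_swap s L = (case L of (pos, a, b, c, d) \<Rightarrow> case place s pos of (r, w) \<Rightarrow> (place_upd s a c pos, r, b, w, d))"

definition label_flip_rows :: "lstate \<Rightarrow> lstate" where "label_flip_rows L = (case L of (pos, a, b, c, d) \<Rightarrow> (pos, b, a, c, d))"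
definition label_flip_cols :: "lstate \<Rightarrow> lstate" where "label_flip_cols L = (case L of (pos, a, b, c, d) \<Rightarrow> (pos, a, b, d, c))"

lemma place_place_upd: "place l (place_upd s x w pos) = (if l = s then (x, w) else place l pos)"
  by (induction pos) (auto split: entry.splits)

text \<open>The symbols that are moved during the exceptional cycle, read from two starting points.\<close>

definition word1 :: "lbl list" where "word1 = [L0,L1,L2,L0,L1,L3,L0,L1,L2,L3,L0,L2,L3,L1,L2,L3]"
definition word2 :: "lbl list" where "word2 = [L0,L1,L2,L0,L1,L3,L2,L0,L3,L2,L1,L3,L2,L0,L1,L3]"
definition rword1 :: "lbl list" where "rword1 = rev word1"
definition rword2 :: "lbl list" where "rword2 = rev word2"

text \<open>Conditionals instead of conjunctions keep the simplifier from evaluating both arguments.\<close>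

primrec all_lazy :: "('a \<Rightarrow> bool) \<Rightarrow> 'a list \<Rightarrow> bool" where
  "all_lazy P [] = True"
| "all_lazy P (x # xs) = (if P x then all_lazy P xs else False)"

lemma all_lazy: "all_lazy P xs \<longleftrightarrow> (\<forall>x\<in>set xs. P x)"
  by (induction xs) auto

text \<open>
  The search follows the exchanges and branches over the content of each unknown cell. The reversed list \<open>h\<close>
  holds the symbols moved so far, \<open>tc\<close> the labels in use and \<open>fs\<close> the unused ones. Five labels are enough for
  seven rows, and a branch that needs another label is closed. The fuel is large enough for all branches.
\<close>

primrec search :: "(lbl list \<Rightarrow> bool) \<Rightarrow> nat \<Rightarrow> lbl list \<Rightarrow> entry list \<Rightarrow> lbl list \<Rightarrow> lbl list \<Rightarrow> lstate \<Rightarrow> bool" where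
  "search ok 0 h tab tc fs L = False"
| "search ok (Suc k) h tab tc fs L =
    (if h = rword1 then True else if h = rword2 then True else
     (let go = (\<lambda>tab tc fs s. if ok (s # h) then search ok k (s # h) tab tc fs (label_flip_rows (label_swap s L)) else True) in
      case L of (pos, a, b, c, d) \<Rightarrow>
       (case entry_at a c tab of Some s \<Rightarrow> go tab tc fs s
        | None \<Rightarrow> (let us = blocked a c tab in
           if all_lazy (\<lambda>s. if s \<in> set us then True else go (Ent a c s # tab) tc fs s) tc then
             (case fs of [] \<Rightarrow> True | f # fs' \<Rightarrow> go (Ent a c f # Ent f f f # tab) (f # tc) fs' f)
           else False))))"

text \<open>
  Let \<open>D i\<close> say that the \<open>i\<close>-th and the \<open>(i+3)\<close>-rd exchange move the same symbol. Either the starting point can be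
  chosen with \<open>D 0\<close>, \<open>D 1\<close> and \<open>\<not> D 2\<close>, or with \<open>D i\<close> for all \<open>i\<close>, or \<open>D i\<close> and \<open>D (i+1)\<close> never hold together.
  Only the first case survives, and its survivors are the two words.
\<close>

fun two_repeats :: "lbl list \<Rightarrow> bool" where
  "two_repeats [a, b, c, d] = (a = d)"
| "two_repeats [a, b, c, d, e] = (a = d)"
| "two_repeats [a, b, c, d, e, f] = (a \<noteq> d)"
| "two_repeats _ = True"

fun all_repeats :: "lbl list \<Rightarrow> bool" where
  "all_repeats (a # b # c # d # _) = (a = d)"
| "all_repeats _ = True"

fun no_two_repeats :: "lbl list \<Rightarrow> bool" where
  "no_two_repeats (a # b # c # d # e # _) = (\<not> (a = d \<and> b = e))"
| "no_two_repeats _ = True"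

definition label_start :: lstate where "label_start = ([], U, V, U, V)"

lemma search_two_repeats: "search two_repeats 60 [] [] [] [L0, L1, L2, L3, L4] label_start" by code_simp
lemma search_all_repeats: "search all_repeats 60 [] [] [] [L0, L1, L2, L3, L4] label_start" by code_simp
lemma search_no_two_repeats: "search no_two_repeats 60 [] [] [] [L0, L1, L2, L3, L4] label_start" by code_simp

definition line :: "('s \<Rightarrow> 'a) \<Rightarrow> 'a \<Rightarrow> 'a \<Rightarrow> (lbl \<Rightarrow> 's) \<Rightarrow> lbl \<Rightarrow> 'a" where
  "line f a b \<sigma> l = (if l = U then a else if l = V then b else f (\<sigma> l))"

lemma line_simps [simp]: "line f a b \<sigma> U = a" "line f a b \<sigma> V = b"
  by (auto simp: line_def)

section \<open>Soundness of the search\<close>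

locale labelled = deficient X Z A S
  for X :: "'r set" and Z :: "'c set" and A :: "'r \<Rightarrow> 'c \<Rightarrow> 's" and S +
  fixes \<rho>0 :: "'s \<Rightarrow> 'r" and \<gamma>0 :: "'s \<Rightarrow> 'c" and u v p q
  assumes base: "valid (\<rho>0, \<gamma>0, u, v, p, q)"
begin

abbreviation "rl \<equiv> line \<rho>0 u v"
abbreviation "cl \<equiv> line \<gamma>0 p q"

definition labelling :: "(lbl \<Rightarrow> 's) \<Rightarrow> lbl set \<Rightarrow> bool" where
  "labelling \<sigma> T \<longleftrightarrow> inj_on \<sigma> T \<and> \<sigma> ` T \<subseteq> S \<and> U \<notin> T \<and> V \<notin> T"

definition lines :: "lbl set \<Rightarrow> lbl set" where "lines T = T \<union> {U, V}"

definition table_ok :: "(lbl \<Rightarrow> 's) \<Rightarrow> lbl set \<Rightarrow> entry list \<Rightarrow> bool" where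
  "table_ok \<sigma> T tab \<longleftrightarrow> (\<forall>r c s. Ent r c s \<in> set tab \<longrightarrow>
     r \<in> lines T \<and> c \<in> lines T \<and> s \<in> T \<and> A (rl \<sigma> r) (cl \<sigma> c) = \<sigma> s)"

definition represents :: "(lbl \<Rightarrow> 's) \<Rightarrow> lbl set \<Rightarrow> lstate \<Rightarrow> ('r, 'c, 's) config \<Rightarrow> bool" where
  "represents \<sigma> T L C \<longleftrightarrow> (case L of (pos, a, b, c, d) \<Rightarrow> {a, b, c, d} \<subseteq> lines T \<and>
     (\<exists>\<rho> \<gamma>. C = (\<rho>, \<gamma>, rl \<sigma> a, rl \<sigma> b, cl \<sigma> c, cl \<sigma> d) \<and>
       (\<forall>s\<in>T. {fst (place s pos), snd (place s pos)} \<subseteq> lines T \<and>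
          \<rho> (\<sigma> s) = rl \<sigma> (fst (place s pos)) \<and> \<gamma> (\<sigma> s) = cl \<sigma> (snd (place s pos))) \<and>
       (\<forall>s\<in>S - \<sigma> ` T. \<rho> s = \<rho>0 s \<and> \<gamma> s = \<gamma>0 s) \<and> (\<forall>s. s \<notin> T \<longrightarrow> place s pos = (s, s))))"

lemma line_inj:
  assumes "labelling \<sigma> T" "inj_on f S" "a \<notin> f ` S" "b \<notin> f ` S" "a \<noteq> b"
  shows "inj_on (line f a b \<sigma>) (lines T)"
proof -
  have S: "\<sigma> x \<in> S" if "x \<in> T" for x using assms(1) that by (auto simp: labelling_def)
  have 1: "f (\<sigma> x) = f (\<sigma> y) \<longleftrightarrow> x = y" if "x \<in> T" "y \<in> T" for x y
    using inj_on_eq_iff[OF assms(2) S[OF that(1)] S[OF that(2)]] assms(1) that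
    by (simp add: labelling_def inj_on_eq_iff[of \<sigma> T])
  have 2: "f (\<sigma> x) \<noteq> a" "f (\<sigma> x) \<noteq> b" "a \<noteq> f (\<sigma> x)" "b \<noteq> f (\<sigma> x)" if "x \<in> T" for x
    using assms(3,4) imageI[OF S[OF that], of f] by auto
  show ?thesis unfolding inj_on_def using assms(5) 1 2 by (simp add: lines_def line_def)
qed

lemma rl_inj: "labelling \<sigma> T \<Longrightarrow> inj_on (rl \<sigma>) (lines T)"
  using base by (intro line_inj) (auto simp: rainbow_def)

lemma cl_inj: "labelling \<sigma> T \<Longrightarrow> inj_on (cl \<sigma>) (lines T)"
  using base by (intro line_inj) (auto simp: rainbow_def)

lemma rl_in: "labelling \<sigma> T \<Longrightarrow> l \<in> lines T \<Longrightarrow> rl \<sigma> l \<in> X"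
  using base unfolding labelling_def lines_def line_def by (auto simp: rainbow_def)

lemma cl_in: "labelling \<sigma> T \<Longrightarrow> l \<in> lines T \<Longrightarrow> cl \<sigma> l \<in> Z"
  using base unfolding labelling_def lines_def line_def by (auto simp: rainbow_def)

lemma entry_at_sound:
  assumes "table_ok \<sigma> T tab" "entry_at x w tab = Some s" shows "s \<in> T \<and> A (rl \<sigma> x) (cl \<sigma> w) = \<sigma> s"
proof -
  have "entry_at x w tab = Some s \<Longrightarrow> Ent x w s \<in> set tab"
    by (induction tab) (auto split: entry.splits if_splits)
  then show ?thesis using assms by (auto simp: table_ok_def)
qed

lemma blocked_sound:
  assumes "labelling \<sigma> T" "table_ok \<sigma> T tab" "entry_at x w tab = None" "s \<in> set (blocked x w tab)" "x \<in> lines T" "w \<in> lines T"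
  shows "A (rl \<sigma> x) (cl \<sigma> w) \<noteq> \<sigma> s"
proof -
  have "(\<exists>c. Ent x c s \<in> set tab \<and> c \<noteq> w) \<or> (\<exists>r. Ent r w s \<in> set tab \<and> r \<noteq> x)"
    using assms(3,4)
  proof (induction tab)
    case (Cons e t)
    obtain r c s' where e: "e = Ent r c s'" by (cases e)
    show ?case using Cons unfolding e by (cases "r = x"; cases "c = w") auto
  qed simp
  then show ?thesis
  proof (elim disjE exE conjE)
    fix c assume c: "Ent x c s \<in> set tab" "c \<noteq> w"
    then have m: "c \<in> lines T" "A (rl \<sigma> x) (cl \<sigma> c) = \<sigma> s" using assms(2) unfolding table_ok_def by blast+
    have "cl \<sigma> c \<noteq> cl \<sigma> w" using inj_on_eq_iff[OF cl_inj[OF assms(1)] m(1) assms(6)] c(2) by simp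
    then show ?thesis
      using inj_on_eq_iff[OF row_inj[OF rl_in[OF assms(1,5)]] cl_in[OF assms(1) m(1)] cl_in[OF assms(1,6)]] m(2) by simp
  next
    fix r assume r: "Ent r w s \<in> set tab" "r \<noteq> x"
    then have m: "r \<in> lines T" "A (rl \<sigma> r) (cl \<sigma> w) = \<sigma> s" using assms(2) unfolding table_ok_def by blast+
    have "rl \<sigma> r \<noteq> rl \<sigma> x" using inj_on_eq_iff[OF rl_inj[OF assms(1)] m(1) assms(5)] r(2) by simp
    then show ?thesis
      using inj_on_eq_iff[OF col_inj[OF cl_in[OF assms(1,6)]] rl_in[OF assms(1) m(1)] rl_in[OF assms(1,5)]] m(2) by simp
  qed
qed

lemma represents_swap:
  assumes "labelling \<sigma> T" "represents \<sigma> T L C" "s \<in> T" "cell_sym C = \<sigma> s"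
  shows "represents \<sigma> T (label_swap s L) (exchange C)"
proof -
  obtain pos a b c d where L: "L = (pos, a, b, c, d)" by (metis prod_cases5)
  have inj: "\<sigma> l = \<sigma> s \<longleftrightarrow> l = s" if "l \<in> T" for l
    using assms(1,3) that unfolding labelling_def inj_on_def by auto
  show ?thesis
    using assms(2-4) inj unfolding represents_def L label_swap_def
    by (auto simp: cell_sym_def place_place_upd split: prod.splits)
qed

lemma represents_flip_rows: "represents \<sigma> T L C \<Longrightarrow> represents \<sigma> T (label_flip_rows L) (flip_rows C)"
  unfolding represents_def label_flip_rows_def by (auto split: prod.splits)

lemma represents_flip_cols: "represents \<sigma> T L C \<Longrightarrow> represents \<sigma> T (label_flip_cols L) (flip_cols C)"
  unfolding represents_def label_flip_cols_def by (auto split: prod.splits)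

lemma line_upd: "l \<in> lines T \<Longrightarrow> f \<notin> T \<Longrightarrow> line g a b (\<sigma>(f := s)) l = line g a b \<sigma> l"
  by (auto simp: lines_def line_def)

text \<open>A symbol that has no label yet has never moved. Its home cell is the one of the initial
  transversal, which is why the entry \<open>Ent f f f\<close> comes with the label.\<close>

lemma new_label:
  assumes "labelling \<sigma> T" "table_ok \<sigma> T tab" "represents \<sigma> T L C" "s \<in> S" "s \<notin> \<sigma> ` T" "f \<notin> lines T"
  shows "labelling (\<sigma>(f := s)) (insert f T)" "table_ok (\<sigma>(f := s)) (insert f T) (Ent f f f # tab)" "represents (\<sigma>(f := s)) (insert f T) L C"
proof -
  have f: "f \<notin> T" "f \<noteq> U" "f \<noteq> V" using assms(6) by (auto simp: lines_def)
  note e = line_upd[OF _ f(1), of _ \<rho>0 u v] line_upd[OF _ f(1), of _ \<gamma>0 p q]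
  have lines: "l \<in> lines T \<Longrightarrow> l \<in> lines (insert f T)" for l by (auto simp: lines_def)
  show 1: "labelling (\<sigma>(f := s)) (insert f T)"
    using assms(1,4,5) f unfolding labelling_def inj_on_def by auto
  have im: "\<sigma>(f := s) ` T = \<sigma> ` T" using f by auto
  have "rl (\<sigma>(f := s)) f = \<rho>0 s" "cl (\<sigma>(f := s)) f = \<gamma>0 s" using f by (auto simp: line_def)
  moreover have "A (\<rho>0 s) (\<gamma>0 s) = s" using base assms(4) by (auto simp: rainbow_def)
  ultimately show "table_ok (\<sigma>(f := s)) (insert f T) (Ent f f f # tab)"
    using assms(2) f(1) e lines unfolding table_ok_def
    by (auto simp: lines_def[of "insert f T"])
  show "represents (\<sigma>(f := s)) (insert f T) L C"
  proof -
    obtain pos a b c d where L: "L = (pos, a, b, c, d)" by (metis prod_cases5)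
    obtain \<rho> \<gamma> where *: "{a, b, c, d} \<subseteq> lines T" "C = (\<rho>, \<gamma>, rl \<sigma> a, rl \<sigma> b, cl \<sigma> c, cl \<sigma> d)"
      "\<And>s. s \<in> T \<Longrightarrow> {fst (place s pos), snd (place s pos)} \<subseteq> lines T \<and>
          \<rho> (\<sigma> s) = rl \<sigma> (fst (place s pos)) \<and> \<gamma> (\<sigma> s) = cl \<sigma> (snd (place s pos))"
      "\<And>s. s \<in> S - \<sigma> ` T \<Longrightarrow> \<rho> s = \<rho>0 s \<and> \<gamma> s = \<gamma>0 s" "\<And>s. s \<notin> T \<Longrightarrow> place s pos = (s, s)"
      using assms(3) unfolding represents_def L by auto
    have A1: "C = (\<rho>, \<gamma>, rl (\<sigma>(f := s)) a, rl (\<sigma>(f := s)) b, cl (\<sigma>(f := s)) c, cl (\<sigma>(f := s)) d)"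
      using * e by auto
    have A2: "{fst (place l pos), snd (place l pos)} \<subseteq> lines (insert f T) \<and>
          \<rho> ((\<sigma>(f := s)) l) = rl (\<sigma>(f := s)) (fst (place l pos)) \<and> \<gamma> ((\<sigma>(f := s)) l) = cl (\<sigma>(f := s)) (snd (place l pos))"
      if "l \<in> insert f T" for l
    proof (cases "l = f")
      case True
      then show ?thesis using *(4)[of s] *(5)[of f] f assms(4,5) by (auto simp: lines_def line_def)
    next
      case False
      then show ?thesis using *(3)[of l] that e lines f by auto
    qed
    have A3: "\<forall>t\<in>S - (\<sigma>(f := s)) ` insert f T. \<rho> t = \<rho>0 t \<and> \<gamma> t = \<gamma>0 t"
      using *(4) im by auto
    show ?thesis unfolding represents_def L prod.case
    proof (intro conjI exI[of _ \<rho>] exI[of _ \<gamma>] A1 A3 ballI)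
      show "{a, b, c, d} \<subseteq> lines (insert f T)" using *(1) lines by blast
      show "\<forall>s. s \<notin> insert f T \<longrightarrow> place s pos = (s, s)" using *(5) by blast
    qed (use A2 in blast)+
  qed
qed

definition "start = (\<rho>0, \<gamma>0, u, v, p, q)"
definition "orbit n = (step ^^ n) start"
definition "orbit_sym n = cell_sym (orbit n)"

lemma valid_orbit: "valid (orbit n)"
  unfolding orbit_def start_def using base by (rule valid_steps)

lemma orbit_Suc: "orbit (Suc n) = flip_rows (exchange (orbit n))"
  by (simp add: orbit_def step_def)

lemma row_orbit: "row (orbit n) \<in> orbit_rows start"
  unfolding orbit_def orbit_rows_def by auto

lemma finite_orbit_rows: "finite (orbit_rows start)"
proof (rule finite_subset[OF _ finite_X])
  have "row C \<in> X" if "valid C" for C :: "('r, 'c, 's) config" using that by (cases C rule: valid.cases) auto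
  from this[OF valid_orbit] show "orbit_rows start \<subseteq> X" unfolding orbit_rows_def orbit_def by auto
qed

lemma table_ok_Cons:
  "table_ok \<sigma> T tab \<Longrightarrow> {a, c} \<subseteq> lines T \<Longrightarrow> s \<in> T \<Longrightarrow> A (rl \<sigma> a) (cl \<sigma> c) = \<sigma> s \<Longrightarrow> table_ok \<sigma> T (Ent a c s # tab)"
  unfolding table_ok_def by auto

lemma represents_row_col: "represents \<sigma> T (pos, a, b, c, d) C \<Longrightarrow> row C = rl \<sigma> a \<and> col C = cl \<sigma> c \<and> {a, b, c, d} \<subseteq> lines T"
  unfolding represents_def by auto

text \<open>The actual cycle selects one branch at each unknown cell. Along it \<open>ok\<close>
  holds and the supply of labels suffices, so neither reason for closing a branch applies; exhausted
  fuel counts as failure. The branch can therefore end only at one of the two words.\<close>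

lemma search_sound:
  assumes "search ok k h tab tc fs L" "labelling \<sigma> (set tc)" "table_ok \<sigma> (set tc) tab" "represents \<sigma> (set tc) L (orbit (length h))"
    "map \<sigma> (rev h) = map orbit_sym [0..<length h]" "set h \<subseteq> set tc" "distinct (tc @ fs)" "U \<notin> set fs" "V \<notin> set fs"
    "length tc + length fs = 5" "rl \<sigma> ` lines (set tc) \<subseteq> orbit_rows start"
    and R7: "card (orbit_rows start) \<le> 7"
    and ok: "\<And>\<sigma> h. inj_on \<sigma> (set h) \<Longrightarrow> map \<sigma> (rev h) = map orbit_sym [0..<length h] \<Longrightarrow> ok h"
  shows "\<exists>\<sigma> h. (h = word1 \<or> h = word2) \<and> labelling \<sigma> (set h) \<and> map \<sigma> h = map orbit_sym [0..<length h]"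
  using assms(1-11)
proof (induction k arbitrary: h tab tc fs L \<sigma>)
  case (Suc k)
  note prems = Suc.prems
  let ?C = "orbit (length h)"
  obtain pos a b c d where L: "L = (pos, a, b, c, d)" by (metis prod_cases5)
  show ?case
  proof (cases "h = rword1 \<or> h = rword2")
    case True
    then have "rev h = word1 \<or> rev h = word2" by (auto simp: rword1_def rword2_def)
    moreover have "labelling \<sigma> (set (rev h))"
      using prems(2,6) inj_on_subset[of \<sigma> "set tc" "set h"] unfolding labelling_def by auto
    ultimately show ?thesis using prems(5) by (metis length_rev)
  next
    case False
    define go where "go = (\<lambda>tab tc fs s. if ok (s # h) then search ok k (s # h) tab tc fs (label_flip_rows (label_swap s L)) else True)"
    have search: "case entry_at a c tab of Some s \<Rightarrow> go tab tc fs s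
        | None \<Rightarrow> (let us = blocked a c tab in
           if all_lazy (\<lambda>s. if s \<in> set us then True else go (Ent a c s # tab) tc fs s) tc then
             (case fs of [] \<Rightarrow> True | f # fs' \<Rightarrow> go (Ent a c f # Ent f f f # tab) (f # tc) fs' f)
           else False)"
      using prems(1) False unfolding go_def L by (simp add: Let_def)
    have go: ?thesis if "go tab' tc' fs' s" "s \<in> set tc'" "labelling \<sigma>' (set tc')" "table_ok \<sigma>' (set tc') tab'" "represents \<sigma>' (set tc') L ?C"
      "cell_sym ?C = \<sigma>' s" "map \<sigma>' (rev h) = map orbit_sym [0..<length h]" "set h \<subseteq> set tc'" "distinct (tc' @ fs')" "U \<notin> set fs'" "V \<notin> set fs'"
      "length tc' + length fs' = 5" "rl \<sigma>' ` lines (set tc') \<subseteq> orbit_rows start" for tab' tc' fs' s \<sigma>'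
    proof -
      have m: "map \<sigma>' (rev (s # h)) = map orbit_sym [0..<length (s # h)]" using that(6,7) by (simp add: orbit_sym_def)
      have "inj_on \<sigma>' (set tc')" using that(3) by (simp add: labelling_def)
      then have "inj_on \<sigma>' (set (s # h))" by (rule inj_on_subset) (use that(2,8) in auto)
      then have "ok (s # h)" using m by (rule ok)
      then have "search ok k (s # h) tab' tc' fs' (label_flip_rows (label_swap s L))" using that(1) unfolding go_def by simp
      moreover have "represents \<sigma>' (set tc') (label_flip_rows (label_swap s L)) (orbit (length (s # h)))"
        using represents_flip_rows[OF represents_swap[OF that(3,5,2,6)]] orbit_Suc by simp
      ultimately show ?thesis
        using Suc.IH[of "s # h" tab' tc' fs' _ \<sigma>'] that m by simp
    qed
    note rc = represents_row_col[OF prems(4)[unfolded L]]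
    then have sC: "cell_sym ?C = A (rl \<sigma> a) (cl \<sigma> c)" by (simp add: cell_sym_def)
    show ?thesis
    proof (cases "entry_at a c tab")
      case (Some s)
      then show ?thesis
        using search entry_at_sound[OF prems(3) Some] prems sC by (intro go[of tab tc fs s \<sigma>]) auto
    next
      case None
      have al: "\<And>s. s \<in> set tc \<Longrightarrow> s \<notin> set (blocked a c tab) \<Longrightarrow> go (Ent a c s # tab) tc fs s"
        and nw: "case fs of [] \<Rightarrow> True | f # fs' \<Rightarrow> go (Ent a c f # Ent f f f # tab) (f # tc) fs' f"
        using search None by (auto simp: all_lazy Let_def split: if_splits)
      show ?thesis
      proof (cases "cell_sym ?C \<in> \<sigma> ` set tc")
        case True
        then obtain s where s: "s \<in> set tc" "cell_sym ?C = \<sigma> s" by auto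
        then have "s \<notin> set (blocked a c tab)"
          using blocked_sound[OF prems(2,3) None] rc sC by auto
        then show ?thesis
          using al s prems rc sC by (intro go[of "Ent a c s # tab" tc fs s \<sigma>]) (auto intro!: table_ok_Cons)
      next
        case new: False
        define s where "s = cell_sym ?C"
        have s: "s \<in> S" "s \<notin> \<sigma> ` set tc" using new valid_cell_sym[OF valid_orbit] unfolding s_def by auto
        obtain \<rho> \<gamma> where C: "?C = (\<rho>, \<gamma>, rl \<sigma> a, rl \<sigma> b, cl \<sigma> c, cl \<sigma> d)" "\<rho> s = \<rho>0 s"
          using prems(4) s unfolding represents_def L by auto
        \<comment> \<open>The exchange of a new symbol frees its home row, which is the first missed
          row two steps later.\<close>
        have "row (orbit (Suc (Suc (length h)))) = \<rho>0 s"
          using C sC unfolding orbit_Suc s_def by (simp add: C)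
        then have row: "\<rho>0 s \<in> orbit_rows start" using row_orbit by metis
        show ?thesis
        proof (cases fs)
          case Nil
          \<comment> \<open>Five labels together with \<open>U\<close> and \<open>V\<close> already
            name seven rows of the cycle; the home row of the new symbol would be an eighth.\<close>
          have "card (lines (set tc)) = 7"
            using prems(2,7,10) Nil by (simp add: lines_def labelling_def distinct_card)
          then have "card (rl \<sigma> ` lines (set tc)) = 7" using card_image[OF rl_inj[OF prems(2)]] by simp
          moreover have "\<rho>0 s \<notin> rl \<sigma> ` lines (set tc)"
          proof
            assume "\<rho>0 s \<in> rl \<sigma> ` lines (set tc)"
            then obtain l where l: "l \<in> lines (set tc)" "\<rho>0 s = rl \<sigma> l" by auto
            moreover have "\<rho>0 s \<noteq> u" "\<rho>0 s \<noteq> v" using base s by auto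
            ultimately have "l \<noteq> U" "l \<noteq> V" by auto
            then have "l \<in> set tc" "\<rho>0 s = \<rho>0 (\<sigma> l)" using l by (simp_all add: lines_def line_def)
            moreover have "\<sigma> l \<in> S" "inj_on \<rho>0 S" using prems(2) calculation base by (auto simp: labelling_def rainbow_def)
            ultimately have "s = \<sigma> l" using s(1) by (simp add: inj_on_eq_iff)
            then show False using s \<open>l \<in> set tc\<close> by auto
          qed
          ultimately have "card (insert (\<rho>0 s) (rl \<sigma> ` lines (set tc))) = 8" by (simp add: lines_def)
          moreover have "card (insert (\<rho>0 s) (rl \<sigma> ` lines (set tc))) \<le> card (orbit_rows start)"
            using finite_orbit_rows row prems(11) by (intro card_mono) auto
          ultimately show ?thesis using R7 by simp
        next
          case (Cons f fs')
          have f: "f \<notin> lines (set tc)" "f \<notin> set tc" using prems(7-9) Cons by (auto simp: lines_def)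
          let ?\<sigma> = "\<sigma>(f := s)"
          note nl = new_label[OF prems(2-4) s f(1)]
          have eq: "x \<in> set h \<Longrightarrow> ?\<sigma> x = \<sigma> x" for x using f prems(6) by auto
          have e: "rl ?\<sigma> x = rl \<sigma> x" "cl ?\<sigma> x = cl \<sigma> x" if "x \<in> lines (set tc)" for x
            by (rule line_upd[OF that f(2)])+
          have "rl ?\<sigma> ` lines (set (f # tc)) \<subseteq> insert (\<rho>0 s) (rl \<sigma> ` lines (set tc))"
          proof -
            have "lines (set (f # tc)) = insert f (lines (set tc))" by (auto simp: lines_def)
            moreover have "rl ?\<sigma> f = \<rho>0 s" using f by (auto simp: line_def lines_def)
            moreover have "rl ?\<sigma> ` lines (set tc) = rl \<sigma> ` lines (set tc)" using e(1) by (rule image_cong[OF refl])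
            ultimately show ?thesis by simp
          qed
          moreover have "table_ok ?\<sigma> (set (f # tc)) (Ent a c f # Ent f f f # tab)"
          proof (rule table_ok_Cons)
            have ac: "a \<in> lines (set tc)" "c \<in> lines (set tc)" using rc by auto
            then show "{a, c} \<subseteq> lines (set (f # tc))" by (auto simp: lines_def)
            show "A (rl ?\<sigma> a) (cl ?\<sigma> c) = ?\<sigma> f" using e(1)[OF ac(1)] e(2)[OF ac(2)] sC by (simp add: s_def)
          qed (use nl in auto)
          moreover have "map ?\<sigma> (rev h) = map orbit_sym [0..<length h]"
          proof -
            have "map ?\<sigma> (rev h) = map \<sigma> (rev h)" using eq by (intro map_cong) simp_all
            then show ?thesis using prems(5) by (rule trans)
          qed
          ultimately have 3: "table_ok ?\<sigma> (set (f # tc)) (Ent a c f # Ent f f f # tab)"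
            "map ?\<sigma> (rev h) = map orbit_sym [0..<length h]" "rl ?\<sigma> ` lines (set (f # tc)) \<subseteq> insert (\<rho>0 s) (rl \<sigma> ` lines (set tc))"
            by simp_all
          show ?thesis
          proof (rule go[of "Ent a c f # Ent f f f # tab" "f # tc" fs' f ?\<sigma>])
            show "go (Ent a c f # Ent f f f # tab) (f # tc) fs' f" using nw unfolding Cons list.case .
            show "labelling ?\<sigma> (set (f # tc))" "represents ?\<sigma> (set (f # tc)) L ?C" unfolding list.set by (fact nl(1), fact nl(3))
            show "table_ok ?\<sigma> (set (f # tc)) (Ent a c f # Ent f f f # tab)" "map ?\<sigma> (rev h) = map orbit_sym [0..<length h]"
              by (fact 3(1), fact 3(2))
            show "rl ?\<sigma> ` lines (set (f # tc)) \<subseteq> orbit_rows start"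
              by (rule order.trans[OF 3(3)]) (use row prems(11) in simp)
            show "cell_sym ?C = ?\<sigma> f" by (simp add: s_def)
            show "set h \<subseteq> set (f # tc)" using prems(6) by auto
            show "distinct ((f # tc) @ fs')" "U \<notin> set fs'" "V \<notin> set fs'" "length (f # tc) + length fs' = 5"
              using prems(7-10) Cons by auto
          qed simp
        qed
      qed
    qed
  qed
qed simp

end

section \<open>The exceptional cycle closes after sixteen exchanges\<close>

primrec follow :: "lbl list \<Rightarrow> entry list \<times> lstate \<Rightarrow> entry list \<times> lstate" where
  "follow [] st = st"
| "follow (s # h) st = follow h (case st of (tab, pos, a, b, c, d) \<Rightarrow> (Ent a c s # tab, label_flip_rows (label_swap s (pos, a, b, c, d))))"

definition "table0 = [Ent L0 L0 L0, Ent L1 L1 L1, Ent L2 L2 L2, Ent L3 L3 L3]"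

definition closed_cycle :: "lstate \<Rightarrow> bool" where
  "closed_cycle L = (case L of (pos, a, b, c, d) \<Rightarrow> a = U \<and> b = V \<and> c = U \<and> d = V \<and> all_lazy (\<lambda>s. place s pos = (s, s)) [L0, L1, L2, L3])"

lemma closed_word1: "closed_cycle (snd (follow word1 (table0, label_start)))" by code_simp
lemma closed_word2: "closed_cycle (snd (follow word2 (table0, label_start)))" by code_simp

context labelled
begin

lemma orbit_0: "orbit 0 = start"
  by (simp add: orbit_def)

lemma represents_start: "labelling \<sigma> T \<Longrightarrow> represents \<sigma> T label_start start"
  unfolding represents_def label_start_def start_def prod.case place.simps fst_conv snd_conv
  by (intro conjI exI[of _ \<rho>0] exI[of _ \<gamma>0]) (auto simp: lines_def labelling_def line_def)

lemma pattern:
  assumes "search ok 60 [] [] [] [L0, L1, L2, L3, L4] label_start" "card (orbit_rows start) \<le> 7"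
    and ok: "\<And>\<sigma> h. inj_on \<sigma> (set h) \<Longrightarrow> map \<sigma> (rev h) = map orbit_sym [0..<length h] \<Longrightarrow> ok h"
  shows "\<exists>\<sigma> h. (h = word1 \<or> h = word2) \<and> labelling \<sigma> (set h) \<and> map \<sigma> h = map orbit_sym [0..<length h]"
proof (rule search_sound[OF assms(1)])
  fix \<sigma> :: "lbl \<Rightarrow> 's"
  show l: "labelling \<sigma> (set [])" by (simp add: labelling_def)
  show "represents \<sigma> (set []) label_start (orbit (length []))" using represents_start[OF l] by (simp add: orbit_0)
  have "row (orbit 0) = u" "row (orbit 1) = v" by (simp_all add: orbit_def start_def)
  then have "u \<in> orbit_rows start" "v \<in> orbit_rows start" using row_orbit by metis+
  then show "rl \<sigma> ` lines (set []) \<subseteq> orbit_rows start" by (simp add: lines_def)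
qed (use assms in \<open>auto simp: table_ok_def\<close>)

lemma follow_sound:
  assumes "labelling \<sigma> T" "table_ok \<sigma> T tab" "represents \<sigma> T L (orbit n)" "set h \<subseteq> T" "map \<sigma> h = map orbit_sym [n..<n + length h]"
  shows "table_ok \<sigma> T (fst (follow h (tab, L))) \<and> represents \<sigma> T (snd (follow h (tab, L))) (orbit (n + length h))
    \<and> (\<forall>i<length h. row (orbit (n + i)) \<in> rl \<sigma> ` lines T)"
  using assms(2-5)
proof (induction h arbitrary: tab L n)
  case (Cons s h)
  obtain pos a b c d where L: "L = (pos, a, b, c, d)" by (metis prod_cases5)
  note rc = represents_row_col[OF Cons.prems(2)[unfolded L]]
  have s: "s \<in> T" using Cons.prems by simp
  have "[n..<n + length (s # h)] = n # [Suc n..<Suc n + length h]" by (simp add: upt_conv_Cons del: upt_Suc)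
  then have m: "\<sigma> s = orbit_sym n" "map \<sigma> h = map orbit_sym [Suc n..<Suc n + length h]"
    using Cons.prems(4) by (simp_all del: upt_Suc)
  then have sy: "cell_sym (orbit n) = \<sigma> s" by (simp add: orbit_sym_def)
  have "table_ok \<sigma> T (Ent a c s # tab)"
    using Cons.prems(1) rc s sy by (intro table_ok_Cons) (simp_all add: cell_sym_def)
  moreover have "represents \<sigma> T (label_flip_rows (label_swap s L)) (orbit (Suc n))"
    using represents_flip_rows[OF represents_swap[OF assms(1) Cons.prems(2) s sy]] by (simp add: orbit_Suc)
  ultimately have "table_ok \<sigma> T (fst (follow h (Ent a c s # tab, label_flip_rows (label_swap s L)))) \<and>
    represents \<sigma> T (snd (follow h (Ent a c s # tab, label_flip_rows (label_swap s L)))) (orbit (Suc n + length h)) \<and>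
    (\<forall>i<length h. row (orbit (Suc n + i)) \<in> rl \<sigma> ` lines T)"
    using Cons.prems m by (intro Cons.IH) (simp_all del: upt_Suc)
  moreover have "row (orbit n) \<in> rl \<sigma> ` lines T" using rc by simp
  moreover have "row (orbit (n + i)) \<in> rl \<sigma> ` lines T" if "i < length (s # h)"
    "\<forall>i<length h. row (orbit (Suc n + i)) \<in> rl \<sigma> ` lines T" "row (orbit n) \<in> rl \<sigma> ` lines T" for i
    using that by (cases i) simp_all
  ultimately show ?case by (simp add: L)
qed simp

lemma set_h: "h = word1 \<or> h = word2 \<Longrightarrow> set h = {L0, L1, L2, L3} \<and> length h = 16"
  by (auto simp: word1_def word2_def)

text \<open>Executing the word on labels returns to the start, so the cycle has period 16 and meets
  only the home rows of four symbols and the two missed rows. The cells read on the way form the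
  table from which the case tree starts.\<close>

lemma pattern_closed:
  assumes h: "h = word1 \<or> h = word2" and lb: "labelling \<sigma> (set h)" and m: "map \<sigma> h = map orbit_sym [0..<length h]"
  shows "card (orbit_rows start) \<le> 6" "table_ok \<sigma> (set h) (fst (follow h (table0, label_start)))"
proof -
  have T: "set h = {L0, L1, L2, L3}" "length h = 16" using set_h[OF h] by auto
  have home: "A (\<rho>0 s) (\<gamma>0 s) = s" if "s \<in> S" for s using base that by (simp add: rainbow_def)
  have "\<sigma> l \<in> S" "l \<noteq> U" "l \<noteq> V" if "l \<in> set h" for l using lb that unfolding labelling_def by auto
  then have "A (rl \<sigma> l) (cl \<sigma> l) = \<sigma> l" if "l \<in> set h" for l using home that by (simp add: line_def)
  then have table0: "table_ok \<sigma> (set h) table0" unfolding table_ok_def table0_def by (auto simp: T(1) lines_def)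
  note fs = follow_sound[OF lb table0 represents_start[OF lb, folded orbit_0] order.refl, simplified, OF m]
  show "table_ok \<sigma> (set h) (fst (follow h (table0, label_start)))" using fs by blast
  have cl: "closed_cycle (snd (follow h (table0, label_start)))" using h closed_word1 closed_word2 by blast
  obtain pos a b c d where L: "snd (follow h (table0, label_start)) = (pos, a, b, c, d)" by (metis prod_cases5)
  have L': "a = U" "b = V" "c = U" "d = V" "\<And>s. s \<in> set h \<Longrightarrow> place s pos = (s, s)"
    using cl unfolding L closed_cycle_def all_lazy T(1) by auto
  have "represents \<sigma> (set h) (pos, a, b, c, d) (orbit 16)" using fs L T(2) by simp
  then obtain \<rho> \<gamma> where s16: "orbit 16 = (\<rho>, \<gamma>, u, v, p, q)"
    "\<And>s. s \<in> set h \<Longrightarrow> \<rho> (\<sigma> s) = rl \<sigma> s \<and> \<gamma> (\<sigma> s) = cl \<sigma> s"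
    "\<And>s. s \<in> S - \<sigma> ` set h \<Longrightarrow> \<rho> s = \<rho>0 s \<and> \<gamma> s = \<gamma>0 s"
    using L' unfolding represents_def by auto
  have on: "\<rho> s = \<rho>0 s \<and> \<gamma> s = \<gamma>0 s" if "s \<in> S" for s
  proof (cases "s \<in> \<sigma> ` set h")
    case True
    then obtain l where l: "l \<in> set h" "s = \<sigma> l" by blast
    then have "l \<noteq> U" "l \<noteq> V" using lb unfolding labelling_def by auto
    then show ?thesis using s16(2)[OF l(1)] l(2) by (simp add: line_def)
  qed (use s16(3) that in simp)
  have v: "\<rho> \<in> S \<rightarrow>\<^sub>E X" "\<gamma> \<in> S \<rightarrow>\<^sub>E Z" using valid_orbit[of 16] s16(1) by simp_all
  have v0: "\<rho>0 \<in> S \<rightarrow>\<^sub>E X" "\<gamma>0 \<in> S \<rightarrow>\<^sub>E Z" using base by simp_all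
  have "\<rho> = \<rho>0" by (rule PiE_ext[OF v(1) v0(1)]) (use on in simp)
  moreover have "\<gamma> = \<gamma>0" by (rule PiE_ext[OF v(2) v0(2)]) (use on in simp)
  ultimately have per: "(step ^^ 16) start = start" using s16(1) by (simp add: orbit_def start_def)
  have "row (orbit i) \<in> rl \<sigma> ` lines (set h)" for i
  proof -
    have "orbit i = orbit (i mod 16)" using funpow_mod_eq[OF per, of i] by (simp add: orbit_def)
    then show ?thesis using fs T(2) by simp
  qed
  then have "orbit_rows start \<subseteq> rl \<sigma> ` lines (set h)" unfolding orbit_rows_def orbit_def by blast
  then have "card (orbit_rows start) \<le> card (rl \<sigma> ` lines (set h))" by (intro card_mono) (simp_all add: lines_def)
  also have "\<dots> \<le> card (lines (set h))" by (rule card_image_le) (simp add: lines_def)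
  also have "\<dots> = 6" by (simp add: T(1) lines_def)
  finally show "card (orbit_rows start) \<le> 6" .
qed

end

section \<open>The choice of the starting point on a cycle\<close>

context deficient
begin

text \<open>Phrased for an arbitrary configuration and not inside \<open>labelled\<close>, because
  the starting point still has to be found on the cycle.\<close>

definition has_word :: "('r, 'c, 's) config \<Rightarrow> bool" where
  "has_word C \<longleftrightarrow> (\<exists>\<sigma> h. (h = word1 \<or> h = word2) \<and> inj_on \<sigma> (set h) \<and> \<sigma> ` set h \<subseteq> S \<and>
     map \<sigma> h = map (\<lambda>n. cell_sym ((step ^^ n) C)) [0..<length h])"

lemma has_wordI:
  assumes "valid C" "card (orbit_rows C) \<le> 7" "search ok 60 [] [] [] [L0, L1, L2, L3, L4] label_start"
    and "\<And>\<sigma> h. inj_on \<sigma> (set h) \<Longrightarrow> map \<sigma> (rev h) = map (\<lambda>n. cell_sym ((step ^^ n) C)) [0..<length h] \<Longrightarrow> ok h"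
  shows "has_word C"
proof -
  obtain \<rho> \<gamma> x y w q where C: "C = (\<rho>, \<gamma>, x, y, w, q)" by (metis prod_cases6)
  interpret labelled X Z A S \<rho> \<gamma> x y w q by standard (use assms(1) C in simp)
  have e: "orbit_sym = (\<lambda>n. cell_sym ((step ^^ n) C))" "start = C" unfolding orbit_sym_def orbit_def start_def C by auto
  show ?thesis using pattern[OF assms(3)] assms(2,4) unfolding has_word_def e labelling_def by blast
qed

lemma ex_has_word:
  assumes v: "valid C" and R7: "card (orbit_rows C) \<le> 7"
  shows "\<exists>i. has_word ((step ^^ i) C)"
proof -
  define s where "s n = cell_sym ((step ^^ n) C)" for n
  define D where "D n \<longleftrightarrow> s (n + 3) = s n" for n
  have sh: "(\<lambda>n. cell_sym ((step ^^ n) ((step ^^ i) C))) = (\<lambda>n. s (n + i))" for i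
    unfolding s_def by (simp add: funpow_add)
  have at: "has_word ((step ^^ i) C)" if "search ok 60 [] [] [] [L0, L1, L2, L3, L4] label_start"
    "\<And>\<sigma> h. inj_on \<sigma> (set h) \<Longrightarrow> map \<sigma> (rev h) = map (\<lambda>n. s (n + i)) [0..<length h] \<Longrightarrow> ok h" for i ok
    by (rule has_wordI[OF valid_steps[OF v] _ that(1)]) (use orbit_rows_steps[OF v] R7 that(2) in \<open>simp_all add: sh\<close>)
  show ?thesis
  proof (cases "\<exists>i. D i \<and> D (i + 1)")
    case False
    have "has_word ((step ^^ 0) C)"
    proof (rule at[OF search_no_two_repeats])
      fix \<sigma> :: "lbl \<Rightarrow> 's" and h
      assume inj: "inj_on \<sigma> (set h)" and m: "map \<sigma> (rev h) = map (\<lambda>n. s (n + 0)) [0..<length h]"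
      show "no_two_repeats h"
      proof (cases h rule: no_two_repeats.cases)
        case (1 a b c d e t)
        have "\<sigma> e = s (length t)" "\<sigma> d = s (length t + 1)" "\<sigma> b = s (length t + 3)" "\<sigma> a = s (length t + 4)"
          using m unfolding 1 by (simp_all add: numeral_eq_Suc)
        moreover have "\<not> (D (length t) \<and> D (length t + 1))" using False by blast
        ultimately show ?thesis unfolding 1 D_def by (auto simp: numeral_eq_Suc)
      qed simp_all
    qed
    then show ?thesis by blast
  next
    case True
    then obtain i where i: "D i" "D (i + 1)" by blast
    show ?thesis
    proof (cases "\<exists>i. D i \<and> D (i + 1) \<and> \<not> D (i + 2)")
      case True
      then obtain j where j: "D j" "D (j + 1)" "\<not> D (j + 2)" by blast
      have "has_word ((step ^^ j) C)"
      proof (rule at[OF search_two_repeats])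
        fix \<sigma> :: "lbl \<Rightarrow> 's" and h
        assume inj: "inj_on \<sigma> (set h)" and m: "map \<sigma> (rev h) = map (\<lambda>n. s (n + j)) [0..<length h]"
        note u = numeral_eq_Suc
        show "two_repeats h"
        \<comment> \<open>The head of \<open>h\<close> is the latest symbol, so histories of length
          4, 5 and 6 test \<open>D j\<close>, \<open>D (j + 1)\<close> and
          \<open>\<not> D (j + 2)\<close>.\<close>
        proof (cases h rule: two_repeats.cases)
          case (1 a b c d)
          have "\<sigma> d = s j" "\<sigma> a = s (j + 3)" using m unfolding 1 by (simp_all add: u)
          then have "\<sigma> a = \<sigma> d" using j(1) unfolding D_def by simp
          then have "a = d" using inj_onD[OF inj, of a d] unfolding 1 by simp
          then show ?thesis unfolding 1 by simp
        next
          case (2 a b c d e)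
          have "\<sigma> d = s (j + 1)" "\<sigma> a = s (j + 1 + 3)" using m unfolding 2 by (simp_all add: u)
          then have "\<sigma> a = \<sigma> d" using j(2) unfolding D_def by simp
          then have "a = d" using inj_onD[OF inj, of a d] unfolding 2 by simp
          then show ?thesis unfolding 2 by simp
        next
          case (3 a b c d e f)
          have "\<sigma> d = s (j + 2)" "\<sigma> a = s (j + 2 + 3)" using m unfolding 3 by (simp_all add: u)
          then have "\<sigma> a \<noteq> \<sigma> d" using j(3) unfolding D_def by simp
          then show ?thesis unfolding 3 by auto
        qed simp_all
      qed
      then show ?thesis by blast
    next
      case False
      \<comment> \<open>No run of repeats ever ends, so one pair of consecutive repeats propagates
        to all later positions, and \<open>i\<close> can serve as the start.\<close>
      have all: "D (i + k) \<and> D (i + k + 1)" for k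
      proof (induction k)
        case (Suc k)
        then have "D (i + k + 2)" using False by blast
        then show ?case using Suc by (simp add: numeral_eq_Suc)
      qed (use i in simp)
      have "has_word ((step ^^ i) C)"
      proof (rule at[OF search_all_repeats])
        fix \<sigma> :: "lbl \<Rightarrow> 's" and h
        assume inj: "inj_on \<sigma> (set h)" and m: "map \<sigma> (rev h) = map (\<lambda>n. s (n + i)) [0..<length h]"
        show "all_repeats h"
        proof (cases h rule: all_repeats.cases)
          case (1 a b c d t)
          have "\<sigma> d = s (length t + i)" "\<sigma> a = s (length t + 3 + i)"
            using m unfolding 1 by (simp_all add: numeral_eq_Suc)
          then have "\<sigma> a = \<sigma> d" using all[of "length t"] unfolding D_def by (simp add: algebra_simps)
          then have "a = d" using inj_onD[OF inj, of a d] unfolding 1 by simp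
          then show ?thesis unfolding 1 by simp
        qed simp_all
      qed
      then show ?thesis by blast
    qed
  qed
qed

text \<open>The bound 7 from the outside rows forces one of the words from some point of the cycle
  on, and the cycle of a word meets at most six rows. The number of rows does not depend on the
  starting point.\<close>

theorem card_orbit_rows_le_6:
  assumes v: "valid C" and "card S \<le> 9"
  shows "card (orbit_rows C) \<le> 6"
proof -
  have "card (orbit_rows C) \<le> 7" using card_orbit_rows_le[OF v] assms(2) by simp
  then obtain i where p: "has_word ((step ^^ i) C)" using ex_has_word[OF v] by blast
  obtain \<rho> \<gamma> x y w q where C: "(step ^^ i) C = (\<rho>, \<gamma>, x, y, w, q)" by (metis prod_cases6)
  interpret labelled X Z A S \<rho> \<gamma> x y w q by standard (use valid_steps[OF v, of i] C in simp)
  obtain \<sigma> h where h: "h = word1 \<or> h = word2" "inj_on \<sigma> (set h)" "\<sigma> ` set h \<subseteq> S"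
    "map \<sigma> h = map (\<lambda>n. cell_sym ((step ^^ n) ((step ^^ i) C))) [0..<length h]" using p unfolding has_word_def by blast
  have "labelling \<sigma> (set h)" using h(2,3) set_h[OF h(1)] unfolding labelling_def by auto
  moreover have "map \<sigma> h = map orbit_sym [0..<length h]" using h(4) unfolding orbit_sym_def orbit_def start_def C .
  ultimately have "card (orbit_rows start) \<le> 6" using pattern_closed(1)[OF h(1)] by blast
  then show ?thesis using orbit_rows_steps[OF v, of i] C unfolding start_def by simp
qed

end

section \<open>The case tree\<close>

text \<open>
  A node of the case tree starts with a path of exchanges from the initial transversal. In a path, the move
  with number \<open>2 * i + j\<close> interchanges the missed rows if \<open>i = 1\<close> and the missed columns if \<open>j = 1\<close>, and then
  exchanges; the last move of a path only interchanges. \<open>Bn\<close> branches over the cell that would be exchanged next,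
  \<open>Vn\<close> and \<open>Wn\<close> close the case because the cycle from there with a fixed column (row) has seven rows (columns).
  The last argument continues with the next sibling. The trees were found by a computer search.
\<close>

datatype mv = M0 | M1 | M2 | M3

datatype forest = Nn | Vn "mv list" forest | Wn "mv list" forest | Bn "mv list" forest forest

primrec flip :: "mv \<Rightarrow> lstate \<Rightarrow> lstate" where
  "flip M0 L = L" | "flip M1 L = label_flip_cols L" | "flip M2 L = label_flip_rows L" | "flip M3 L = label_flip_rows (label_flip_cols L)"

definition table_swap :: "entry list \<Rightarrow> lstate \<Rightarrow> lstate option" where
  "table_swap tab L = (case L of (pos, a, b, c, d) \<Rightarrow> (case entry_at a c tab of None \<Rightarrow> None | Some s \<Rightarrow> Some (label_swap s L)))"

primrec run :: "entry list \<Rightarrow> mv list \<Rightarrow> lstate \<Rightarrow> lstate option" where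
  "run tab [] L = Some L"
| "run tab (m # ms) L = (let L' = flip m L in case ms of [] \<Rightarrow> Some L'
     | _ # _ \<Rightarrow> (case table_swap tab L' of None \<Rightarrow> None | Some L'' \<Rightarrow> run tab ms L''))"

definition insert_new :: "lbl \<Rightarrow> lbl list \<Rightarrow> lbl list" where
  "insert_new x xs = (if x \<in> set xs then xs else x # xs)"

text \<open>The cycle is followed only until seven labels are collected, as this exceeds the bound
  6. Meeting an unknown cell earlier makes the check fail.\<close>

primrec walk :: "bool \<Rightarrow> entry list \<Rightarrow> nat \<Rightarrow> lbl list \<Rightarrow> lstate \<Rightarrow> bool" where
  "walk r tab 0 acc L = False"
| "walk r tab (Suc k) acc L = (case L of (pos, a, b, c, d) \<Rightarrow>
     (let acc' = insert_new (if r then b else d) (insert_new (if r then a else c) acc) in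
      if 7 \<le> length acc' then True
      else (case table_swap tab L of None \<Rightarrow> False | Some L' \<Rightarrow> walk r tab k acc' (if r then label_flip_rows L' else label_flip_cols L'))))"

type_synonym ctxt = "entry list \<times> lbl list \<times> lbl list"

text \<open>Certificates refer to children by position. Hence the fixed order: admissible known
  symbols in the order of \<open>tc\<close>, then a new symbol; new labels are appended to
  \<open>tc\<close> to keep this order stable.\<close>

definition expand :: "ctxt \<Rightarrow> mv list \<Rightarrow> ctxt list option" where
  "expand t ms = (case t of (tab, tc, fs) \<Rightarrow> (case run tab ms label_start of None \<Rightarrow> None
     | Some (pos, a, b, c, d) \<Rightarrow> (case entry_at a c tab of Some _ \<Rightarrow> None
       | None \<Rightarrow> (let us = blocked a c tab in
           Some (map (\<lambda>s. (Ent a c s # tab, tc, fs)) (filter (\<lambda>s. s \<notin> set us) tc) @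
             (case fs of [] \<Rightarrow> [] | f # fs' \<Rightarrow> [(Ent a c f # Ent f f f # tab, tc @ [f], fs')]))))))"

definition violates :: "bool \<Rightarrow> ctxt \<Rightarrow> mv list \<Rightarrow> bool" where
  "violates r t ms = (case t of (tab, tc, fs) \<Rightarrow> (case run tab ms label_start of None \<Rightarrow> False
     | Some L \<Rightarrow> walk r tab 60 [] L))"

primrec refutes :: "forest \<Rightarrow> ctxt list \<Rightarrow> bool" where
  "refutes Nn ts = (case ts of [] \<Rightarrow> True | _ # _ \<Rightarrow> False)"
| "refutes (Vn ms n) ts = (case ts of [] \<Rightarrow> False | t # ts' \<Rightarrow> if violates True t ms then refutes n ts' else False)"
| "refutes (Wn ms n) ts = (case ts of [] \<Rightarrow> False | t # ts' \<Rightarrow> if violates False t ms then refutes n ts' else False)"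
| "refutes (Bn ms g n) ts = (case ts of [] \<Rightarrow> False | t # ts' \<Rightarrow>
     (case expand t ms of None \<Rightarrow> False | Some us \<Rightarrow> if refutes g us then refutes n ts' else False))"

text \<open>Nine labels are enough for all symbols, so once \<open>fs\<close> is empty a cell can
  only contain a known symbol.\<close>

definition root :: "lbl list \<Rightarrow> ctxt" where
  "root h = (fst (follow h (table0, label_start)), [L0, L1, L2, L3], [L4, L5, L6, L7, L8])"

text \<open>A node \<open>Bn ms Nn n\<close> closes its case because \<open>expand\<close> yields no
  child: every known symbol is blocked at the cell and no label is left.\<close>

definition cert1 :: forest where
  "cert1 = (Bn [M1] (Bn [M1,M2] (Bn [M0,M1] (Bn [M0,M2,M1] (Wn [M0,M0] (Wn [M0,M0] Nn)) (Wn [M0,M1,M0] (Wn [M0,M1,M0] Nn))) Nn) (Bn [M1,M1] (Bn [M0,M2,M1] (Wn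
[M0,M2,M1,M3,M2,M0] (Bn [M3] (Bn [M2,M1] (Bn [M2,M1,M1] (Wn [M3,M1,M1,M2,M2,M1,M0] (Wn [M3,M1,M0] (Wn [M3,M1,M0] (Wn [M3,M1,M0] Nn)))) (Wn [M2,M1,M0]
Nn)) (Bn [M3,M1] (Bn [M2,M2,M1] (Wn [M2,M2,M1,M3,M2,M0] (Bn [M0,M2,M2,M1,M3,M2] (Bn [M2,M2,M2,M1,M3,M2] (Bn [M2,M1] (Bn [M2,M1,M2,M2] (Bn
[M2,M1,M2,M1,M1] Nn Nn) (Bn [M0,M2,M2,M2,M2,M2,M1,M3,M1,M2] (Bn [M0,M2,M2,M2,M2,M2,M1,M3,M1,M1,M1] Nn Nn) (Bn [M0,M1] (Bn
[M2,M2,M2,M2,M2,M2,M1,M3,M1,M2] Nn (Bn [M0,M1,M2,M2] Nn Nn)) Nn))) (Bn [M2,M1] (Bn [M2,M1,M2,M2] (Bn [M2,M1,M2,M1,M1] Nn Nn) (Bn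
[M0,M2,M2,M2,M2,M2,M1,M3,M1,M2] (Bn [M0,M2,M2,M2,M2,M2,M1,M3,M1,M1,M1] Nn Nn) (Bn [M0,M1] (Bn [M2,M2,M2,M2,M2,M2,M1,M3,M1,M2] (Bn
[M2,M2,M2,M2,M2,M2,M1,M3,M1,M1,M1] Nn Nn) (Bn [M0,M1,M2,M2] (Bn [M0,M1,M2,M1,M1] Nn Nn) Nn)) Nn))) Nn)) (Bn [M2,M2,M2,M1,M3,M2] (Bn [M2,M1] (Bn
[M2,M1,M2,M2] (Bn [M2,M1,M2,M1,M1] Nn Nn) (Bn [M0,M2,M2,M2,M2,M2,M1,M3,M1,M2] (Bn [M0,M2,M2,M2,M2,M2,M1,M3,M1,M1,M1] Nn Nn) (Bn [M0,M1] (Bn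
[M2,M2,M2,M2,M2,M2,M1,M3,M1,M2] (Bn [M2,M2,M2,M2,M2,M2,M1,M3,M1,M1,M1] Nn Nn) (Bn [M0,M1,M2,M2] (Bn [M0,M1,M2,M1,M1] Nn Nn) Nn)) Nn))) (Bn [M2,M1] (Bn
[M2,M1,M2,M2] (Bn [M2,M1,M2,M1,M1] Nn Nn) (Bn [M0,M2,M2,M2,M2,M2,M1,M3,M1,M2] (Bn [M0,M2,M2,M2,M2,M2,M1,M3,M1,M1,M1] Nn Nn) (Bn [M0,M1] (Bn
[M2,M2,M2,M2,M2,M2,M1,M3,M1,M2] (Bn [M2,M2,M2,M2,M2,M2,M1,M3,M1,M1,M1] Nn Nn) (Bn [M0,M1,M2,M2] (Bn [M0,M1,M2,M1,M1] Nn Nn) Nn)) Nn))) Nn)) Nn)) Nn))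
(Bn [M2,M2,M1] (Wn [M2,M2,M1,M3,M2,M0] (Bn [M2,M1] (Bn [M0,M1] (Bn [M2,M1,M2,M2] (Bn [M0,M2,M2,M1,M3,M2] (Bn [M2,M2,M2,M1,M3,M2] (Bn [M2,M1,M2,M1,M1]
Nn Nn) (Bn [M2,M2,M2,M1,M3,M2] (Bn [M2,M1,M2,M1,M1] Nn Nn) Nn)) (Bn [M0,M2,M2,M1,M3,M2] (Bn [M2,M2,M2,M1,M3,M2] (Bn [M2,M1,M2,M1,M1] Nn Nn) (Bn
[M2,M2,M2,M1,M3,M2] (Bn [M2,M1,M2,M1,M1] Nn Nn) Nn)) (Bn [M0,M2,M2,M1,M3,M2] (Bn [M2,M2,M2,M1,M3,M2] (Bn [M2,M1,M2,M1,M1] Nn Nn) (Bn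
[M2,M2,M2,M1,M3,M2] (Bn [M2,M1,M2,M1,M1] Nn Nn) Nn)) Nn))) (Bn [M0,M1,M2,M2] (Bn [M2,M1,M2,M2] (Bn [M0,M2,M2,M1,M3,M2] (Bn [M2,M2,M2,M1,M3,M2] Nn Nn)
(Bn [M0,M2,M2,M1,M3,M2] (Bn [M2,M2,M2,M1,M3,M2] Nn Nn) Nn)) (Bn [M2,M1,M2,M2] (Bn [M0,M2,M2,M1,M3,M2] (Bn [M2,M2,M2,M1,M3,M2] Nn Nn) (Bn
[M0,M2,M2,M1,M3,M2] (Bn [M2,M2,M2,M1,M3,M2] Nn Nn) Nn)) (Bn [M2,M1,M2,M2] (Bn [M0,M2,M2,M1,M3,M2] (Bn [M2,M2,M2,M1,M3,M2] Nn Nn) (Bn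
[M0,M2,M2,M1,M3,M2] (Bn [M2,M2,M2,M1,M3,M2] Nn Nn) Nn)) Nn))) (Bn [M2,M1,M2,M2] (Bn [M2,M1,M2,M1,M2,M1] (Bn [M0,M2,M2,M1,M3,M2] (Bn
[M2,M2,M2,M1,M3,M2] Nn Nn) Nn) (Bn [M2,M1,M2,M1,M2,M1] (Bn [M0,M2,M2,M1,M3,M2] (Bn [M2,M2,M2,M1,M3,M2] Nn Nn) Nn) Nn)) Nn))) (Bn [M0,M1] (Bn
[M0,M2,M2,M1,M3,M2] (Bn [M0,M2,M2,M2,M2,M2,M1,M3,M1,M2] (Bn [M2,M2,M2,M1,M3,M2] (Bn [M2,M2,M2,M2,M2,M2,M1,M3,M1,M2] Nn Nn) (Bn [M2,M2,M2,M1,M3,M2] (Bn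
[M2,M2,M2,M2,M2,M2,M1,M3,M1,M2] Nn Nn) Nn)) (Bn [M0,M2,M2,M2,M2,M2,M1,M3,M1,M2] (Bn [M2,M2,M2,M1,M3,M2] (Bn [M2,M2,M2,M2,M2,M2,M1,M3,M1,M2] Nn Nn) (Bn
[M2,M2,M2,M1,M3,M2] (Bn [M2,M2,M2,M2,M2,M2,M1,M3,M1,M2] Nn Nn) Nn)) (Bn [M0,M2,M2,M2,M2,M2,M1,M3,M1,M2] (Bn [M2,M2,M2,M1,M3,M2] (Bn
[M2,M2,M2,M2,M2,M2,M1,M3,M1,M2] Nn Nn) (Bn [M2,M2,M2,M1,M3,M2] (Bn [M2,M2,M2,M2,M2,M2,M1,M3,M1,M2] Nn Nn) Nn)) Nn))) (Bn [M0,M1,M2,M2] (Bn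
[M0,M2,M2,M1,M3,M2] (Bn [M0,M1,M2,M1,M1] (Bn [M2,M2,M2,M1,M3,M2] Nn Nn) (Bn [M0,M1,M2,M1,M1] (Bn [M2,M2,M2,M1,M3,M2] Nn Nn) Nn)) (Bn
[M0,M2,M2,M1,M3,M2] (Bn [M0,M1,M2,M1,M1] (Bn [M2,M2,M2,M1,M3,M2] Nn Nn) (Bn [M0,M1,M2,M1,M1] (Bn [M2,M2,M2,M1,M3,M2] Nn Nn) Nn)) (Bn
[M0,M2,M2,M1,M3,M2] (Bn [M0,M1,M2,M1,M1] (Bn [M2,M2,M2,M1,M3,M2] Nn Nn) (Bn [M0,M1,M2,M1,M1] (Bn [M2,M2,M2,M1,M3,M2] Nn Nn) Nn)) Nn))) (Bn
[M0,M2,M2,M2,M2,M2,M1,M3,M1,M2] (Bn [M0,M2,M2,M2,M2,M2,M1,M3,M1,M1,M2,M1] (Bn [M0,M2,M2,M1,M3,M2] (Bn [M2,M2,M2,M1,M3,M2] Nn Nn) Nn) (Bn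
[M0,M2,M2,M2,M2,M2,M1,M3,M1,M1,M2,M1] (Bn [M0,M2,M2,M1,M3,M2] (Bn [M2,M2,M2,M1,M3,M2] Nn Nn) Nn) Nn)) Nn))) (Bn [M0,M1] (Bn
[M2,M2,M2,M2,M2,M2,M1,M3,M1,M2] (Bn [M2,M2,M2,M2,M2,M2,M1,M3,M1,M1,M2,M1] (Bn [M0,M2,M2,M1,M3,M2] (Bn [M2,M2,M2,M1,M3,M2] Nn Nn) Nn) (Bn
[M2,M2,M2,M2,M2,M2,M1,M3,M1,M1,M2,M1] (Bn [M0,M2,M2,M1,M3,M2] (Bn [M2,M2,M2,M1,M3,M2] Nn Nn) Nn) Nn)) (Bn [M0,M1,M2,M2] (Bn [M0,M1,M2,M1,M2,M1] (Bn
[M0,M2,M2,M1,M3,M2] (Bn [M2,M2,M2,M1,M3,M2] Nn Nn) Nn) (Bn [M0,M1,M2,M1,M2,M1] (Bn [M0,M2,M2,M1,M3,M2] (Bn [M2,M2,M2,M1,M3,M2] Nn Nn) Nn) Nn)) Nn))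
Nn))) (Bn [M0,M2,M2,M1,M3,M2] (Bn [M2,M2,M2,M1,M3,M2] (Bn [M2,M1] (Bn [M2,M1,M2,M2] (Bn [M2,M1,M2,M1,M1] Nn Nn) (Bn [M0,M2,M2,M2,M2,M2,M1,M3,M1,M2]
(Bn [M0,M2,M2,M2,M2,M2,M1,M3,M1,M1,M1] Nn Nn) (Bn [M0,M1] (Bn [M2,M2,M2,M2,M2,M2,M1,M3,M1,M2] (Bn [M2,M2,M2,M2,M2,M2,M1,M3,M1,M1,M1] Nn Nn) (Bn
[M0,M1,M2,M2] (Bn [M0,M1,M2,M1,M1] Nn Nn) Nn)) Nn))) (Bn [M2,M1] (Bn [M2,M1,M2,M2] (Bn [M2,M1,M2,M1,M1] Nn Nn) (Bn [M0,M2,M2,M2,M2,M2,M1,M3,M1,M2] (Bn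
[M0,M2,M2,M2,M2,M2,M1,M3,M1,M1,M1] Nn Nn) (Bn [M0,M1] (Bn [M2,M2,M2,M2,M2,M2,M1,M3,M1,M2] (Bn [M2,M2,M2,M2,M2,M2,M1,M3,M1,M1,M1] Nn Nn) (Bn
[M0,M1,M2,M2] (Bn [M0,M1,M2,M1,M1] Nn Nn) Nn)) Nn))) Nn)) (Bn [M2,M2,M2,M1,M3,M2] (Bn [M2,M1] (Bn [M2,M1,M2,M2] (Bn [M2,M1,M2,M1,M1] Nn Nn) (Bn
[M0,M2,M2,M2,M2,M2,M1,M3,M1,M2] (Bn [M0,M2,M2,M2,M2,M2,M1,M3,M1,M1,M1] Nn Nn) (Bn [M0,M1] (Bn [M2,M2,M2,M2,M2,M2,M1,M3,M1,M2] (Bn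
[M2,M2,M2,M2,M2,M2,M1,M3,M1,M1,M1] Nn Nn) (Bn [M0,M1,M2,M2] (Bn [M0,M1,M2,M1,M1] Nn Nn) Nn)) Nn))) (Bn [M2,M1] (Bn [M2,M1,M2,M2] (Bn [M2,M1,M2,M1,M1]
Nn Nn) (Bn [M0,M2,M2,M2,M2,M2,M1,M3,M1,M2] (Bn [M0,M2,M2,M2,M2,M2,M1,M3,M1,M1,M1] Nn Nn) (Bn [M0,M1] (Bn [M2,M2,M2,M2,M2,M2,M1,M3,M1,M2] (Bn
[M2,M2,M2,M2,M2,M2,M1,M3,M1,M1,M1] Nn Nn) (Bn [M0,M1,M2,M2] (Bn [M0,M1,M2,M1,M1] Nn Nn) Nn)) Nn))) Nn)) Nn)) Nn))) Nn)) Nn)) (Bn [M2,M2,M2,M1,M3,M2]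
(Bn [M3] (Bn [M2,M1] (Bn [M2,M1,M1] (Wn [M3,M1,M1,M2,M2,M1,M0] (Wn [M3,M1,M0] (Wn [M3,M1,M0] (Wn [M3,M1,M0] (Wn [M3,M1,M0] Nn))))) (Wn [M2,M1,M0] (Wn
[M2,M1,M0] Nn))) (Bn [M3,M1] (Bn [M2,M2,M1] (Wn [M2,M2,M1,M3,M2,M0] (Bn [M0,M2,M2,M1,M3,M2] (Bn [M2,M1] (Bn [M2,M1,M2,M2] (Bn [M2,M1,M2,M1,M1] Nn Nn)
(Bn [M0,M2,M2,M2,M2,M2,M1,M3,M1,M2] (Bn [M0,M2,M2,M2,M2,M2,M1,M3,M1,M1,M1] Nn Nn) (Bn [M0,M1] (Bn [M2,M2,M2,M2,M2,M2,M1,M3,M1,M2] (Bn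
[M2,M2,M2,M2,M2,M2,M1,M3,M1,M1,M1] Nn Nn) (Bn [M0,M1,M2,M2] (Bn [M0,M1,M2,M1,M1] Nn Nn) Nn)) Nn))) Nn) Nn)) (Bn [M2,M2,M1] (Wn [M2,M2,M1,M3,M2,M0] (Bn
[M0,M2,M2,M1,M3,M2] (Bn [M2,M1] (Bn [M2,M1,M2,M2] (Bn [M2,M1,M2,M1,M1] Nn Nn) (Bn [M0,M2,M2,M2,M2,M2,M1,M3,M1,M2] (Bn
[M0,M2,M2,M2,M2,M2,M1,M3,M1,M1,M1] Nn Nn) (Bn [M0,M1] (Bn [M2,M2,M2,M2,M2,M2,M1,M3,M1,M2] Nn (Bn [M0,M1,M2,M2] Nn Nn)) Nn))) (Bn [M2,M1] (Bn
[M2,M1,M2,M2] (Bn [M2,M1,M2,M1,M1] Nn Nn) (Bn [M0,M2,M2,M2,M2,M2,M1,M3,M1,M2] (Bn [M0,M2,M2,M2,M2,M2,M1,M3,M1,M1,M1] Nn Nn) (Bn [M0,M1] (Bn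
[M2,M2,M2,M2,M2,M2,M1,M3,M1,M2] (Bn [M2,M2,M2,M2,M2,M2,M1,M3,M1,M1,M1] Nn Nn) (Bn [M0,M1,M2,M2] (Bn [M0,M1,M2,M1,M1] Nn Nn) Nn)) Nn))) Nn)) (Bn
[M0,M2,M2,M1,M3,M2] (Bn [M2,M1] (Bn [M2,M1,M2,M2] (Bn [M2,M1,M2,M1,M1] Nn Nn) (Bn [M0,M2,M2,M2,M2,M2,M1,M3,M1,M2] (Bn
[M0,M2,M2,M2,M2,M2,M1,M3,M1,M1,M1] Nn Nn) (Bn [M0,M1] (Bn [M2,M2,M2,M2,M2,M2,M1,M3,M1,M2] (Bn [M2,M2,M2,M2,M2,M2,M1,M3,M1,M1,M1] Nn Nn) (Bn
[M0,M1,M2,M2] (Bn [M0,M1,M2,M1,M1] Nn Nn) Nn)) Nn))) Nn) Nn))) Nn)) (Bn [M3,M1] (Bn [M2,M2,M1] (Wn [M2,M2,M1,M3,M2,M0] (Bn [M0,M2,M2,M1,M3,M2] (Bn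
[M2,M1] (Bn [M2,M1,M2,M2] (Bn [M2,M1,M2,M1,M1] Nn Nn) (Bn [M0,M2,M2,M2,M2,M2,M1,M3,M1,M2] (Bn [M0,M2,M2,M2,M2,M2,M1,M3,M1,M1,M1] Nn Nn) (Bn [M0,M1]
(Bn [M2,M2,M2,M2,M2,M2,M1,M3,M1,M2] Nn (Bn [M0,M1,M2,M2] Nn Nn)) Nn))) (Bn [M2,M1] (Bn [M2,M1,M2,M2] (Bn [M2,M1,M2,M1,M1] Nn Nn) (Bn
[M0,M2,M2,M2,M2,M2,M1,M3,M1,M2] (Bn [M0,M2,M2,M2,M2,M2,M1,M3,M1,M1,M1] Nn Nn) (Bn [M0,M1] (Bn [M2,M2,M2,M2,M2,M2,M1,M3,M1,M2] (Bn
[M2,M2,M2,M2,M2,M2,M1,M3,M1,M1,M1] Nn Nn) (Bn [M0,M1,M2,M2] (Bn [M0,M1,M2,M1,M1] Nn Nn) Nn)) Nn))) Nn)) (Bn [M0,M2,M2,M1,M3,M2] (Bn [M2,M1] (Bn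
[M2,M1,M2,M2] (Bn [M2,M1,M2,M1,M1] Nn Nn) (Bn [M0,M2,M2,M2,M2,M2,M1,M3,M1,M2] (Bn [M0,M2,M2,M2,M2,M2,M1,M3,M1,M1,M1] Nn Nn) (Bn [M0,M1] (Bn
[M2,M2,M2,M2,M2,M2,M1,M3,M1,M2] (Bn [M2,M2,M2,M2,M2,M2,M1,M3,M1,M1,M1] Nn Nn) (Bn [M0,M1,M2,M2] (Bn [M0,M1,M2,M1,M1] Nn Nn) Nn)) Nn))) Nn) Nn))) (Bn
[M2,M2,M1] (Wn [M2,M2,M1,M3,M2,M0] (Bn [M0,M2,M2,M1,M3,M2] (Bn [M2,M1] (Bn [M2,M1,M2,M2] (Bn [M2,M1,M2,M1,M1] Nn Nn) (Bn
[M0,M2,M2,M2,M2,M2,M1,M3,M1,M2] (Bn [M0,M2,M2,M2,M2,M2,M1,M3,M1,M1,M1] Nn Nn) (Bn [M0,M1] (Bn [M2,M2,M2,M2,M2,M2,M1,M3,M1,M2] (Bn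
[M2,M2,M2,M2,M2,M2,M1,M3,M1,M1,M1] Nn Nn) (Bn [M0,M1,M2,M2] (Bn [M0,M1,M2,M1,M1] Nn Nn) Nn)) Nn))) (Bn [M2,M1] (Bn [M2,M1,M2,M2] (Bn [M2,M1,M2,M1,M1]
Nn Nn) (Bn [M0,M2,M2,M2,M2,M2,M1,M3,M1,M2] (Bn [M0,M2,M2,M2,M2,M2,M1,M3,M1,M1,M1] Nn Nn) (Bn [M0,M1] (Bn [M2,M2,M2,M2,M2,M2,M1,M3,M1,M2] (Bn
[M2,M2,M2,M2,M2,M2,M1,M3,M1,M1,M1] Nn Nn) (Bn [M0,M1,M2,M2] (Bn [M0,M1,M2,M1,M1] Nn Nn) Nn)) Nn))) Nn)) (Bn [M0,M2,M2,M1,M3,M2] (Bn [M2,M1] (Bn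
[M2,M1,M2,M2] (Bn [M2,M1,M2,M1,M1] Nn Nn) (Bn [M0,M2,M2,M2,M2,M2,M1,M3,M1,M2] (Bn [M0,M2,M2,M2,M2,M2,M1,M3,M1,M1,M1] Nn Nn) (Bn [M0,M1] (Bn
[M2,M2,M2,M2,M2,M2,M1,M3,M1,M2] (Bn [M2,M2,M2,M2,M2,M2,M1,M3,M1,M1,M1] Nn Nn) (Bn [M0,M1,M2,M2] (Bn [M0,M1,M2,M1,M1] Nn Nn) Nn)) Nn))) (Bn [M2,M1] (Bn
[M2,M1,M2,M2] (Bn [M2,M1,M2,M1,M1] Nn Nn) (Bn [M0,M2,M2,M2,M2,M2,M1,M3,M1,M2] (Bn [M0,M2,M2,M2,M2,M2,M1,M3,M1,M1,M1] Nn Nn) (Bn [M0,M1] (Bn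
[M2,M2,M2,M2,M2,M2,M1,M3,M1,M2] (Bn [M2,M2,M2,M2,M2,M2,M1,M3,M1,M1,M1] Nn Nn) (Bn [M0,M1,M2,M2] (Bn [M0,M1,M2,M1,M1] Nn Nn) Nn)) Nn))) Nn)) Nn))) Nn))
Nn))) (Bn [M3] (Bn [M2,M1] (Bn [M2,M1,M1] (Wn [M3,M1,M1,M2,M2,M1,M0] (Wn [M3,M1,M0] (Wn [M3,M1,M0] (Wn [M3,M1,M0] (Wn [M3,M1,M0] (Wn [M3,M1,M0]
Nn)))))) (Wn [M2,M1,M0] (Wn [M2,M1,M0] (Wn [M2,M1,M0] Nn)))) (Bn [M3,M1] (Bn [M2,M2,M1] (Wn [M2,M2,M1,M3,M2,M0] (Bn [M0,M2,M2,M1,M3,M2] (Bn [M2,M1]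
(Bn [M2,M1,M2,M2] (Bn [M2,M1,M2,M1,M1] Nn Nn) (Bn [M0,M2,M2,M2,M2,M2,M1,M3,M1,M2] (Bn [M0,M2,M2,M2,M2,M2,M1,M3,M1,M1,M1] Nn Nn) (Bn [M0,M1] (Bn
[M2,M2,M2,M2,M2,M2,M1,M3,M1,M2] Nn (Bn [M0,M1,M2,M2] Nn Nn)) Nn))) (Bn [M2,M1] (Bn [M2,M1,M2,M2] (Bn [M2,M1,M2,M1,M1] Nn Nn) (Bn
[M0,M2,M2,M2,M2,M2,M1,M3,M1,M2] (Bn [M0,M2,M2,M2,M2,M2,M1,M3,M1,M1,M1] Nn Nn) (Bn [M0,M1] (Bn [M2,M2,M2,M2,M2,M2,M1,M3,M1,M2] (Bn
[M2,M2,M2,M2,M2,M2,M1,M3,M1,M1,M1] Nn Nn) (Bn [M0,M1,M2,M2] (Bn [M0,M1,M2,M1,M1] Nn Nn) Nn)) Nn))) Nn)) (Bn [M0,M2,M2,M1,M3,M2] (Bn [M2,M1] (Bn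
[M2,M1,M2,M2] (Bn [M2,M1,M2,M1,M1] Nn Nn) (Bn [M0,M2,M2,M2,M2,M2,M1,M3,M1,M2] (Bn [M0,M2,M2,M2,M2,M2,M1,M3,M1,M1,M1] Nn Nn) (Bn [M0,M1] (Bn
[M2,M2,M2,M2,M2,M2,M1,M3,M1,M2] (Bn [M2,M2,M2,M2,M2,M2,M1,M3,M1,M1,M1] Nn Nn) (Bn [M0,M1,M2,M2] (Bn [M0,M1,M2,M1,M1] Nn Nn) Nn)) Nn))) Nn) Nn))) (Bn
[M2,M2,M1] (Wn [M2,M2,M1,M3,M2,M0] (Bn [M0,M2,M2,M1,M3,M2] (Bn [M2,M1] (Bn [M2,M1,M2,M2] (Bn [M2,M1,M2,M1,M1] Nn Nn) (Bn
[M0,M2,M2,M2,M2,M2,M1,M3,M1,M2] (Bn [M0,M2,M2,M2,M2,M2,M1,M3,M1,M1,M1] Nn Nn) (Bn [M0,M1] (Bn [M2,M2,M2,M2,M2,M2,M1,M3,M1,M2] Nn (Bn [M0,M1,M2,M2] Nn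
Nn)) Nn))) (Bn [M2,M1] (Bn [M2,M1,M2,M2] (Bn [M2,M1,M2,M1,M1] Nn Nn) (Bn [M0,M2,M2,M2,M2,M2,M1,M3,M1,M2] (Bn [M0,M2,M2,M2,M2,M2,M1,M3,M1,M1,M1] Nn Nn)
(Bn [M0,M1] (Bn [M2,M2,M2,M2,M2,M2,M1,M3,M1,M2] (Bn [M2,M2,M2,M2,M2,M2,M1,M3,M1,M1,M1] Nn Nn) (Bn [M0,M1,M2,M2] (Bn [M0,M1,M2,M1,M1] Nn Nn) Nn)) Nn)))
Nn)) (Bn [M0,M2,M2,M1,M3,M2] (Bn [M2,M1] (Bn [M2,M1,M2,M2] (Bn [M2,M1,M2,M1,M1] Nn Nn) (Bn [M0,M2,M2,M2,M2,M2,M1,M3,M1,M2] (Bn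
[M0,M2,M2,M2,M2,M2,M1,M3,M1,M1,M1] Nn Nn) (Bn [M0,M1] (Bn [M2,M2,M2,M2,M2,M2,M1,M3,M1,M2] (Bn [M2,M2,M2,M2,M2,M2,M1,M3,M1,M1,M1] Nn Nn) (Bn
[M0,M1,M2,M2] (Bn [M0,M1,M2,M1,M1] Nn Nn) Nn)) Nn))) Nn) Nn))) (Bn [M2,M2,M1] (Wn [M2,M2,M1,M3,M2,M0] (Bn [M0,M2,M2,M1,M3,M2] (Bn [M2,M1] (Bn
[M2,M1,M2,M2] (Bn [M2,M1,M2,M1,M1] Nn Nn) (Bn [M0,M2,M2,M2,M2,M2,M1,M3,M1,M2] (Bn [M0,M2,M2,M2,M2,M2,M1,M3,M1,M1,M1] Nn Nn) (Bn [M0,M1] (Bn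
[M2,M2,M2,M2,M2,M2,M1,M3,M1,M2] (Bn [M2,M2,M2,M2,M2,M2,M1,M3,M1,M1,M1] Nn Nn) (Bn [M0,M1,M2,M2] (Bn [M0,M1,M2,M1,M1] Nn Nn) Nn)) Nn))) (Bn [M2,M1] (Bn
[M2,M1,M2,M2] (Bn [M2,M1,M2,M1,M1] Nn Nn) (Bn [M0,M2,M2,M2,M2,M2,M1,M3,M1,M2] (Bn [M0,M2,M2,M2,M2,M2,M1,M3,M1,M1,M1] Nn Nn) (Bn [M0,M1] (Bn
[M2,M2,M2,M2,M2,M2,M1,M3,M1,M2] (Bn [M2,M2,M2,M2,M2,M2,M1,M3,M1,M1,M1] Nn Nn) (Bn [M0,M1,M2,M2] (Bn [M0,M1,M2,M1,M1] Nn Nn) Nn)) Nn))) Nn)) (Bn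
[M0,M2,M2,M1,M3,M2] (Bn [M2,M1] (Bn [M2,M1,M2,M2] (Bn [M2,M1,M2,M1,M1] Nn Nn) (Bn [M0,M2,M2,M2,M2,M2,M1,M3,M1,M2] (Bn
[M0,M2,M2,M2,M2,M2,M1,M3,M1,M1,M1] Nn Nn) (Bn [M0,M1] (Bn [M2,M2,M2,M2,M2,M2,M1,M3,M1,M2] (Bn [M2,M2,M2,M2,M2,M2,M1,M3,M1,M1,M1] Nn Nn) (Bn
[M0,M1,M2,M2] (Bn [M0,M1,M2,M1,M1] Nn Nn) Nn)) Nn))) (Bn [M2,M1] (Bn [M2,M1,M2,M2] (Bn [M2,M1,M2,M1,M1] Nn Nn) (Bn [M0,M2,M2,M2,M2,M2,M1,M3,M1,M2] (Bn
[M0,M2,M2,M2,M2,M2,M1,M3,M1,M1,M1] Nn Nn) (Bn [M0,M1] (Bn [M2,M2,M2,M2,M2,M2,M1,M3,M1,M2] (Bn [M2,M2,M2,M2,M2,M2,M1,M3,M1,M1,M1] Nn Nn) (Bn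
[M0,M1,M2,M2] (Bn [M0,M1,M2,M1,M1] Nn Nn) Nn)) Nn))) Nn)) Nn))) Nn))) (Bn [M3,M1] (Bn [M2,M2,M1] (Wn [M2,M2,M1,M3,M2,M0] (Bn [M0,M2,M2,M1,M3,M2] (Bn
[M2,M1] (Bn [M2,M1,M2,M2] (Bn [M2,M1,M2,M1,M1] Nn Nn) (Bn [M0,M2,M2,M2,M2,M2,M1,M3,M1,M2] (Bn [M0,M2,M2,M2,M2,M2,M1,M3,M1,M1,M1] Nn Nn) (Bn [M0,M1]
(Bn [M2,M2,M2,M2,M2,M2,M1,M3,M1,M2] Nn (Bn [M0,M1,M2,M2] Nn Nn)) Nn))) (Bn [M2,M1] (Bn [M2,M1,M2,M2] (Bn [M2,M1,M2,M1,M1] Nn Nn) (Bn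
[M0,M2,M2,M2,M2,M2,M1,M3,M1,M2] (Bn [M0,M2,M2,M2,M2,M2,M1,M3,M1,M1,M1] Nn Nn) (Bn [M0,M1] (Bn [M2,M2,M2,M2,M2,M2,M1,M3,M1,M2] (Bn
[M2,M2,M2,M2,M2,M2,M1,M3,M1,M1,M1] Nn Nn) (Bn [M0,M1,M2,M2] (Bn [M0,M1,M2,M1,M1] Nn Nn) Nn)) Nn))) Nn)) (Bn [M0,M2,M2,M1,M3,M2] (Bn [M2,M1] (Bn
[M2,M1,M2,M2] (Bn [M2,M1,M2,M1,M1] Nn Nn) (Bn [M0,M2,M2,M2,M2,M2,M1,M3,M1,M2] (Bn [M0,M2,M2,M2,M2,M2,M1,M3,M1,M1,M1] Nn Nn) (Bn [M0,M1] (Bn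
[M2,M2,M2,M2,M2,M2,M1,M3,M1,M2] (Bn [M2,M2,M2,M2,M2,M2,M1,M3,M1,M1,M1] Nn Nn) (Bn [M0,M1,M2,M2] (Bn [M0,M1,M2,M1,M1] Nn Nn) Nn)) Nn))) Nn) Nn))) (Bn
[M2,M2,M1] (Wn [M2,M2,M1,M3,M2,M0] (Bn [M0,M2,M2,M1,M3,M2] (Bn [M2,M1] (Bn [M2,M1,M2,M2] (Bn [M2,M1,M2,M1,M1] Nn Nn) (Bn
[M0,M2,M2,M2,M2,M2,M1,M3,M1,M2] (Bn [M0,M2,M2,M2,M2,M2,M1,M3,M1,M1,M1] Nn Nn) (Bn [M0,M1] (Bn [M2,M2,M2,M2,M2,M2,M1,M3,M1,M2] Nn (Bn [M0,M1,M2,M2] Nn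
Nn)) Nn))) (Bn [M2,M1] (Bn [M2,M1,M2,M2] (Bn [M2,M1,M2,M1,M1] Nn Nn) (Bn [M0,M2,M2,M2,M2,M2,M1,M3,M1,M2] (Bn [M0,M2,M2,M2,M2,M2,M1,M3,M1,M1,M1] Nn Nn)
(Bn [M0,M1] (Bn [M2,M2,M2,M2,M2,M2,M1,M3,M1,M2] (Bn [M2,M2,M2,M2,M2,M2,M1,M3,M1,M1,M1] Nn Nn) (Bn [M0,M1,M2,M2] (Bn [M0,M1,M2,M1,M1] Nn Nn) Nn)) Nn)))
Nn)) (Bn [M0,M2,M2,M1,M3,M2] (Bn [M2,M1] (Bn [M2,M1,M2,M2] (Bn [M2,M1,M2,M1,M1] Nn Nn) (Bn [M0,M2,M2,M2,M2,M2,M1,M3,M1,M2] (Bn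
[M0,M2,M2,M2,M2,M2,M1,M3,M1,M1,M1] Nn Nn) (Bn [M0,M1] (Bn [M2,M2,M2,M2,M2,M2,M1,M3,M1,M2] (Bn [M2,M2,M2,M2,M2,M2,M1,M3,M1,M1,M1] Nn Nn) (Bn
[M0,M1,M2,M2] (Bn [M0,M1,M2,M1,M1] Nn Nn) Nn)) Nn))) Nn) Nn))) (Bn [M2,M2,M1] (Wn [M2,M2,M1,M3,M2,M0] (Bn [M0,M2,M2,M1,M3,M2] (Bn [M2,M1] (Bn
[M2,M1,M2,M2] (Bn [M2,M1,M2,M1,M1] Nn Nn) (Bn [M0,M2,M2,M2,M2,M2,M1,M3,M1,M2] (Bn [M0,M2,M2,M2,M2,M2,M1,M3,M1,M1,M1] Nn Nn) (Bn [M0,M1] (Bn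
[M2,M2,M2,M2,M2,M2,M1,M3,M1,M2] (Bn [M2,M2,M2,M2,M2,M2,M1,M3,M1,M1,M1] Nn Nn) (Bn [M0,M1,M2,M2] (Bn [M0,M1,M2,M1,M1] Nn Nn) Nn)) Nn))) (Bn [M2,M1] (Bn
[M2,M1,M2,M2] (Bn [M2,M1,M2,M1,M1] Nn Nn) (Bn [M0,M2,M2,M2,M2,M2,M1,M3,M1,M2] (Bn [M0,M2,M2,M2,M2,M2,M1,M3,M1,M1,M1] Nn Nn) (Bn [M0,M1] (Bn
[M2,M2,M2,M2,M2,M2,M1,M3,M1,M2] (Bn [M2,M2,M2,M2,M2,M2,M1,M3,M1,M1,M1] Nn Nn) (Bn [M0,M1,M2,M2] (Bn [M0,M1,M2,M1,M1] Nn Nn) Nn)) Nn))) Nn)) (Bn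
[M0,M2,M2,M1,M3,M2] (Bn [M2,M1] (Bn [M2,M1,M2,M2] (Bn [M2,M1,M2,M1,M1] Nn Nn) (Bn [M0,M2,M2,M2,M2,M2,M1,M3,M1,M2] (Bn
[M0,M2,M2,M2,M2,M2,M1,M3,M1,M1,M1] Nn Nn) (Bn [M0,M1] (Bn [M2,M2,M2,M2,M2,M2,M1,M3,M1,M2] (Bn [M2,M2,M2,M2,M2,M2,M1,M3,M1,M1,M1] Nn Nn) (Bn
[M0,M1,M2,M2] (Bn [M0,M1,M2,M1,M1] Nn Nn) Nn)) Nn))) (Bn [M2,M1] (Bn [M2,M1,M2,M2] (Bn [M2,M1,M2,M1,M1] Nn Nn) (Bn [M0,M2,M2,M2,M2,M2,M1,M3,M1,M2] (Bn
[M0,M2,M2,M2,M2,M2,M1,M3,M1,M1,M1] Nn Nn) (Bn [M0,M1] (Bn [M2,M2,M2,M2,M2,M2,M1,M3,M1,M2] (Bn [M2,M2,M2,M2,M2,M2,M1,M3,M1,M1,M1] Nn Nn) (Bn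
[M0,M1,M2,M2] (Bn [M0,M1,M2,M1,M1] Nn Nn) Nn)) Nn))) Nn)) Nn))) Nn))) (Bn [M3,M1] (Bn [M2,M2,M1] (Wn [M2,M2,M1,M3,M2,M0] (Bn [M0,M2,M2,M1,M3,M2] (Bn
[M2,M1] (Bn [M2,M1,M2,M2] (Bn [M2,M1,M2,M1,M1] Nn Nn) (Bn [M0,M2,M2,M2,M2,M2,M1,M3,M1,M2] (Bn [M0,M2,M2,M2,M2,M2,M1,M3,M1,M1,M1] Nn Nn) (Bn [M0,M1]
(Bn [M2,M2,M2,M2,M2,M2,M1,M3,M1,M2] (Bn [M2,M2,M2,M2,M2,M2,M1,M3,M1,M1,M1] Nn Nn) (Bn [M0,M1,M2,M2] (Bn [M0,M1,M2,M1,M1] Nn Nn) Nn)) Nn))) (Bn [M2,M1]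
(Bn [M2,M1,M2,M2] (Bn [M2,M1,M2,M1,M1] Nn Nn) (Bn [M0,M2,M2,M2,M2,M2,M1,M3,M1,M2] (Bn [M0,M2,M2,M2,M2,M2,M1,M3,M1,M1,M1] Nn Nn) (Bn [M0,M1] (Bn
[M2,M2,M2,M2,M2,M2,M1,M3,M1,M2] (Bn [M2,M2,M2,M2,M2,M2,M1,M3,M1,M1,M1] Nn Nn) (Bn [M0,M1,M2,M2] (Bn [M0,M1,M2,M1,M1] Nn Nn) Nn)) Nn))) Nn)) (Bn
[M0,M2,M2,M1,M3,M2] (Bn [M2,M1] (Bn [M2,M1,M2,M2] (Bn [M2,M1,M2,M1,M1] Nn Nn) (Bn [M0,M2,M2,M2,M2,M2,M1,M3,M1,M2] (Bn
[M0,M2,M2,M2,M2,M2,M1,M3,M1,M1,M1] Nn Nn) (Bn [M0,M1] (Bn [M2,M2,M2,M2,M2,M2,M1,M3,M1,M2] (Bn [M2,M2,M2,M2,M2,M2,M1,M3,M1,M1,M1] Nn Nn) (Bn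
[M0,M1,M2,M2] (Bn [M0,M1,M2,M1,M1] Nn Nn) Nn)) Nn))) (Bn [M2,M1] (Bn [M2,M1,M2,M2] (Bn [M2,M1,M2,M1,M1] Nn Nn) (Bn [M0,M2,M2,M2,M2,M2,M1,M3,M1,M2] (Bn
[M0,M2,M2,M2,M2,M2,M1,M3,M1,M1,M1] Nn Nn) (Bn [M0,M1] (Bn [M2,M2,M2,M2,M2,M2,M1,M3,M1,M2] (Bn [M2,M2,M2,M2,M2,M2,M1,M3,M1,M1,M1] Nn Nn) (Bn
[M0,M1,M2,M2] (Bn [M0,M1,M2,M1,M1] Nn Nn) Nn)) Nn))) Nn)) Nn))) (Bn [M2,M2,M1] (Wn [M2,M2,M1,M3,M2,M0] (Bn [M0,M2,M2,M1,M3,M2] (Bn [M2,M1] (Bn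
[M2,M1,M2,M2] (Bn [M2,M1,M2,M1,M1] Nn Nn) (Bn [M0,M2,M2,M2,M2,M2,M1,M3,M1,M2] (Bn [M0,M2,M2,M2,M2,M2,M1,M3,M1,M1,M1] Nn Nn) (Bn [M0,M1] (Bn
[M2,M2,M2,M2,M2,M2,M1,M3,M1,M2] (Bn [M2,M2,M2,M2,M2,M2,M1,M3,M1,M1,M1] Nn Nn) (Bn [M0,M1,M2,M2] (Bn [M0,M1,M2,M1,M1] Nn Nn) Nn)) Nn))) (Bn [M2,M1] (Bn
[M2,M1,M2,M2] (Bn [M2,M1,M2,M1,M1] Nn Nn) (Bn [M0,M2,M2,M2,M2,M2,M1,M3,M1,M2] (Bn [M0,M2,M2,M2,M2,M2,M1,M3,M1,M1,M1] Nn Nn) (Bn [M0,M1] (Bn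
[M2,M2,M2,M2,M2,M2,M1,M3,M1,M2] (Bn [M2,M2,M2,M2,M2,M2,M1,M3,M1,M1,M1] Nn Nn) (Bn [M0,M1,M2,M2] (Bn [M0,M1,M2,M1,M1] Nn Nn) Nn)) Nn))) Nn)) (Bn
[M0,M2,M2,M1,M3,M2] (Bn [M2,M1] (Bn [M2,M1,M2,M2] (Bn [M2,M1,M2,M1,M1] Nn Nn) (Bn [M0,M2,M2,M2,M2,M2,M1,M3,M1,M2] (Bn
[M0,M2,M2,M2,M2,M2,M1,M3,M1,M1,M1] Nn Nn) (Bn [M0,M1] (Bn [M2,M2,M2,M2,M2,M2,M1,M3,M1,M2] (Bn [M2,M2,M2,M2,M2,M2,M1,M3,M1,M1,M1] Nn Nn) (Bn
[M0,M1,M2,M2] (Bn [M0,M1,M2,M1,M1] Nn Nn) Nn)) Nn))) (Bn [M2,M1] (Bn [M2,M1,M2,M2] (Bn [M2,M1,M2,M1,M1] Nn Nn) (Bn [M0,M2,M2,M2,M2,M2,M1,M3,M1,M2] (Bn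
[M0,M2,M2,M2,M2,M2,M1,M3,M1,M1,M1] Nn Nn) (Bn [M0,M1] (Bn [M2,M2,M2,M2,M2,M2,M1,M3,M1,M2] (Bn [M2,M2,M2,M2,M2,M2,M1,M3,M1,M1,M1] Nn Nn) (Bn
[M0,M1,M2,M2] (Bn [M0,M1,M2,M1,M1] Nn Nn) Nn)) Nn))) Nn)) Nn))) Nn)) Nn)))) Nn)) Nn))) Nn) Nn)) Nn)"

definition cert2 :: forest where
  "cert2 = (Bn [M1] (Bn [M1,M2] (Bn [M2,M1] (Bn [M0,M1] (Wn [M0,M1,M0] (Wn [M0,M1,M0] Nn)) (Wn [M1] (Wn [M1] Nn))) Nn) (Bn [M0,M2,M2,M2,M1,M3,M2] (Bn [M0,M1] (Wn
[M2,M2,M2] (Bn [M3] (Bn [M0,M2,M2,M1] (Bn [M0,M2,M1] (Wn [M0,M2,M2,M2,M2] Nn) (Wn [M0,M2,M2,M1,M3,M3] Nn)) (Bn [M0,M2,M1] (Bn [M0,M2,M2,M1] (Wn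
[M0,M3,M0] (Wn [M0,M2] Nn)) (Bn [M2,M1] (Bn [M0,M3,M1] (Bn [M2,M2,M1,M3,M2] (Bn [M0,M1,M1] (Bn [M0,M2,M2,M2,M2,M2,M1,M2,M2] (Bn
[M0,M2,M2,M2,M2,M2,M1,M2,M1,M1] Nn Nn) (Bn [M0,M2,M2,M2,M2,M2,M1,M2,M2] (Bn [M0,M2,M2,M2,M2,M2,M1,M2,M1,M1] Nn Nn) Nn)) (Bn [M0,M1,M1] (Bn
[M0,M2,M2,M2,M2,M2,M1,M2,M2] (Bn [M0,M2,M2,M2,M2,M2,M1,M2,M1,M1] Nn Nn) (Bn [M0,M2,M2,M2,M2,M2,M1,M2,M2] (Bn [M0,M2,M2,M2,M2,M2,M1,M2,M1,M1] Nn Nn)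
Nn)) Nn)) (Bn [M0,M1,M1] (Bn [M0,M2,M2,M2,M2,M2,M1,M2,M2] (Bn [M2,M2,M1,M3,M2] (Bn [M0,M2,M2,M2,M2,M2,M1,M2,M1,M1] Nn Nn) (Bn [M2,M2,M1,M3,M2] (Bn
[M0,M2,M2,M2,M2,M2,M1,M2,M1,M1] Nn Nn) Nn)) (Bn [M0,M2,M2,M2,M2,M2,M1,M2,M2] (Bn [M2,M2,M1,M3,M2] (Bn [M0,M2,M2,M2,M2,M2,M1,M2,M1,M1] Nn Nn) (Bn
[M2,M2,M1,M3,M2] (Bn [M0,M2,M2,M2,M2,M2,M1,M2,M1,M1] Nn Nn) Nn)) (Bn [M0,M2,M2,M2,M2,M2,M1,M2,M2] (Bn [M2,M2,M1,M3,M2] (Bn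
[M0,M2,M2,M2,M2,M2,M1,M2,M1,M1] Nn Nn) (Bn [M2,M2,M1,M3,M2] (Bn [M0,M2,M2,M2,M2,M2,M1,M2,M1,M1] Nn Nn) Nn)) Nn))) (Bn [M2,M2,M1,M3,M2] (Bn [M0,M1,M1]
(Bn [M0,M2,M2,M2,M2,M2,M1,M2,M2] (Bn [M0,M2,M2,M2,M2,M2,M1,M2,M1,M1] Nn Nn) (Bn [M0,M2,M2,M2,M2,M2,M1,M2,M2] (Bn [M0,M2,M2,M2,M2,M2,M1,M2,M1,M1] Nn
Nn) Nn)) (Bn [M0,M1,M1] (Bn [M0,M2,M2,M2,M2,M2,M1,M2,M2] (Bn [M0,M2,M2,M2,M2,M2,M1,M2,M1,M1] Nn Nn) (Bn [M0,M2,M2,M2,M2,M2,M1,M2,M2] (Bn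
[M0,M2,M2,M2,M2,M2,M1,M2,M1,M1] Nn Nn) Nn)) Nn)) Nn))) (Bn [M0,M3,M1] (Bn [M2,M2,M1,M3,M2] (Bn [M0,M1,M1] (Bn [M2,M1,M3,M1,M2] (Bn [M2,M1,M3,M1,M1,M1]
Nn Nn) (Bn [M2,M1,M3,M1,M2] (Bn [M2,M1,M3,M1,M1,M1] Nn Nn) Nn)) (Bn [M0,M1,M1] (Bn [M2,M1,M3,M1,M2] (Bn [M2,M1,M3,M1,M1,M1] Nn Nn) (Bn
[M2,M1,M3,M1,M2] (Bn [M2,M1,M3,M1,M1,M1] Nn Nn) Nn)) Nn)) (Bn [M0,M1,M1] (Bn [M2,M1,M3,M1,M2] (Bn [M2,M2,M1,M3,M2] (Bn [M2,M1,M3,M1,M1,M1] Nn Nn) (Bn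
[M2,M2,M1,M3,M2] (Bn [M2,M1,M3,M1,M1,M1] Nn Nn) Nn)) (Bn [M2,M1,M3,M1,M2] (Bn [M2,M2,M1,M3,M2] (Bn [M2,M1,M3,M1,M1,M1] Nn Nn) (Bn [M2,M2,M1,M3,M2] (Bn
[M2,M1,M3,M1,M1,M1] Nn Nn) Nn)) (Bn [M2,M1,M3,M1,M2] (Bn [M2,M2,M1,M3,M2] (Bn [M2,M1,M3,M1,M1,M1] Nn Nn) (Bn [M2,M2,M1,M3,M2] (Bn [M2,M1,M3,M1,M1,M1]
Nn Nn) Nn)) Nn))) (Bn [M2,M2,M1,M3,M2] (Bn [M0,M1,M1] (Bn [M2,M1,M3,M1,M2] (Bn [M2,M1,M3,M1,M1,M1] Nn Nn) (Bn [M2,M1,M3,M1,M2] (Bn [M2,M1,M3,M1,M1,M1]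
Nn Nn) Nn)) (Bn [M0,M1,M1] (Bn [M2,M1,M3,M1,M2] (Bn [M2,M1,M3,M1,M1,M1] Nn Nn) (Bn [M2,M1,M3,M1,M2] (Bn [M2,M1,M3,M1,M1,M1] Nn Nn) Nn)) Nn)) Nn))) (Bn
[M0,M2,M2,M1] (Bn [M0,M3,M1] (Bn [M2,M2,M1,M3,M2] (Bn [M2,M2,M2,M2,M1,M2,M2] (Bn [M2,M2,M2,M2,M1,M2,M1,M2,M1] Nn Nn) (Bn [M0,M1,M1] (Bn
[M2,M2,M2,M2,M1,M2,M2] (Bn [M2,M2,M2,M2,M1,M2,M1,M1] Nn Nn) (Bn [M2,M2,M2,M2,M1,M2,M2] (Bn [M2,M2,M2,M2,M1,M2,M1,M1] Nn Nn) Nn)) Nn)) (Bn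
[M2,M2,M2,M2,M1,M2,M2] (Bn [M2,M2,M2,M2,M1,M2,M1,M2,M1] (Bn [M0,M1,M1] (Bn [M2,M2,M1,M3,M2] Nn Nn) Nn) (Bn [M2,M2,M2,M2,M1,M2,M1,M2,M1] (Bn [M0,M1,M1]
(Bn [M2,M2,M1,M3,M2] Nn Nn) Nn) Nn)) (Bn [M2,M2,M1,M3,M2] (Bn [M0,M1,M1] (Bn [M2,M2,M2,M2,M1,M2,M2] (Bn [M2,M2,M2,M2,M1,M2,M1,M1] Nn Nn) (Bn
[M2,M2,M2,M2,M1,M2,M2] (Bn [M2,M2,M2,M2,M1,M2,M1,M1] Nn Nn) Nn)) (Bn [M0,M1,M1] (Bn [M2,M2,M2,M2,M1,M2,M2] (Bn [M2,M2,M2,M2,M1,M2,M1,M1] Nn Nn) (Bn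
[M2,M2,M2,M2,M1,M2,M2] (Bn [M2,M2,M2,M2,M1,M2,M1,M1] Nn Nn) Nn)) Nn)) Nn))) (Bn [M0,M3,M1] (Bn [M0,M2,M2,M1,M3,M1,M2] (Bn [M2,M2,M1,M3,M2] (Bn
[M0,M1,M1] (Bn [M0,M2,M2,M1,M3,M1,M1,M1] Nn Nn) Nn) (Bn [M0,M2,M2,M1,M3,M1,M1,M2,M1] (Bn [M0,M1,M1] (Bn [M2,M2,M1,M3,M2] Nn Nn) Nn) Nn)) (Bn
[M0,M2,M2,M1,M3,M1,M2] (Bn [M0,M2,M2,M1,M3,M1,M1,M2,M1] (Bn [M0,M1,M1] (Bn [M2,M2,M1,M3,M2] Nn Nn) Nn) (Bn [M0,M2,M2,M1,M3,M1,M1,M2,M1] (Bn [M0,M1,M1]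
(Bn [M2,M2,M1,M3,M2] Nn Nn) Nn) Nn)) (Bn [M2,M2,M1,M3,M2] (Bn [M0,M1,M1] (Bn [M0,M2,M2,M1,M3,M1,M2] (Bn [M0,M2,M2,M1,M3,M1,M1,M1] Nn Nn) (Bn
[M0,M2,M2,M1,M3,M1,M2] (Bn [M0,M2,M2,M1,M3,M1,M1,M1] Nn Nn) Nn)) (Bn [M0,M1,M1] (Bn [M0,M2,M2,M1,M3,M1,M2] (Bn [M0,M2,M2,M1,M3,M1,M1,M1] Nn Nn) (Bn
[M0,M2,M2,M1,M3,M1,M2] (Bn [M0,M2,M2,M1,M3,M1,M1,M1] Nn Nn) Nn)) Nn)) Nn))) Nn)) Nn))) Nn)) Nn)) (Bn [M0,M1,M1] (Bn [M3] (Bn [M0,M2,M2,M1] (Bn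
[M0,M2,M1] (Wn [M0,M2,M2,M2,M2] (Wn [M0,M2,M2,M2,M2] Nn)) (Wn [M0,M2,M2,M1,M3,M3] (Wn [M0,M2,M2,M1,M3,M3] Nn))) (Bn [M0,M2,M1] (Bn [M0,M2,M2,M1] (Wn
[M0,M3,M0] (Wn [M0,M2] Nn)) (Bn [M2,M2,M1,M3,M2] (Bn [M0,M3,M1] (Bn [M2,M1] (Bn [M0,M2,M2,M2,M2,M2,M1,M2,M2] (Bn [M0,M2,M2,M2,M2,M2,M1,M2,M1,M1] Nn
Nn) (Bn [M2,M1,M3,M1,M2] (Bn [M2,M1,M3,M1,M1,M1] Nn Nn) (Bn [M0,M2,M2,M1] (Bn [M2,M2,M2,M2,M1,M2,M2] Nn (Bn [M0,M2,M2,M1,M3,M1,M2] Nn Nn)) Nn))) (Bn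
[M2,M1] (Bn [M0,M2,M2,M2,M2,M2,M1,M2,M2] (Bn [M0,M2,M2,M2,M2,M2,M1,M2,M1,M1] Nn Nn) (Bn [M2,M1,M3,M1,M2] (Bn [M2,M1,M3,M1,M1,M1] Nn Nn) (Bn
[M0,M2,M2,M1] (Bn [M2,M2,M2,M2,M1,M2,M2] (Bn [M2,M2,M2,M2,M1,M2,M1,M1] Nn Nn) (Bn [M0,M2,M2,M1,M3,M1,M2] (Bn [M0,M2,M2,M1,M3,M1,M1,M1] Nn Nn) Nn))
Nn))) Nn)) (Bn [M0,M3,M1] (Bn [M2,M1] (Bn [M0,M2,M2,M2,M2,M2,M1,M2,M2] (Bn [M0,M2,M2,M2,M2,M2,M1,M2,M1,M1] Nn Nn) (Bn [M2,M1,M3,M1,M2] (Bn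
[M2,M1,M3,M1,M1,M1] Nn Nn) (Bn [M0,M2,M2,M1] (Bn [M2,M2,M2,M2,M1,M2,M2] (Bn [M2,M2,M2,M2,M1,M2,M1,M1] Nn Nn) (Bn [M0,M2,M2,M1,M3,M1,M2] (Bn
[M0,M2,M2,M1,M3,M1,M1,M1] Nn Nn) Nn)) Nn))) (Bn [M2,M1] (Bn [M0,M2,M2,M2,M2,M2,M1,M2,M2] (Bn [M0,M2,M2,M2,M2,M2,M1,M2,M1,M1] Nn Nn) (Bn
[M2,M1,M3,M1,M2] (Bn [M2,M1,M3,M1,M1,M1] Nn Nn) (Bn [M0,M2,M2,M1] (Bn [M2,M2,M2,M2,M1,M2,M2] (Bn [M2,M2,M2,M2,M1,M2,M1,M1] Nn Nn) (Bn
[M0,M2,M2,M1,M3,M1,M2] (Bn [M0,M2,M2,M1,M3,M1,M1,M1] Nn Nn) Nn)) Nn))) Nn)) Nn)) Nn)) (Bn [M0,M3,M1] (Bn [M0,M2,M1] (Wn [M0,M3,M0] (Bn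
[M2,M2,M1,M3,M2] (Bn [M2,M1] (Bn [M0,M2,M2,M2,M2,M2,M1,M2,M2] (Bn [M0,M2,M2,M2,M2,M2,M1,M2,M1,M1] Nn Nn) (Bn [M2,M1,M3,M1,M2] (Bn [M2,M1,M3,M1,M1,M1]
Nn Nn) (Bn [M0,M2,M2,M1] (Bn [M2,M2,M2,M2,M1,M2,M2] Nn (Bn [M0,M2,M2,M1,M3,M1,M2] Nn Nn)) Nn))) (Bn [M2,M1] (Bn [M0,M2,M2,M2,M2,M2,M1,M2,M2] (Bn
[M0,M2,M2,M2,M2,M2,M1,M2,M1,M1] Nn Nn) (Bn [M2,M1,M3,M1,M2] (Bn [M2,M1,M3,M1,M1,M1] Nn Nn) (Bn [M0,M2,M2,M1] (Bn [M2,M2,M2,M2,M1,M2,M2] (Bn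
[M2,M2,M2,M2,M1,M2,M1,M1] Nn Nn) (Bn [M0,M2,M2,M1,M3,M1,M2] (Bn [M0,M2,M2,M1,M3,M1,M1,M1] Nn Nn) Nn)) Nn))) Nn)) (Bn [M2,M2,M1,M3,M2] (Bn [M2,M1] (Bn
[M0,M2,M2,M2,M2,M2,M1,M2,M2] (Bn [M0,M2,M2,M2,M2,M2,M1,M2,M1,M1] Nn Nn) (Bn [M2,M1,M3,M1,M2] (Bn [M2,M1,M3,M1,M1,M1] Nn Nn) (Bn [M0,M2,M2,M1] (Bn
[M2,M2,M2,M2,M1,M2,M2] (Bn [M2,M2,M2,M2,M1,M2,M1,M1] Nn Nn) (Bn [M0,M2,M2,M1,M3,M1,M2] (Bn [M0,M2,M2,M1,M3,M1,M1,M1] Nn Nn) Nn)) Nn))) Nn) Nn))) (Bn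
[M0,M2,M1] (Wn [M0,M3,M0] (Bn [M2,M2,M1,M3,M2] (Bn [M2,M1] (Bn [M0,M2,M2,M2,M2,M2,M1,M2,M2] (Bn [M0,M2,M2,M2,M2,M2,M1,M2,M1,M1] Nn Nn) (Bn
[M2,M1,M3,M1,M2] (Bn [M2,M1,M3,M1,M1,M1] Nn Nn) (Bn [M0,M2,M2,M1] (Bn [M2,M2,M2,M2,M1,M2,M2] (Bn [M2,M2,M2,M2,M1,M2,M1,M1] Nn Nn) (Bn
[M0,M2,M2,M1,M3,M1,M2] (Bn [M0,M2,M2,M1,M3,M1,M1,M1] Nn Nn) Nn)) Nn))) (Bn [M2,M1] (Bn [M0,M2,M2,M2,M2,M2,M1,M2,M2] (Bn
[M0,M2,M2,M2,M2,M2,M1,M2,M1,M1] Nn Nn) (Bn [M2,M1,M3,M1,M2] (Bn [M2,M1,M3,M1,M1,M1] Nn Nn) (Bn [M0,M2,M2,M1] (Bn [M2,M2,M2,M2,M1,M2,M2] (Bn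
[M2,M2,M2,M2,M1,M2,M1,M1] Nn Nn) (Bn [M0,M2,M2,M1,M3,M1,M2] (Bn [M0,M2,M2,M1,M3,M1,M1,M1] Nn Nn) Nn)) Nn))) Nn)) (Bn [M2,M2,M1,M3,M2] (Bn [M2,M1] (Bn
[M0,M2,M2,M2,M2,M2,M1,M2,M2] (Bn [M0,M2,M2,M2,M2,M2,M1,M2,M1,M1] Nn Nn) (Bn [M2,M1,M3,M1,M2] (Bn [M2,M1,M3,M1,M1,M1] Nn Nn) (Bn [M0,M2,M2,M1] (Bn
[M2,M2,M2,M2,M1,M2,M2] (Bn [M2,M2,M2,M2,M1,M2,M1,M1] Nn Nn) (Bn [M0,M2,M2,M1,M3,M1,M2] (Bn [M0,M2,M2,M1,M3,M1,M1,M1] Nn Nn) Nn)) Nn))) (Bn [M2,M1] (Bn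
[M0,M2,M2,M2,M2,M2,M1,M2,M2] (Bn [M0,M2,M2,M2,M2,M2,M1,M2,M1,M1] Nn Nn) (Bn [M2,M1,M3,M1,M2] (Bn [M2,M1,M3,M1,M1,M1] Nn Nn) (Bn [M0,M2,M2,M1] (Bn
[M2,M2,M2,M2,M1,M2,M2] (Bn [M2,M2,M2,M2,M1,M2,M1,M1] Nn Nn) (Bn [M0,M2,M2,M1,M3,M1,M2] (Bn [M0,M2,M2,M1,M3,M1,M1,M1] Nn Nn) Nn)) Nn))) Nn)) Nn))) Nn))
Nn))) (Bn [M3] (Bn [M0,M2,M2,M1] (Bn [M0,M2,M1] (Wn [M0,M2,M2,M2,M2] (Wn [M0,M2,M2,M2,M2] (Wn [M0,M2,M2,M2,M2] Nn))) (Wn [M0,M2,M2,M1,M3,M3] (Wn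
[M0,M2,M2,M1,M3,M3] (Wn [M0,M2,M2,M1,M3,M3] Nn)))) (Bn [M0,M2,M1] (Bn [M0,M2,M2,M1] (Wn [M0,M3,M0] (Wn [M0,M2] (Wn [M0,M2] Nn))) (Bn [M2,M1] (Bn
[M0,M3,M1] (Bn [M0,M2,M2,M2,M2,M2,M1,M2,M2] (Bn [M2,M2,M1,M3,M2] (Bn [M0,M2,M2,M2,M2,M2,M1,M2,M1,M1] Nn Nn) (Bn [M2,M2,M1,M3,M2] (Bn
[M0,M2,M2,M2,M2,M2,M1,M2,M1,M1] Nn Nn) Nn)) (Bn [M0,M2,M2,M2,M2,M2,M1,M2,M2] (Bn [M2,M2,M1,M3,M2] (Bn [M0,M2,M2,M2,M2,M2,M1,M2,M1,M1] Nn Nn) (Bn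
[M2,M2,M1,M3,M2] (Bn [M0,M2,M2,M2,M2,M2,M1,M2,M1,M1] Nn Nn) Nn)) (Bn [M0,M2,M2,M2,M2,M2,M1,M2,M2] (Bn [M2,M2,M1,M3,M2] (Bn
[M0,M2,M2,M2,M2,M2,M1,M2,M1,M1] Nn Nn) (Bn [M2,M2,M1,M3,M2] (Bn [M0,M2,M2,M2,M2,M2,M1,M2,M1,M1] Nn Nn) Nn)) Nn))) (Bn [M0,M3,M1] (Bn [M2,M1,M3,M1,M2]
(Bn [M2,M2,M1,M3,M2] (Bn [M2,M1,M3,M1,M1,M1] Nn Nn) (Bn [M2,M2,M1,M3,M2] (Bn [M2,M1,M3,M1,M1,M1] Nn Nn) Nn)) (Bn [M2,M1,M3,M1,M2] (Bn [M2,M2,M1,M3,M2]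
(Bn [M2,M1,M3,M1,M1,M1] Nn Nn) (Bn [M2,M2,M1,M3,M2] (Bn [M2,M1,M3,M1,M1,M1] Nn Nn) Nn)) (Bn [M2,M1,M3,M1,M2] (Bn [M2,M2,M1,M3,M2] (Bn
[M2,M1,M3,M1,M1,M1] Nn Nn) (Bn [M2,M2,M1,M3,M2] (Bn [M2,M1,M3,M1,M1,M1] Nn Nn) Nn)) Nn))) (Bn [M0,M2,M2,M1] (Bn [M2,M2,M2,M2,M1,M2,M2] (Bn
[M2,M2,M2,M2,M1,M2,M1,M2,M1] (Bn [M0,M3,M1] (Bn [M2,M2,M1,M3,M2] Nn Nn) Nn) (Bn [M2,M2,M2,M2,M1,M2,M1,M2,M1] (Bn [M0,M3,M1] (Bn [M2,M2,M1,M3,M2] Nn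
Nn) Nn) Nn)) (Bn [M0,M2,M2,M1,M3,M1,M2] (Bn [M0,M2,M2,M1,M3,M1,M1,M2,M1] (Bn [M0,M3,M1] (Bn [M2,M2,M1,M3,M2] Nn Nn) Nn) (Bn
[M0,M2,M2,M1,M3,M1,M1,M2,M1] (Bn [M0,M3,M1] (Bn [M2,M2,M1,M3,M2] Nn Nn) Nn) Nn)) Nn)) Nn))) (Bn [M2,M2,M1,M3,M2] (Bn [M0,M3,M1] (Bn [M2,M1] (Bn
[M0,M2,M2,M2,M2,M2,M1,M2,M2] (Bn [M0,M2,M2,M2,M2,M2,M1,M2,M1,M1] Nn Nn) (Bn [M2,M1,M3,M1,M2] (Bn [M2,M1,M3,M1,M1,M1] Nn Nn) (Bn [M0,M2,M2,M1] (Bn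
[M2,M2,M2,M2,M1,M2,M2] (Bn [M2,M2,M2,M2,M1,M2,M1,M1] Nn Nn) (Bn [M0,M2,M2,M1,M3,M1,M2] (Bn [M0,M2,M2,M1,M3,M1,M1,M1] Nn Nn) Nn)) Nn))) (Bn [M2,M1] (Bn
[M0,M2,M2,M2,M2,M2,M1,M2,M2] (Bn [M0,M2,M2,M2,M2,M2,M1,M2,M1,M1] Nn Nn) (Bn [M2,M1,M3,M1,M2] (Bn [M2,M1,M3,M1,M1,M1] Nn Nn) (Bn [M0,M2,M2,M1] (Bn
[M2,M2,M2,M2,M1,M2,M2] (Bn [M2,M2,M2,M2,M1,M2,M1,M1] Nn Nn) (Bn [M0,M2,M2,M1,M3,M1,M2] (Bn [M0,M2,M2,M1,M3,M1,M1,M1] Nn Nn) Nn)) Nn))) Nn)) (Bn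
[M0,M3,M1] (Bn [M2,M1] (Bn [M0,M2,M2,M2,M2,M2,M1,M2,M2] (Bn [M0,M2,M2,M2,M2,M2,M1,M2,M1,M1] Nn Nn) (Bn [M2,M1,M3,M1,M2] (Bn [M2,M1,M3,M1,M1,M1] Nn Nn)
(Bn [M0,M2,M2,M1] (Bn [M2,M2,M2,M2,M1,M2,M2] (Bn [M2,M2,M2,M2,M1,M2,M1,M1] Nn Nn) (Bn [M0,M2,M2,M1,M3,M1,M2] (Bn [M0,M2,M2,M1,M3,M1,M1,M1] Nn Nn) Nn))
Nn))) (Bn [M2,M1] (Bn [M0,M2,M2,M2,M2,M2,M1,M2,M2] (Bn [M0,M2,M2,M2,M2,M2,M1,M2,M1,M1] Nn Nn) (Bn [M2,M1,M3,M1,M2] (Bn [M2,M1,M3,M1,M1,M1] Nn Nn) (Bn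
[M0,M2,M2,M1] (Bn [M2,M2,M2,M2,M1,M2,M2] (Bn [M2,M2,M2,M2,M1,M2,M1,M1] Nn Nn) (Bn [M0,M2,M2,M1,M3,M1,M2] (Bn [M0,M2,M2,M1,M3,M1,M1,M1] Nn Nn) Nn))
Nn))) Nn)) Nn)) Nn))) (Bn [M0,M2,M1] (Bn [M0,M2,M2,M1] (Wn [M0,M3,M0] (Wn [M0,M2] (Wn [M0,M2] Nn))) (Bn [M2,M1] (Bn [M0,M3,M1] (Bn
[M0,M2,M2,M2,M2,M2,M1,M2,M2] (Bn [M2,M2,M1,M3,M2] (Bn [M0,M2,M2,M2,M2,M2,M1,M2,M1,M1] Nn Nn) (Bn [M2,M2,M1,M3,M2] (Bn [M0,M2,M2,M2,M2,M2,M1,M2,M1,M1]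
Nn Nn) Nn)) (Bn [M0,M2,M2,M2,M2,M2,M1,M2,M2] (Bn [M2,M2,M1,M3,M2] (Bn [M0,M2,M2,M2,M2,M2,M1,M2,M1,M1] Nn Nn) (Bn [M2,M2,M1,M3,M2] (Bn
[M0,M2,M2,M2,M2,M2,M1,M2,M1,M1] Nn Nn) Nn)) (Bn [M0,M2,M2,M2,M2,M2,M1,M2,M2] (Bn [M2,M2,M1,M3,M2] (Bn [M0,M2,M2,M2,M2,M2,M1,M2,M1,M1] Nn Nn) (Bn
[M2,M2,M1,M3,M2] (Bn [M0,M2,M2,M2,M2,M2,M1,M2,M1,M1] Nn Nn) Nn)) Nn))) (Bn [M0,M3,M1] (Bn [M2,M1,M3,M1,M2] (Bn [M2,M2,M1,M3,M2] (Bn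
[M2,M1,M3,M1,M1,M1] Nn Nn) (Bn [M2,M2,M1,M3,M2] (Bn [M2,M1,M3,M1,M1,M1] Nn Nn) Nn)) (Bn [M2,M1,M3,M1,M2] (Bn [M2,M2,M1,M3,M2] (Bn [M2,M1,M3,M1,M1,M1]
Nn Nn) (Bn [M2,M2,M1,M3,M2] (Bn [M2,M1,M3,M1,M1,M1] Nn Nn) Nn)) (Bn [M2,M1,M3,M1,M2] (Bn [M2,M2,M1,M3,M2] (Bn [M2,M1,M3,M1,M1,M1] Nn Nn) (Bn
[M2,M2,M1,M3,M2] (Bn [M2,M1,M3,M1,M1,M1] Nn Nn) Nn)) Nn))) (Bn [M0,M2,M2,M1] (Bn [M2,M2,M2,M2,M1,M2,M2] (Bn [M2,M2,M2,M2,M1,M2,M1,M2,M1] (Bn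
[M0,M3,M1] (Bn [M2,M2,M1,M3,M2] Nn Nn) Nn) (Bn [M2,M2,M2,M2,M1,M2,M1,M2,M1] (Bn [M0,M3,M1] (Bn [M2,M2,M1,M3,M2] Nn Nn) Nn) Nn)) (Bn
[M0,M2,M2,M1,M3,M1,M2] (Bn [M0,M2,M2,M1,M3,M1,M1,M2,M1] (Bn [M0,M3,M1] (Bn [M2,M2,M1,M3,M2] Nn Nn) Nn) (Bn [M0,M2,M2,M1,M3,M1,M1,M2,M1] (Bn [M0,M3,M1]
(Bn [M2,M2,M1,M3,M2] Nn Nn) Nn) Nn)) Nn)) Nn))) (Bn [M2,M2,M1,M3,M2] (Bn [M0,M3,M1] (Bn [M2,M1] (Bn [M0,M2,M2,M2,M2,M2,M1,M2,M2] (Bn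
[M0,M2,M2,M2,M2,M2,M1,M2,M1,M1] Nn Nn) (Bn [M2,M1,M3,M1,M2] (Bn [M2,M1,M3,M1,M1,M1] Nn Nn) (Bn [M0,M2,M2,M1] (Bn [M2,M2,M2,M2,M1,M2,M2] (Bn
[M2,M2,M2,M2,M1,M2,M1,M1] Nn Nn) (Bn [M0,M2,M2,M1,M3,M1,M2] (Bn [M0,M2,M2,M1,M3,M1,M1,M1] Nn Nn) Nn)) Nn))) (Bn [M2,M1] (Bn
[M0,M2,M2,M2,M2,M2,M1,M2,M2] (Bn [M0,M2,M2,M2,M2,M2,M1,M2,M1,M1] Nn Nn) (Bn [M2,M1,M3,M1,M2] (Bn [M2,M1,M3,M1,M1,M1] Nn Nn) (Bn [M0,M2,M2,M1] (Bn
[M2,M2,M2,M2,M1,M2,M2] (Bn [M2,M2,M2,M2,M1,M2,M1,M1] Nn Nn) (Bn [M0,M2,M2,M1,M3,M1,M2] (Bn [M0,M2,M2,M1,M3,M1,M1,M1] Nn Nn) Nn)) Nn))) Nn)) (Bn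
[M0,M3,M1] (Bn [M2,M1] (Bn [M0,M2,M2,M2,M2,M2,M1,M2,M2] (Bn [M0,M2,M2,M2,M2,M2,M1,M2,M1,M1] Nn Nn) (Bn [M2,M1,M3,M1,M2] (Bn [M2,M1,M3,M1,M1,M1] Nn Nn)
(Bn [M0,M2,M2,M1] (Bn [M2,M2,M2,M2,M1,M2,M2] (Bn [M2,M2,M2,M2,M1,M2,M1,M1] Nn Nn) (Bn [M0,M2,M2,M1,M3,M1,M2] (Bn [M0,M2,M2,M1,M3,M1,M1,M1] Nn Nn) Nn))
Nn))) (Bn [M2,M1] (Bn [M0,M2,M2,M2,M2,M2,M1,M2,M2] (Bn [M0,M2,M2,M2,M2,M2,M1,M2,M1,M1] Nn Nn) (Bn [M2,M1,M3,M1,M2] (Bn [M2,M1,M3,M1,M1,M1] Nn Nn) (Bn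
[M0,M2,M2,M1] (Bn [M2,M2,M2,M2,M1,M2,M2] (Bn [M2,M2,M2,M2,M1,M2,M1,M1] Nn Nn) (Bn [M0,M2,M2,M1,M3,M1,M2] (Bn [M0,M2,M2,M1,M3,M1,M1,M1] Nn Nn) Nn))
Nn))) Nn)) Nn)) Nn))) (Bn [M0,M3,M1] (Bn [M0,M2,M1] (Wn [M0,M3,M0] (Bn [M2,M2,M1,M3,M2] (Bn [M2,M1] (Bn [M0,M2,M2,M2,M2,M2,M1,M2,M2] (Bn
[M0,M2,M2,M2,M2,M2,M1,M2,M1,M1] Nn Nn) (Bn [M2,M1,M3,M1,M2] (Bn [M2,M1,M3,M1,M1,M1] Nn Nn) (Bn [M0,M2,M2,M1] (Bn [M2,M2,M2,M2,M1,M2,M2] (Bn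
[M2,M2,M2,M2,M1,M2,M1,M1] Nn Nn) (Bn [M0,M2,M2,M1,M3,M1,M2] (Bn [M0,M2,M2,M1,M3,M1,M1,M1] Nn Nn) Nn)) Nn))) (Bn [M2,M1] (Bn
[M0,M2,M2,M2,M2,M2,M1,M2,M2] (Bn [M0,M2,M2,M2,M2,M2,M1,M2,M1,M1] Nn Nn) (Bn [M2,M1,M3,M1,M2] (Bn [M2,M1,M3,M1,M1,M1] Nn Nn) (Bn [M0,M2,M2,M1] (Bn
[M2,M2,M2,M2,M1,M2,M2] (Bn [M2,M2,M2,M2,M1,M2,M1,M1] Nn Nn) (Bn [M0,M2,M2,M1,M3,M1,M2] (Bn [M0,M2,M2,M1,M3,M1,M1,M1] Nn Nn) Nn)) Nn))) Nn)) (Bn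
[M2,M2,M1,M3,M2] (Bn [M2,M1] (Bn [M0,M2,M2,M2,M2,M2,M1,M2,M2] (Bn [M0,M2,M2,M2,M2,M2,M1,M2,M1,M1] Nn Nn) (Bn [M2,M1,M3,M1,M2] (Bn [M2,M1,M3,M1,M1,M1]
Nn Nn) (Bn [M0,M2,M2,M1] (Bn [M2,M2,M2,M2,M1,M2,M2] (Bn [M2,M2,M2,M2,M1,M2,M1,M1] Nn Nn) (Bn [M0,M2,M2,M1,M3,M1,M2] (Bn [M0,M2,M2,M1,M3,M1,M1,M1] Nn
Nn) Nn)) Nn))) (Bn [M2,M1] (Bn [M0,M2,M2,M2,M2,M2,M1,M2,M2] (Bn [M0,M2,M2,M2,M2,M2,M1,M2,M1,M1] Nn Nn) (Bn [M2,M1,M3,M1,M2] (Bn [M2,M1,M3,M1,M1,M1] Nn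
Nn) (Bn [M0,M2,M2,M1] (Bn [M2,M2,M2,M2,M1,M2,M2] (Bn [M2,M2,M2,M2,M1,M2,M1,M1] Nn Nn) (Bn [M0,M2,M2,M1,M3,M1,M2] (Bn [M0,M2,M2,M1,M3,M1,M1,M1] Nn Nn)
Nn)) Nn))) Nn)) Nn))) (Bn [M0,M2,M1] (Wn [M0,M3,M0] (Bn [M2,M2,M1,M3,M2] (Bn [M2,M1] (Bn [M0,M2,M2,M2,M2,M2,M1,M2,M2] (Bn
[M0,M2,M2,M2,M2,M2,M1,M2,M1,M1] Nn Nn) (Bn [M2,M1,M3,M1,M2] (Bn [M2,M1,M3,M1,M1,M1] Nn Nn) (Bn [M0,M2,M2,M1] (Bn [M2,M2,M2,M2,M1,M2,M2] (Bn
[M2,M2,M2,M2,M1,M2,M1,M1] Nn Nn) (Bn [M0,M2,M2,M1,M3,M1,M2] (Bn [M0,M2,M2,M1,M3,M1,M1,M1] Nn Nn) Nn)) Nn))) (Bn [M2,M1] (Bn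
[M0,M2,M2,M2,M2,M2,M1,M2,M2] (Bn [M0,M2,M2,M2,M2,M2,M1,M2,M1,M1] Nn Nn) (Bn [M2,M1,M3,M1,M2] (Bn [M2,M1,M3,M1,M1,M1] Nn Nn) (Bn [M0,M2,M2,M1] (Bn
[M2,M2,M2,M2,M1,M2,M2] (Bn [M2,M2,M2,M2,M1,M2,M1,M1] Nn Nn) (Bn [M0,M2,M2,M1,M3,M1,M2] (Bn [M0,M2,M2,M1,M3,M1,M1,M1] Nn Nn) Nn)) Nn))) Nn)) (Bn
[M2,M2,M1,M3,M2] (Bn [M2,M1] (Bn [M0,M2,M2,M2,M2,M2,M1,M2,M2] (Bn [M0,M2,M2,M2,M2,M2,M1,M2,M1,M1] Nn Nn) (Bn [M2,M1,M3,M1,M2] (Bn [M2,M1,M3,M1,M1,M1]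
Nn Nn) (Bn [M0,M2,M2,M1] (Bn [M2,M2,M2,M2,M1,M2,M2] (Bn [M2,M2,M2,M2,M1,M2,M1,M1] Nn Nn) (Bn [M0,M2,M2,M1,M3,M1,M2] (Bn [M0,M2,M2,M1,M3,M1,M1,M1] Nn
Nn) Nn)) Nn))) (Bn [M2,M1] (Bn [M0,M2,M2,M2,M2,M2,M1,M2,M2] (Bn [M0,M2,M2,M2,M2,M2,M1,M2,M1,M1] Nn Nn) (Bn [M2,M1,M3,M1,M2] (Bn [M2,M1,M3,M1,M1,M1] Nn
Nn) (Bn [M0,M2,M2,M1] (Bn [M2,M2,M2,M2,M1,M2,M2] (Bn [M2,M2,M2,M2,M1,M2,M1,M1] Nn Nn) (Bn [M0,M2,M2,M1,M3,M1,M2] (Bn [M0,M2,M2,M1,M3,M1,M1,M1] Nn Nn)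
Nn)) Nn))) Nn)) Nn))) Nn)) Nn)))) Nn)) Nn))) Nn) Nn)) Nn)"

lemma refutes_word1: "refutes cert1 [root word1]" by code_simp
lemma refutes_word2: "refutes cert2 [root word2]" by code_simp

section \<open>Transposition and soundness of the case tree\<close>

context deficient
begin

lemma transposed: "deficient Z X (\<lambda>c r. A r c) S"
proof
  fix T :: "'s set" and \<rho> \<gamma>
  assume "finite T" "inj_on \<rho> T" "inj_on \<gamma> T" "\<rho> ` T \<subseteq> Z" "\<gamma> ` T \<subseteq> X" "\<And>s. s \<in> T \<Longrightarrow> A (\<gamma> s) (\<rho> s) = s"
  then show "card T \<le> card S" by (intro maximal) auto
qed (use finite_X finite_Z finite_S card_X card_Z row_inj col_inj in auto)

definition step_cols where "step_cols C = flip_cols (exchange C)"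

lemma step_cols_simp [simp]:
  "step_cols (\<rho>, \<gamma>, x, y, w, q) = (\<rho>(A x w := x), \<gamma>(A x w := w), \<rho> (A x w), y, q, \<gamma> (A x w))"
  by (simp add: step_cols_def)

lemma valid_step_cols: "valid C \<Longrightarrow> valid ((step_cols ^^ i) C)"
  by (induction i) (auto simp: step_cols_def valid_flip_cols valid_exchange)

text \<open>Exchanging the roles of rows and columns conjugates \<open>step_cols\<close> into the
  \<open>step\<close> of the transposed array, to which the bound for rows applies.\<close>

lemma card_cols_le_6:
  assumes v: "valid C" and "card S \<le> 9"
  shows "card (range (\<lambda>i. col ((step_cols ^^ i) C))) \<le> 6"
proof -
  interpret t: deficient Z X "\<lambda>c r. A r c" S by (rule transposed)
  define tr :: "('r, 'c, 's) config \<Rightarrow> ('c, 'r, 's) config"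
    where "tr C = (case C of (\<rho>, \<gamma>, x, y, w, q) \<Rightarrow> (\<gamma>, \<rho>, w, q, x, y))" for C
  have tr1: "t.row (tr C) = col C" for C unfolding tr_def by (cases C) auto
  have tr2: "tr (step_cols C) = t.step (tr C)" for C
    unfolding tr_def step_cols_def by (cases C) simp
  have tr3: "tr ((step_cols ^^ i) C) = (t.step ^^ i) (tr C)" for i
    by (induction i) (simp_all add: tr2)
  have "t.valid (tr C)"
    using v unfolding tr_def by (cases C) (auto simp: rainbow_def t.rainbow_def)
  then have "card (t.orbit_rows (tr C)) \<le> 6" using assms(2) by (rule t.card_orbit_rows_le_6)
  then show ?thesis unfolding t.orbit_rows_def tr3[symmetric] tr1 .
qed

end

lemma set_insert_new: "set (insert_new x xs) = insert x (set xs)"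
  by (auto simp: insert_new_def)

lemma distinct_insert_new: "distinct xs \<Longrightarrow> distinct (insert_new x xs)"
  by (auto simp: insert_new_def)

context labelled
begin

lemma represents_flip:
  assumes "represents \<sigma> T L C" "valid C" shows "\<exists>C'. represents \<sigma> T (flip m L) C' \<and> valid C'"
proof -
  have "represents \<sigma> T (flip m L) (case m of M0 \<Rightarrow> C | M1 \<Rightarrow> flip_cols C | M2 \<Rightarrow> flip_rows C | M3 \<Rightarrow> flip_rows (flip_cols C)) \<and>
    valid (case m of M0 \<Rightarrow> C | M1 \<Rightarrow> flip_cols C | M2 \<Rightarrow> flip_rows C | M3 \<Rightarrow> flip_rows (flip_cols C))"
    using assms by (cases m) (simp_all add: represents_flip_rows represents_flip_cols valid_flip_rows valid_flip_cols)
  then show ?thesis by blast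
qed

lemma represents_table_swap:
  assumes "labelling \<sigma> T" "table_ok \<sigma> T tab" "represents \<sigma> T L C" "table_swap tab L = Some L'"
  shows "represents \<sigma> T L' (exchange C)"
proof -
  obtain pos a b c d where L: "L = (pos, a, b, c, d)" by (metis prod_cases5)
  obtain s where s: "entry_at a c tab = Some s" "L' = label_swap s L"
    using assms(4) unfolding table_swap_def L by (auto split: option.splits)
  have "s \<in> T" "cell_sym C = \<sigma> s"
    using entry_at_sound[OF assms(2) s(1)] represents_row_col[OF assms(3)[unfolded L]] by (simp_all add: cell_sym_def)
  then show ?thesis unfolding s(2) by (rule represents_swap[OF assms(1,3)])
qed

text \<open>Only the existence of a valid configuration at the end of the path is kept, since the
  bounds on cycles hold for every valid configuration.\<close>

lemma represents_run:
  assumes "labelling \<sigma> T" "table_ok \<sigma> T tab"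
  shows "represents \<sigma> T L C \<Longrightarrow> valid C \<Longrightarrow> run tab ms L = Some L' \<Longrightarrow> \<exists>C'. represents \<sigma> T L' C' \<and> valid C'"
proof (induction ms arbitrary: L C)
  case (Cons m ms)
  obtain C1 where C1: "represents \<sigma> T (flip m L) C1" "valid C1" using represents_flip Cons.prems(1,2) by blast
  show ?case
  proof (cases ms)
    case Nil
    then have "L' = flip m L" using Cons.prems(3) by simp
    then show ?thesis using C1 by blast
  next
    case (Cons m' ms')
    then obtain L'' where L'': "table_swap tab (flip m L) = Some L''" "run tab ms L'' = Some L'"
      using Cons.prems(3) by (auto simp: Let_def split: option.splits)
    show ?thesis
      by (rule Cons.IH[OF represents_table_swap[OF assms C1(1) L''(1)] valid_exchange[OF C1(2)] L''(2)])
  qed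
next
  case Nil
  then have "L' = L" by simp
  then show ?case using Nil by blast
qed

lemma card_line_image:
  assumes "inj_on f (lines T)" "set acc \<subseteq> lines T" "distinct acc" "f ` set acc \<subseteq> Q" "finite Q"
  shows "length acc \<le> card Q"
proof -
  have "length acc = card (f ` set acc)"
    using assms by (simp add: distinct_card card_image[OF inj_on_subset[OF assms(1,2)]])
  also have "\<dots> \<le> card Q" by (rule card_mono[OF assms(5,4)])
  finally show ?thesis .
qed

lemma finite_orbit:
  "valid C \<Longrightarrow> finite (orbit_rows C)" "valid C \<Longrightarrow> finite (range (\<lambda>i. col ((step_cols ^^ i) C)))"
proof -
  assume v: "valid C"
  have "row C \<in> X" "col C \<in> Z" if "valid C" for C :: "('r, 'c, 's) config"
    using that by (cases C rule: valid.cases; auto)+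
  then have "orbit_rows C \<subseteq> X" "range (\<lambda>i. col ((step_cols ^^ i) C)) \<subseteq> Z"
    unfolding orbit_rows_def using valid_steps[OF v] valid_step_cols[OF v] by blast+
  then show "finite (orbit_rows C)" "finite (range (\<lambda>i. col ((step_cols ^^ i) C)))"
    using finite_X finite_Z by (auto intro: finite_subset)
qed

lemma walk_rows:
  assumes "labelling \<sigma> T" "table_ok \<sigma> T tab" "valid C"
  shows "walk True tab k acc L \<Longrightarrow> represents \<sigma> T L ((step ^^ n) C) \<Longrightarrow> distinct acc \<Longrightarrow> set acc \<subseteq> lines T
    \<Longrightarrow> rl \<sigma> ` set acc \<subseteq> orbit_rows C \<Longrightarrow> 7 \<le> card (orbit_rows C)"
proof (induction k arbitrary: acc L n)
  case (Suc k)
  obtain pos a b c d where L: "L = (pos, a, b, c, d)" by (metis prod_cases5)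
  note rc = represents_row_col[OF Suc.prems(2)[unfolded L]]
  define acc' where "acc' = insert_new b (insert_new a acc)"
  obtain \<rho> \<gamma> where C: "(step ^^ n) C = (\<rho>, \<gamma>, rl \<sigma> a, rl \<sigma> b, cl \<sigma> c, cl \<sigma> d)"
    using Suc.prems(2) unfolding represents_def L by auto
  have "row ((step ^^ n) C) = rl \<sigma> a" "row ((step ^^ Suc n) C) = rl \<sigma> b" using C by simp_all
  then have ab: "rl \<sigma> a \<in> orbit_rows C" "rl \<sigma> b \<in> orbit_rows C" unfolding orbit_rows_def by (metis rangeI)+
  have acc': "distinct acc'" "set acc' \<subseteq> lines T" "rl \<sigma> ` set acc' \<subseteq> orbit_rows C"
    using Suc.prems(3-5) rc ab unfolding acc'_def by (simp_all add: set_insert_new distinct_insert_new)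
  show ?case
  proof (cases "7 \<le> length acc'")
    case True
    then show ?thesis
      using card_line_image[OF rl_inj[OF assms(1)] acc'(2,1,3) finite_orbit(1)[OF assms(3)]] by simp
  next
    case False
    then obtain L' where L': "table_swap tab L = Some L'" "walk True tab k acc' (label_flip_rows L')"
      using Suc.prems(1) unfolding L acc'_def by (auto simp: Let_def split: option.splits)
    have "represents \<sigma> T (label_flip_rows L') ((step ^^ Suc n) C)"
      using represents_flip_rows[OF represents_table_swap[OF assms(1,2) Suc.prems(2) L'(1)]] by (simp add: step_def[of "(step ^^ n) C"])
    then show ?thesis by (rule Suc.IH[OF L'(2) _ acc'])
  qed
qed simp

lemma walk_cols:
  assumes "labelling \<sigma> T" "table_ok \<sigma> T tab" "valid C"
  shows "walk False tab k acc L \<Longrightarrow> represents \<sigma> T L ((step_cols ^^ n) C) \<Longrightarrow> distinct acc \<Longrightarrow> set acc \<subseteq> lines T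
    \<Longrightarrow> cl \<sigma> ` set acc \<subseteq> range (\<lambda>i. col ((step_cols ^^ i) C)) \<Longrightarrow> 7 \<le> card (range (\<lambda>i. col ((step_cols ^^ i) C)))"
proof (induction k arbitrary: acc L n)
  case (Suc k)
  let ?Q = "range (\<lambda>i. col ((step_cols ^^ i) C))"
  obtain pos a b c d where L: "L = (pos, a, b, c, d)" by (metis prod_cases5)
  note rc = represents_row_col[OF Suc.prems(2)[unfolded L]]
  define acc' where "acc' = insert_new d (insert_new c acc)"
  obtain \<rho> \<gamma> where C: "(step_cols ^^ n) C = (\<rho>, \<gamma>, rl \<sigma> a, rl \<sigma> b, cl \<sigma> c, cl \<sigma> d)"
    using Suc.prems(2) unfolding represents_def L by auto
  have "col ((step_cols ^^ n) C) = cl \<sigma> c" "col ((step_cols ^^ Suc n) C) = cl \<sigma> d" using C by simp_all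
  then have ab: "cl \<sigma> c \<in> ?Q" "cl \<sigma> d \<in> ?Q" by (metis rangeI)+
  have acc': "distinct acc'" "set acc' \<subseteq> lines T" "cl \<sigma> ` set acc' \<subseteq> ?Q"
    using Suc.prems(3-5) rc ab unfolding acc'_def by (simp_all add: set_insert_new distinct_insert_new)
  show ?case
  proof (cases "7 \<le> length acc'")
    case True
    then show ?thesis
      using card_line_image[OF cl_inj[OF assms(1)] acc'(2,1,3) finite_orbit(2)[OF assms(3)]] by simp
  next
    case False
    then obtain L' where L': "table_swap tab L = Some L'" "walk False tab k acc' (label_flip_cols L')"
      using Suc.prems(1) unfolding L acc'_def by (auto simp: Let_def split: option.splits)
    have "represents \<sigma> T (label_flip_cols L') ((step_cols ^^ Suc n) C)"
      using represents_flip_cols[OF represents_table_swap[OF assms(1,2) Suc.prems(2) L'(1)]] by (simp add: step_cols_def[of "(step_cols ^^ n) C"])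
    then show ?thesis by (rule Suc.IH[OF L'(2) _ acc'])
  qed
qed simp

text \<open>A case is described by its table alone, without a current position, because every path
  of the tree restarts from the initial transversal.\<close>

definition realizable :: "ctxt \<Rightarrow> bool" where
  "realizable t \<longleftrightarrow> (case t of (tab, tc, fs) \<Rightarrow> (\<exists>\<sigma>. labelling \<sigma> (set tc) \<and> table_ok \<sigma> (set tc) tab) \<and>
     distinct (tc @ fs) \<and> U \<notin> set fs \<and> V \<notin> set fs \<and> length tc + length fs = 9)"

lemma violates_sound:
  assumes "card S \<le> 9" "violates r t ms" shows "\<not> realizable t"
proof
  assume "realizable t"
  obtain tab tc fs where t: "t = (tab, tc, fs)" by (metis prod_cases3)
  obtain \<sigma> where lb: "labelling \<sigma> (set tc)" "table_ok \<sigma> (set tc) tab" using \<open>realizable t\<close> unfolding realizable_def t by auto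
  obtain L where L: "run tab ms label_start = Some L" "walk r tab 60 [] L"
    using assms(2) unfolding violates_def t by (auto split: option.splits)
  have "valid start" using base by (simp add: start_def)
  then obtain C where C: "represents \<sigma> (set tc) L C" "valid C" using represents_run[OF lb represents_start[OF lb(1)] _ L(1)] by blast
  show False
  proof (cases r)
    case True
    then have "7 \<le> card (orbit_rows C)" using walk_rows[OF lb C(2), of 60 "[]" L 0] L C by simp
    then show False using card_orbit_rows_le_6[OF C(2) assms(1)] by simp
  next
    case False
    then have "7 \<le> card (range (\<lambda>i. col ((step_cols ^^ i) C)))" using walk_cols[OF lb C(2), of 60 "[]" L 0] L C by simp
    then show False using card_cols_le_6[OF C(2) assms(1)] by simp
  qed
qed

lemma expand_sound:
  assumes "card S \<le> 9" "expand t ms = Some us" "realizable t"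
  shows "\<exists>t'\<in>set us. realizable t'"
proof -
  obtain tab tc fs where t: "t = (tab, tc, fs)" by (metis prod_cases3)
  obtain \<sigma> where lb: "labelling \<sigma> (set tc)" "table_ok \<sigma> (set tc) tab" and
    fs: "distinct (tc @ fs)" "U \<notin> set fs" "V \<notin> set fs" "length tc + length fs = 9"
    using \<open>realizable t\<close> unfolding realizable_def t by auto
  obtain pos a b c d where L: "run tab ms label_start = Some (pos, a, b, c, d)" "entry_at a c tab = None"
    and us: "us = map (\<lambda>s. (Ent a c s # tab, tc, fs)) (filter (\<lambda>s. s \<notin> set (blocked a c tab)) tc) @
             (case fs of [] \<Rightarrow> [] | f # fs' \<Rightarrow> [(Ent a c f # Ent f f f # tab, tc @ [f], fs')])"
    using assms(2) unfolding expand_def t by (auto simp: Let_def split: option.splits prod.splits)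
  have "valid start" using base by (simp add: start_def)
  then obtain C where C: "represents \<sigma> (set tc) (pos, a, b, c, d) C" "valid C"
    using represents_run[OF lb represents_start[OF lb(1)] _ L(1)] by blast
  note rc = represents_row_col[OF C(1)]
  then have sC: "cell_sym C = A (rl \<sigma> a) (cl \<sigma> c)" by (simp add: cell_sym_def)
  have ac: "a \<in> lines (set tc)" "c \<in> lines (set tc)" using rc by auto
  show ?thesis
  proof (cases "cell_sym C \<in> \<sigma> ` set tc")
    case True
    then obtain s where s: "s \<in> set tc" "cell_sym C = \<sigma> s" by blast
    have "s \<notin> set (blocked a c tab)" using blocked_sound[OF lb L(2) _ ac] s(2) sC by auto
    then have "(Ent a c s # tab, tc, fs) \<in> set us" using s(1) unfolding us by simp
    moreover have "table_ok \<sigma> (set tc) (Ent a c s # tab)"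
      using lb(2) ac s sC by (intro table_ok_Cons) simp_all
    then have "realizable (Ent a c s # tab, tc, fs)" using lb(1) fs unfolding realizable_def by auto
    ultimately show ?thesis by blast
  next
    case new: False
    define s where "s = cell_sym C"
    have s: "s \<in> S" "s \<notin> \<sigma> ` set tc" using new valid_cell_sym[OF C(2)] unfolding s_def by auto
    show ?thesis
    proof (cases fs)
      case Nil
      \<comment> \<open>All nine labels are in use, so a further symbol would be the tenth in
        \<open>S\<close>.\<close>
      have "card (\<sigma> ` set tc) = 9" using lb(1) fs Nil by (simp add: labelling_def card_image distinct_card)
      then have "card (insert s (\<sigma> ` set tc)) = 10" using s(2) by simp
      moreover have "card (insert s (\<sigma> ` set tc)) \<le> card S"
        using lb(1) s(1) finite_S by (intro card_mono) (auto simp: labelling_def)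
      ultimately show ?thesis using assms(1) by simp
    next
      case (Cons f fs')
      have f: "f \<notin> lines (set tc)" "f \<notin> set tc" using fs Cons lb(1) by (auto simp: lines_def)
      let ?\<sigma> = "\<sigma>(f := s)"
      note nl = new_label[OF lb C(1) s f(1)]
      have e: "rl ?\<sigma> x = rl \<sigma> x" "cl ?\<sigma> x = cl \<sigma> x" if "x \<in> lines (set tc)" for x
        by (rule line_upd[OF that f(2)])+
      have "table_ok ?\<sigma> (insert f (set tc)) (Ent a c f # Ent f f f # tab)"
      proof (rule table_ok_Cons)
        show "{a, c} \<subseteq> lines (insert f (set tc))" using ac by (auto simp: lines_def)
        show "A (rl ?\<sigma> a) (cl ?\<sigma> c) = ?\<sigma> f" using e(1)[OF ac(1)] e(2)[OF ac(2)] sC by (simp add: s_def)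
      qed (use nl in auto)
      then have "realizable (Ent a c f # Ent f f f # tab, tc @ [f], fs')"
        using nl(1) fs Cons unfolding realizable_def by auto
      then show ?thesis unfolding us Cons by simp
    qed
  qed
qed

lemma refutes_sound:
  assumes "card S \<le> 9"
  shows "refutes g ts \<Longrightarrow> t \<in> set ts \<Longrightarrow> \<not> realizable t"
proof (induction g arbitrary: ts t)
  case (Bn ms g n)
  obtain t' ts' where ts: "ts = t' # ts'" using Bn.prems(2) by (cases ts) auto
  obtain us where us: "expand t' ms = Some us" "refutes g us" "refutes n ts'"
    using Bn.prems(1) unfolding ts by (auto split: option.splits if_splits)
  have "\<not> realizable t'" using expand_sound[OF assms us(1)] Bn.IH(1)[OF us(2)] by blast
  then show ?case using Bn.prems(2) Bn.IH(2)[OF us(3)] unfolding ts list.set by blast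
next
  case (Vn ms n)
  obtain t' ts' where ts: "ts = t' # ts'" using Vn.prems(2) by (cases ts) auto
  have "violates True t' ms" "refutes n ts'" using Vn.prems(1) unfolding ts by (auto split: if_splits)
  then show ?case using Vn.prems(2) Vn.IH violates_sound[OF assms] unfolding ts list.set by blast
next
  case (Wn ms n)
  obtain t' ts' where ts: "ts = t' # ts'" using Wn.prems(2) by (cases ts) auto
  have "violates False t' ms" "refutes n ts'" using Wn.prems(1) unfolding ts by (auto split: if_splits)
  then show ?case using Wn.prems(2) Wn.IH violates_sound[OF assms] unfolding ts list.set by blast
next
  case Nn
  then show ?case by (cases ts) auto
qed

end

context deficient
begin

text \<open>A point of the cycle from which one of the words is read becomes the new initial
  transversal; its table realizes the root of a case tree, and both trees refute their
  roots.\<close>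

theorem no_config:
  assumes v: "valid C" and S9: "card S \<le> 9"
  shows False
proof -
  have "card (orbit_rows C) \<le> 7" using card_orbit_rows_le_6[OF v S9] by simp
  then obtain i where p: "has_word ((step ^^ i) C)" using ex_has_word[OF v] by blast
  obtain \<rho> \<gamma> x y w q where C: "(step ^^ i) C = (\<rho>, \<gamma>, x, y, w, q)" by (metis prod_cases6)
  interpret labelled X Z A S \<rho> \<gamma> x y w q by standard (use valid_steps[OF v, of i] C in simp)
  obtain \<sigma> h where h: "h = word1 \<or> h = word2" "inj_on \<sigma> (set h)" "\<sigma> ` set h \<subseteq> S"
    "map \<sigma> h = map (\<lambda>n. cell_sym ((step ^^ n) ((step ^^ i) C))) [0..<length h]" using p unfolding has_word_def by blast
  have lb: "labelling \<sigma> (set h)" using h(2,3) set_h[OF h(1)] unfolding labelling_def by auto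
  have "map \<sigma> h = map orbit_sym [0..<length h]" using h(4) unfolding orbit_sym_def orbit_def start_def C .
  then have "table_ok \<sigma> (set h) (fst (follow h (table0, label_start)))" using pattern_closed(2)[OF h(1) lb] by blast
  then have "realizable (root h)"
    using lb set_h[OF h(1)] unfolding realizable_def root_def by auto
  moreover have "\<not> realizable (root h)"
    using h(1) refutes_sound[OF S9 refutes_word1] refutes_sound[OF S9 refutes_word2] by auto
  ultimately show False by blast
qed

end

section \<open>Near transversals\<close>

lemma two_more:
  assumes "B \<subseteq> X" "finite X" "card X = card B + 2"
  obtains x y where "x \<noteq> y" "{x, y} \<subseteq> X - B"
proof -
  have "card (X - B) = 2" using assms by (simp add: card_Diff_subset finite_subset)
  then show ?thesis using that by (metis card_2_iff order_refl)
qed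

theorem theorem2p5:
  fixes n :: nat and A :: "nat \<Rightarrow> nat \<Rightarrow> 'a"
  assumes "0 < n" and "n \<le> 11" and "latin_array n A"
  shows "\<exists>S. partial_transversal n A S \<and> card S \<ge> n - 1"
proof (rule ccontr)
  assume no: "\<not> ?thesis"
  let ?P = "partial_transversal n A"
  have fin: "finite {S. ?P S}"
    by (rule finite_subset[of _ "Pow ({..<n} \<times> {..<n})"]) (auto simp: partial_transversal_def)
  have "?P {}" by (simp add: partial_transversal_def)
  then have "Max (card ` {S. ?P S}) \<in> card ` {S. ?P S}" using fin by (intro Max_in) auto
  then obtain M where M: "?P M" "card M = Max (card ` {S. ?P S})" by auto
  have max: "card S \<le> card M" if "?P S" for S
    unfolding M(2) using fin that by (intro Max_ge) auto
  have small: "card M + 2 \<le> n" using no M(1) by force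
  have finM: "finite M" using M(1) unfolding partial_transversal_def by (metis finite_SigmaI finite_lessThan finite_subset)
  have inj: "inj_on fst M" "inj_on snd M" "inj_on (\<lambda>(i, j). A i j) M" and sub: "M \<subseteq> {..<n} \<times> {..<n}"
    using M(1) unfolding partial_transversal_def by auto
  define Sy where "Sy = (\<lambda>(i, j). A i j) ` M"
  have cards: "card (fst ` M) = card M" "card (snd ` M) = card M" "card Sy = card M"
    using inj unfolding Sy_def by (simp_all add: card_image)
  have sub': "fst ` M \<subseteq> {..<n}" "snd ` M \<subseteq> {..<n}" using sub by auto
  \<comment> \<open>More than two rows and columns may be missed. Two of each are kept, and
    maximality in the whole array implies maximality in this subarray.\<close>
  obtain X where X: "fst ` M \<subseteq> X" "X \<subseteq> {..<n}" "card X = card M + 2"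
    using exists_subset_between[of "fst ` M" "card M + 2" "{..<n}"] cards small sub' by auto
  obtain Z where Z: "snd ` M \<subseteq> Z" "Z \<subseteq> {..<n}" "card Z = card M + 2"
    using exists_subset_between[of "snd ` M" "card M + 2" "{..<n}"] cards small sub' by auto
  have finXZ: "finite X" "finite Z" using X(2) Z(2) finite_subset by blast+
  interpret deficient X Z A Sy
  proof
    show "inj_on (A r) Z" if "r \<in> X" for r
      using assms(3) that X(2) Z(2) unfolding latin_array_def by (auto intro: inj_on_subset)
    show "inj_on (\<lambda>r. A r c) X" if "c \<in> Z" for c
      using assms(3) that X(2) Z(2) unfolding latin_array_def by (auto intro: inj_on_subset)
    fix T :: "'a set" and \<rho> \<gamma>
    assume T: "finite T" "inj_on \<rho> T" "inj_on \<gamma> T" "\<rho> ` T \<subseteq> X" "\<gamma> ` T \<subseteq> Z" "\<And>s. s \<in> T \<Longrightarrow> A (\<rho> s) (\<gamma> s) = s"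
    let ?S = "(\<lambda>s. (\<rho> s, \<gamma> s)) ` T"
    have "?P ?S" unfolding partial_transversal_def
      using T X(2) Z(2) by (auto simp: inj_on_def)
    then have "card ?S \<le> card M" by (rule max)
    moreover have "card ?S = card T" using T(2) by (intro card_image) (auto simp: inj_on_def)
    ultimately show "card T \<le> card Sy" using cards by simp
  qed (use finXZ finM X Z cards in \<open>auto simp: Sy_def\<close>)
  define cell where "cell = inv_into M (\<lambda>(i, j). A i j)"
  have cell: "cell s \<in> M" "A (fst (cell s)) (snd (cell s)) = s" if "s \<in> Sy" for s
    using that inv_into_into[of s "\<lambda>(i, j). A i j" M] f_inv_into_f[of s "\<lambda>(i, j). A i j" M]
    unfolding cell_def Sy_def by (auto simp: case_prod_beta)
  have cellM: "cell ` Sy = M"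
    unfolding cell_def Sy_def using inj(3) by (simp add: inv_into_image_cancel)
  have inj_cell: "inj_on cell Sy" unfolding cell_def Sy_def by (rule inj_on_inv_into) simp
  define \<rho> where "\<rho> = restrict (\<lambda>s. fst (cell s)) Sy"
  define \<gamma> where "\<gamma> = restrict (\<lambda>s. snd (cell s)) Sy"
  have img: "\<rho> ` Sy = fst ` M" "\<gamma> ` Sy = snd ` M"
    unfolding \<rho>_def \<gamma>_def cellM[symmetric] image_image by simp_all
  have "inj_on \<rho> Sy" "inj_on \<gamma> Sy"
    using comp_inj_on[OF inj_cell, of fst] comp_inj_on[OF inj_cell, of snd] inj(1,2)
    unfolding \<rho>_def \<gamma>_def cellM by (simp_all add: inj_on_def)
  then have "rainbow Sy \<rho> \<gamma>"
    unfolding rainbow_def img using X(1) Z(1) cell by (simp add: \<rho>_def \<gamma>_def)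
  moreover have "\<rho> \<in> Sy \<rightarrow>\<^sub>E X" "\<gamma> \<in> Sy \<rightarrow>\<^sub>E Z"
    using X(1) Z(1) cell(1) unfolding \<rho>_def \<gamma>_def by (auto simp: image_subset_iff)
  moreover obtain x y where "x \<noteq> y" "{x, y} \<subseteq> X - \<rho> ` Sy"
    using two_more[OF X(1) finXZ(1)] X(3) cards img by metis
  moreover obtain w q where "w \<noteq> q" "{w, q} \<subseteq> Z - \<gamma> ` Sy"
    using two_more[OF Z(1) finXZ(2)] Z(3) cards img by metis
  ultimately have "valid (\<rho>, \<gamma>, x, y, w, q)" by simp
  \<comment> \<open>This is the use of \<open>n \<le> 11\<close>: the maximum transversal has at
    most \<open>n - 2\<close> symbols.\<close>
  moreover have "card Sy \<le> 9" using small cards assms(2) by simp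
  ultimately show False by (rule no_config)
qed

end
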